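(* Let $P\subset\mathbf{R}^n$ be an $n$-dimensional integral Delzant polytope, let $x_0$ be a fixed point in the interior of $P$, and let $V$, $L_V$, $\|\cdot\|_J$, $\sigma$ and the function spaces $\mathcal{E}_1,\mathcal{C}_*,\mathcal{C}_{PL},\mathcal{C}_{PL}^{\mathbf{Q}},\mathcal{C}_\infty,\mathcal{S}$ be as defined in the context. Let $\mathcal{F}$ be one of the spaces $\mathcal{E}_1$, $\mathcal{C}_*$, $\mathcal{C}_{PL}$, $\mathcal{C}_{PL}^{\mathbf{Q}}$, $\mathcal{C}_\infty$ or $\mathcal{S}$, and let $\widetilde{\mathcal{F}}=\{f\in\mathcal{F}\mid \inf_P f=f(x_0)=0\}$. Then the following are equivalent: (b)$_{\mathcal{F}}$ There exists $\delta>0$ such that $L_V(f)\ge\delta\int_{\partial P}f\,d\sigma$ for any $f\in\widetilde{\mathcal{F}}$. (J)$_{\mathcal{F}}$ There exists $\delta>0$ such that $L_V(f)\ge\delta\|f\|_J$ for any $f\in\mathcal{F}$. (K)$_{\mathcal{C}_*}$ $L_V(f)\ge0$ for any $f\in\mathcal{C}_*$, and $L_V(f)=0$ if and only if $f$ is affine. (K)$_{\mathcal{E}_1}$ $L_V(f)\ge0$ for any $f\in\mathcal{E}_1$, and $L_V(f)=0$ if and only if $f$ is affine.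
   Context: $P=\{x\in\mathbf{R}^n\mid\langle\lambda_j,x\rangle+d_j\ge0\ (j=1,\dots,r)\}$ is an $n$-dimensional integral Delzant polytope: $r$ is the number of facets, $\lambda_j\in\mathbf{Z}^n$ is primitive, $d_j\in\mathbf{Z}$, all vertices are in $\mathbf{Z}^n$, and at each vertex exactly $n$ edges meet and their primitive integral directions form a $\mathbf{Z}$-basis of $\mathbf{Z}^n$. Facets: $F_j=\{x\in P\mid\langle\lambda_j,x\rangle+d_j=0\}$. $P^\circ$ is the interior and $P^*=P^\circ\cup\bigcup_jF_j^\circ$, where $F_j^\circ$ is the relative interior of $F_j$. $\sigma$ is the Borel measure on $\partial P$ equal on $F_j$ to $|\lambda_j|^{-1}$ times $(n-1)$-dimensional Lebesgue measure. $dx$ is Lebesgue measure, $\overline{s}=\sigma(\partial P)/\mathrm{vol}(P)$, and $V$ is the (unique) affine function on $P$ such that $\int_{\partial P}\ell\,d\sigma-\int_P(\overline{s}+V)\ell\,dx=0$ for every affine function $\ell$ (it corresponds to the extremal Kähler vector field; in particular $\int_PV\,dx=0$). Put $$L_V(f)=\int_{\partial P}f\,d\sigma-\int_P(\overline{s}+V)f\,dx\in(-\infty,+\infty].$$ Function spaces. $\mathrm{CVX}(P)$ is the set of lower semicontinuous convex functions $f:P\to(-\infty,+\infty]$ with $f\not\equiv+\infty$. $\mathcal{E}_1=\mathrm{CVX}(P)\cap L^1(P)$. $\mathcal{C}_*$ is the set of $f\in\mathrm{CVX}(P)$ that are (finite and) continuous on $P^*$ and integrable on $\partial P$ with respect to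 $\sigma$. $\mathcal{C}_{PL}$ is the set of piecewise affine convex functions on $P$, i.e. maxima of finitely many affine functions; $\mathcal{C}_{PL}^{\mathbf{Q}}$ is the subset of maxima of finitely many affine functions with rational coefficients. $\mathcal{C}_\infty$ is the set of continuous convex functions on $P$ that are smooth on $P^\circ$. $\mathcal{S}$ is the set of smooth strictly convex functions $u$ on $P^\circ$ satisfying Guillemin's boundary condition: with $u_P=\sum_{j=1}^r\ell_j\log\ell_j$, $\ell_j(x)=\langle\lambda_j,x\rangle+d_j$, one has $u-u_P\in C^\infty(P)$ (so $u$ extends continuously to $P$), and for every face $F$ of $P$ the restriction $u|_{F^\circ}$ to its relative interior is strictly convex. For $f\in\mathcal{E}_1$ the $J$-norm is $$\|f\|_J=\inf_{\xi\ \mathrm{affine}}\Big(\frac{1}{\mathrm{vol}(P)}\int_P(f+\xi)\,dx-\inf_P(f+\xi)\Big).$$ *)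

theory Defs
  imports "HOL-Analysis.Analysis"
begin

definition ivec :: "int ^ 'n \<Rightarrow> real ^ 'n" where
  "ivec v = (\<chi> i. real_of_int (v $ i))"

definition primitive :: "int ^ 'n \<Rightarrow> bool" where
  "primitive v \<longleftrightarrow> Gcd (range (\<lambda>i. v $ i)) = 1"

definition is_int_basis :: "(int ^ 'n) set \<Rightarrow> bool" where
  "is_int_basis B \<longleftrightarrow>
     \<not> module.dependent ((*s) :: int \<Rightarrow> int ^ 'n \<Rightarrow> int ^ 'n) B \<and>
     module.span ((*s) :: int \<Rightarrow> int ^ 'n \<Rightarrow> int ^ 'n) B = UNIV"

text \<open>
  The defining data are the number \<open>r\<close> of facets, the normals \<open>lam j\<close> and the constants \<open>d j\<close>;
  only the values at \<open>j \<in> {1..r}\<close> matter.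
\<close>

definition ell :: "(nat \<Rightarrow> int ^ 'n) \<Rightarrow> (nat \<Rightarrow> int) \<Rightarrow> nat \<Rightarrow> real ^ 'n \<Rightarrow> real" where
  "ell lam d j x = ivec (lam j) \<bullet> x + real_of_int (d j)"

definition poly_of :: "nat \<Rightarrow> (nat \<Rightarrow> int ^ 'n) \<Rightarrow> (nat \<Rightarrow> int) \<Rightarrow> (real ^ 'n) set" where
  "poly_of r lam d = {x. \<forall>j\<in>{1..r}. ell lam d j x \<ge> 0}"

definition facet ::
  "nat \<Rightarrow> (nat \<Rightarrow> int ^ 'n) \<Rightarrow> (nat \<Rightarrow> int) \<Rightarrow> nat \<Rightarrow> (real ^ 'n) set" where
  "facet r lam d j = {x \<in> poly_of r lam d. ell lam d j x = 0}"

definition edge_directions :: "(real ^ 'n) set \<Rightarrow> real ^ 'n \<Rightarrow> (int ^ 'n) set" where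
  "edge_directions P v =
     {w. primitive w \<and> (\<exists>e. e edge_of P \<and> v \<in> e \<and> (\<exists>t>0. v + t *\<^sub>R ivec w \<in> e))}"

text \<open>
  The bijection condition says that \<open>r\<close> is the number of facets, i.e. that no inequality is
  redundant and none is repeated.
\<close>

definition integral_delzant ::
  "nat \<Rightarrow> (nat \<Rightarrow> int ^ 'n) \<Rightarrow> (nat \<Rightarrow> int) \<Rightarrow> bool" where
  "integral_delzant r lam d \<longleftrightarrow>
     (let P = poly_of r lam d in
        polytope P \<and> aff_dim P = int CARD('n) \<and>
        bij_betw (facet r lam d) {1..r} {F. F facet_of P} \<and>
        (\<forall>j\<in>{1..r}. primitive (lam j)) \<and>
        (\<forall>v. v extreme_point_of P \<longrightarrow>
           v \<in> range ivec \<and>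
           card {e. e edge_of P \<and> v \<in> e} = CARD('n) \<and>
           is_int_basis (edge_directions P v)))"

definition poly_star ::
  "nat \<Rightarrow> (nat \<Rightarrow> int ^ 'n) \<Rightarrow> (nat \<Rightarrow> int) \<Rightarrow> (real ^ 'n) set" where
  "poly_star r lam d =
     interior (poly_of r lam d) \<union> (\<Union>j\<in>{1..r}. rel_interior (facet r lam d j))"

text \<open>
  Lebesgue measure of dimension \<open>dim {x. v \<bullet> x = 0}\<close> on the affine hyperplane through \<open>p\<close>
  orthogonal to \<open>v\<close>: the image of the product Lebesgue measure under the coordinates given by an
  orthonormal basis, just as \<^const>\<open>lborel\<close> is built from \<^const>\<open>Basis\<close>. By invariance of Lebesgue
  measure under isometries the choice of the orthonormal basis does not matter. In dimension
  zero this is the unit point mass at \<open>p\<close>.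
\<close>

definition hyperplane_onb :: "'a::euclidean_space \<Rightarrow> 'a set" where
  "hyperplane_onb v =
     (SOME B. pairwise orthogonal B \<and> (\<forall>b\<in>B. norm b = 1) \<and> span B = {x. v \<bullet> x = 0})"

definition hyperplane_lborel :: "'a::euclidean_space \<Rightarrow> 'a \<Rightarrow> 'a measure" where
  "hyperplane_lborel v p =
     distr (\<Pi>\<^sub>M b\<in>hyperplane_onb v. (lborel :: real measure)) borel
       (\<lambda>t. p + (\<Sum>b\<in>hyperplane_onb v. t b *\<^sub>R b))"

definition facet_lborel ::
  "(nat \<Rightarrow> int ^ 'n) \<Rightarrow> (nat \<Rightarrow> int) \<Rightarrow> nat \<Rightarrow> (real ^ 'n) measure" where
  "facet_lborel lam d j =
     hyperplane_lborel (ivec (lam j))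
       (- (real_of_int (d j) / (norm (ivec (lam j)))\<^sup>2) *\<^sub>R ivec (lam j))"

text \<open>
  Two different facets meet in a set that is null for the hyperplane measures of both, so
  the measure below is the Borel measure on the boundary that equals \<open>1 / norm (lam j)\<close> times Lebesgue
  measure on the \<open>j\<close>-th facet.
\<close>

definition bdry_measure ::
  "nat \<Rightarrow> (nat \<Rightarrow> int ^ 'n) \<Rightarrow> (nat \<Rightarrow> int) \<Rightarrow> (real ^ 'n) measure" where
  "bdry_measure r lam d =
     (let B = frontier (poly_of r lam d) in
        measure_of B (sets (restrict_space borel B))
          (\<lambda>A. \<Sum>j\<in>{1..r}. ennreal (1 / norm (ivec (lam j))) *
                              emeasure (facet_lborel lam d j) (A \<inter> facet r lam d j)))"

abbreviation leb_on :: "'a::euclidean_space set \<Rightarrow> 'a measure" where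
  "leb_on P \<equiv> restrict_space lborel P"

definition vol :: "'a::euclidean_space set \<Rightarrow> real" where
  "vol P = measure lborel P"

definition sbar :: "nat \<Rightarrow> (nat \<Rightarrow> int ^ 'n) \<Rightarrow> (nat \<Rightarrow> int) \<Rightarrow> real" where
  "sbar r lam d =
     measure (bdry_measure r lam d) (frontier (poly_of r lam d)) / vol (poly_of r lam d)"

text \<open>
  Integral of a function with values in \<open>[-\<infinity>, \<infinity>]\<close>, as the difference of the integrals of
  positive and negative part (\<^const>\<open>e2ennreal\<close> sends negative arguments to \<open>0\<close>). It is used for
  functions bounded below on a finite measure space, where the second term is finite.
\<close>

definition ereal_integral :: "'a measure \<Rightarrow> ('a \<Rightarrow> ereal) \<Rightarrow> ereal" where
  "ereal_integral M f =
     enn2ereal (\<integral>\<^sup>+ x. e2ennreal (f x) \<partial>M) - enn2ereal (\<integral>\<^sup>+ x. e2ennreal (- f x) \<partial>M)"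

definition ereal_integrable :: "'a measure \<Rightarrow> ('a \<Rightarrow> ereal) \<Rightarrow> bool" where
  "ereal_integrable M f \<longleftrightarrow>
     f \<in> borel_measurable M \<and> (\<integral>\<^sup>+ x. e2ennreal \<bar>f x\<bar> \<partial>M) < \<infinity>"

definition affine_funs :: "('a::euclidean_space \<Rightarrow> real) set" where
  "affine_funs = {\<xi>. \<exists>a b. \<forall>x. \<xi> x = a \<bullet> x + b}"

definition affine_on :: "'a::euclidean_space set \<Rightarrow> ('a \<Rightarrow> ereal) \<Rightarrow> bool" where
  "affine_on P f \<longleftrightarrow> (\<exists>\<xi>\<in>affine_funs. \<forall>x\<in>P. f x = ereal (\<xi> x))"

definition extremal_affine ::
  "nat \<Rightarrow> (nat \<Rightarrow> int ^ 'n) \<Rightarrow> (nat \<Rightarrow> int) \<Rightarrow> (real ^ 'n \<Rightarrow> real) \<Rightarrow> bool" where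
  "extremal_affine r lam d V \<longleftrightarrow>
     V \<in> affine_funs \<and>
     (\<forall>l\<in>affine_funs.
        (\<integral>x. l x \<partial>bdry_measure r lam d)
        - (\<integral>x. (sbar r lam d + V x) * l x \<partial>leb_on (poly_of r lam d)) = 0)"

text \<open>
  Functions on \<open>P\<close> are represented by \<open>ereal\<close>-valued functions on the whole space; every notion
  below depends on their values on \<open>P\<close> only. The functional is applied to functions integrable over
  \<open>P\<close>. These are finite almost everywhere on \<open>P\<close>, so that \<^const>\<open>real_of_ereal\<close> does not affect the
  integral over \<open>P\<close>, whereas the boundary integral may be \<open>\<infinity>\<close>.
\<close>

definition L_fun ::
  "nat \<Rightarrow> (nat \<Rightarrow> int ^ 'n) \<Rightarrow> (nat \<Rightarrow> int) \<Rightarrow> (real ^ 'n \<Rightarrow> real) \<Rightarrow> (real ^ 'n \<Rightarrow> ereal) \<Rightarrow> ereal" where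
  "L_fun r lam d V f =
     ereal_integral (bdry_measure r lam d) f
     - ereal (\<integral>x. (sbar r lam d + V x) * real_of_ereal (f x) \<partial>leb_on (poly_of r lam d))"

definition J_norm :: "'a::euclidean_space set \<Rightarrow> ('a \<Rightarrow> ereal) \<Rightarrow> ereal" where
  "J_norm P f =
     (INF \<xi>\<in>affine_funs.
        ereal (1 / vol P * (\<integral>x. real_of_ereal (f x) + \<xi> x \<partial>leb_on P))
        - (INF x\<in>P. f x + ereal (\<xi> x)))"

definition lsc_on :: "'a::topological_space set \<Rightarrow> ('a \<Rightarrow> ereal) \<Rightarrow> bool" where
  "lsc_on P f \<longleftrightarrow> (\<forall>x\<in>P. f x \<le> Liminf (at x within P) f)"

definition ereal_convex_on :: "'a::real_vector set \<Rightarrow> ('a \<Rightarrow> ereal) \<Rightarrow> bool" where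
  "ereal_convex_on P f \<longleftrightarrow>
     (\<forall>x\<in>P. \<forall>y\<in>P. \<forall>t\<in>{0<..<1::real}.
        f ((1 - t) *\<^sub>R x + t *\<^sub>R y) \<le> ereal (1 - t) * f x + ereal t * f y)"

definition strictly_convex_on :: "'a::real_vector set \<Rightarrow> ('a \<Rightarrow> real) \<Rightarrow> bool" where
  "strictly_convex_on S u \<longleftrightarrow>
     convex S \<and>
     (\<forall>x\<in>S. \<forall>y\<in>S. \<forall>t\<in>{0<..<1::real}. x \<noteq> y \<longrightarrow>
        u ((1 - t) *\<^sub>R x + t *\<^sub>R y) < (1 - t) * u x + t * u y)"

text \<open>To be used for open sets only.\<close>

primrec Ck_on :: "nat \<Rightarrow> 'a::real_normed_vector set \<Rightarrow> ('a \<Rightarrow> real) \<Rightarrow> bool" where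
  "Ck_on 0 U g \<longleftrightarrow> continuous_on U g"
| "Ck_on (Suc k) U g \<longleftrightarrow>
     (\<forall>x\<in>U. g differentiable (at x)) \<and>
     (\<forall>v. Ck_on k U (\<lambda>x. frechet_derivative g (at x) v))"

definition smooth_on :: "'a::real_normed_vector set \<Rightarrow> ('a \<Rightarrow> real) \<Rightarrow> bool" where
  "smooth_on U g \<longleftrightarrow> (\<forall>k. Ck_on k U g)"

definition smooth_upto_boundary :: "'a::real_normed_vector set \<Rightarrow> ('a \<Rightarrow> real) \<Rightarrow> bool" where
  "smooth_upto_boundary P g \<longleftrightarrow>
     (\<exists>U h. open U \<and> P \<subseteq> U \<and> smooth_on U h \<and> (\<forall>x\<in>P. h x = g x))"

definition CVX :: "'a::euclidean_space set \<Rightarrow> ('a \<Rightarrow> ereal) set" where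
  "CVX P = {f. (\<forall>x\<in>P. f x \<noteq> -\<infinity>) \<and> (\<exists>x\<in>P. f x \<noteq> \<infinity>) \<and> lsc_on P f \<and> ereal_convex_on P f}"

definition E1 :: "'a::euclidean_space set \<Rightarrow> ('a \<Rightarrow> ereal) set" where
  "E1 P = {f \<in> CVX P. ereal_integrable (leb_on P) f}"

definition C_star ::
  "nat \<Rightarrow> (nat \<Rightarrow> int ^ 'n) \<Rightarrow> (nat \<Rightarrow> int) \<Rightarrow> (real ^ 'n \<Rightarrow> ereal) set" where
  "C_star r lam d =
     {f \<in> CVX (poly_of r lam d).
        (\<forall>x\<in>poly_star r lam d. f x \<noteq> \<infinity>) \<and> continuous_on (poly_star r lam d) f \<and>
        ereal_integrable (bdry_measure r lam d) f}"

definition C_PL :: "'a::euclidean_space set \<Rightarrow> ('a \<Rightarrow> ereal) set" where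
  "C_PL P =
     {f. \<exists>T. finite T \<and> T \<noteq> {} \<and> (\<forall>x\<in>P. f x = ereal (Max ((\<lambda>(a, b). a \<bullet> x + b) ` T)))}"

definition C_PL_rat :: "(real ^ 'n) set \<Rightarrow> (real ^ 'n \<Rightarrow> ereal) set" where
  "C_PL_rat P =
     {f. \<exists>T. finite T \<and> T \<noteq> {} \<and> (\<forall>(a, b)\<in>T. (\<forall>i. a $ i \<in> \<rat>) \<and> b \<in> \<rat>) \<and>
             (\<forall>x\<in>P. f x = ereal (Max ((\<lambda>(a, b). a \<bullet> x + b) ` T)))}"

definition C_infty :: "'a::euclidean_space set \<Rightarrow> ('a \<Rightarrow> ereal) set" where
  "C_infty P =
     {f. \<exists>g. (\<forall>x\<in>P. f x = ereal (g x)) \<and>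
             continuous_on P g \<and> convex_on P g \<and> smooth_on (interior P) g}"

text \<open>At the boundary the convention \<open>0 * ln 0 = 0\<close> gives the continuous extension.\<close>

definition guillemin ::
  "nat \<Rightarrow> (nat \<Rightarrow> int ^ 'n) \<Rightarrow> (nat \<Rightarrow> int) \<Rightarrow> real ^ 'n \<Rightarrow> real" where
  "guillemin r lam d x = (\<Sum>j\<in>{1..r}. ell lam d j x * ln (ell lam d j x))"

text \<open>
  A symplectic potential on the interior is identified with its continuous extension to \<open>P\<close>.
\<close>

definition S_pot ::
  "nat \<Rightarrow> (nat \<Rightarrow> int ^ 'n) \<Rightarrow> (nat \<Rightarrow> int) \<Rightarrow> (real ^ 'n \<Rightarrow> ereal) set" where
  "S_pot r lam d =
     (let P = poly_of r lam d in
       {f. \<exists>u. (\<forall>x\<in>P. f x = ereal (u x)) \<and>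
               smooth_on (interior P) u \<and> strictly_convex_on (interior P) u \<and>
               smooth_upto_boundary P (\<lambda>x. u x - guillemin r lam d x) \<and>
               (\<forall>F. F face_of P \<longrightarrow> strictly_convex_on (rel_interior F) u)})"

definition normalized ::
  "'a set \<Rightarrow> 'a \<Rightarrow> ('a \<Rightarrow> ereal) set \<Rightarrow> ('a \<Rightarrow> ereal) set" where
  "normalized P x0 \<F> = {f \<in> \<F>. (INF x\<in>P. f x) = f x0 \<and> f x0 = 0}"

definition cond_b ::
  "nat \<Rightarrow> (nat \<Rightarrow> int ^ 'n) \<Rightarrow> (nat \<Rightarrow> int) \<Rightarrow> (real ^ 'n \<Rightarrow> real) \<Rightarrow> real ^ 'n
     \<Rightarrow> (real ^ 'n \<Rightarrow> ereal) set \<Rightarrow> bool" where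
  "cond_b r lam d V x0 \<F> \<longleftrightarrow>
     (\<exists>\<delta>::real. \<delta> > 0 \<and>
        (\<forall>f\<in>normalized (poly_of r lam d) x0 \<F>.
           L_fun r lam d V f \<ge> ereal \<delta> * ereal_integral (bdry_measure r lam d) f))"

definition cond_J ::
  "nat \<Rightarrow> (nat \<Rightarrow> int ^ 'n) \<Rightarrow> (nat \<Rightarrow> int) \<Rightarrow> (real ^ 'n \<Rightarrow> real)
     \<Rightarrow> (real ^ 'n \<Rightarrow> ereal) set \<Rightarrow> bool" where
  "cond_J r lam d V \<F> \<longleftrightarrow>
     (\<exists>\<delta>::real. \<delta> > 0 \<and>
        (\<forall>f\<in>\<F>. L_fun r lam d V f \<ge> ereal \<delta> * J_norm (poly_of r lam d) f))"

definition cond_K ::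
  "nat \<Rightarrow> (nat \<Rightarrow> int ^ 'n) \<Rightarrow> (nat \<Rightarrow> int) \<Rightarrow> (real ^ 'n \<Rightarrow> real)
     \<Rightarrow> (real ^ 'n \<Rightarrow> ereal) set \<Rightarrow> bool" where
  "cond_K r lam d V \<F> \<longleftrightarrow>
     (\<forall>f\<in>\<F>. L_fun r lam d V f \<ge> 0 \<and>
        (L_fun r lam d V f = 0 \<longleftrightarrow> affine_on (poly_of r lam d) f))"

end

theory Submission
  imports Defs "HOL-Complex_Analysis.Great_Picard"
begin

text \<open>
  For normalized \<open>f\<close> the \<open>J\<close>-norm is comparable to \<open>\<integral>\<^sub>P f\<close>, and integration over the cones from \<open>x0\<close>
  over the facets gives \<open>\<integral>\<^sub>P f \<le> C \<integral>\<^sub>\<partial>\<^sub>P f d\<sigma>\<close>; together with \<open>L(f) \<ge> \<integral>\<^sub>\<partial>\<^sub>P f d\<sigma> - C \<integral>\<^sub>P f\<close> this makes (b) and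
  (J) equivalent on any class that is stable under adding affine functions. Every normalized element
  of \<open>\<E>\<^sub>1\<close> is the increasing limit of normalized rational piecewise affine functions, so (b) passes
  from these to \<open>\<E>\<^sub>1\<close>, where it implies (K). A normalized piecewise affine \<open>g\<close> is approximated from
  \<open>S\<close> by \<open>(u\<^sub>P + |x|^2 + log (\<Sum> exp (k a\<^sub>i))) / k\<close>, where \<open>g = max a\<^sub>i\<close>.

  If (b) fails for piecewise affine functions, there are normalized \<open>h\<^sub>k\<close> with \<open>\<integral>\<^sub>\<partial>\<^sub>P h\<^sub>k d\<sigma> = 1\<close> and
  \<open>L(h\<^sub>k) < 1/k\<close>. They are locally equi-Lipschitz, so a subsequence converges in the interior, and its limit
  extends radially to \<open>f \<in> C\<^sub>*\<close> with \<open>L(f) \<le> 0\<close>, since the cone estimate prevents mass of \<open>h\<^sub>k\<close> in \<open>P\<close>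
  from concentrating at the boundary. By (K), \<open>f\<close> is affine, hence zero, and \<open>L(h\<^sub>k) \<longrightarrow> 1\<close>, a contradiction.
\<close>

section \<open>Lebesgue measure on hyperplanes\<close>

text \<open>Passing from (b) to (J) requires a class closed under adding affine functions. This is
  used for \<open>E1 P\<close> and for \<open>S_pot r lam d\<close> only: the rational piecewise
  affine functions are not closed under adding real affine functions, so for them (J) is inherited
  from \<open>E1 P\<close>. For S the passage is forced, because the smoothed functions need not
  attain their minimum at \<open>x0\<close>, while (J) does not mention \<open>x0\<close>. In the
  compactness argument the limit exists only in the interior. Its boundary integral may be smaller
  than the limit of the boundary integrals, but an upper bound for L(f) is all that is wanted.
  Membership of the limit in \<open>C_star r lam d\<close> takes more work: finiteness on open
  facets comes from a mean value inequality within the facet, and upper semicontinuity from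
  convexity along rays. The facet measures are built from an orthonormal basis selected by choice.
  Their behaviour under dilations and reflections is therefore derived from that of
  \<open>lborel\<close> by Fubini, once \<open>lborel\<close> is known to be the product measure in
  every orthonormal basis.\<close>

lemma nn_integral_lborel_translate:
  fixes f :: "'a::euclidean_space \<Rightarrow> ennreal"
  assumes [measurable]: "f \<in> borel_measurable borel"
  shows "(\<integral>\<^sup>+x. f (c + x) \<partial>lborel) = (\<integral>\<^sup>+x. f x \<partial>lborel)"
  by (subst lborel_distr_plus[of c, symmetric]) (simp add: nn_integral_distr)

lemma nn_integral_lborel_scale:
  fixes f :: "'a::euclidean_space \<Rightarrow> ennreal"
  assumes [measurable]: "f \<in> borel_measurable borel" and c: "c \<noteq> 0"
  shows "(\<integral>\<^sup>+x. f x \<partial>lborel) = ennreal (\<bar>c\<bar> ^ DIM('a)) * (\<integral>\<^sup>+x. f (t + c *\<^sub>R x) \<partial>lborel)"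
  by (subst lborel_affine[OF c, of t])
     (simp add: nn_integral_density nn_integral_distr nn_integral_cmult ennreal_power)

text \<open>Fubini for the pair of the two translation-invariant measures shows that their values
  on any set have the same ratio as their values on a symmetric set.\<close>

lemma translation_invariant_measure_eq_lborel:
  fixes M :: "'a::euclidean_space measure"
  assumes sets[measurable_cong, simp]: "sets M = sets borel" and sf: "sigma_finite_measure M"
    and inv: "\<And>c. distr M borel (\<lambda>x. c + x) = M"
    and ball: "emeasure M (ball 0 1) = emeasure lborel (ball (0::'a) 1)"
  shows "M = lborel"
proof (rule measure_eqI)
  fix B assume "B \<in> sets M"
  then have B[measurable]: "B \<in> sets borel" by simp
  define A :: "'a set" where "A = ball 0 1"
  have A[measurable]: "A \<in> sets borel" by (simp add: A_def)
  interpret M: sigma_finite_measure M by fact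
  interpret pair_sigma_finite lborel M ..
  have invM: "(\<integral>\<^sup>+y. f (c + y) \<partial>M) = (\<integral>\<^sup>+y. f y \<partial>M)" if [measurable]: "f \<in> borel_measurable borel"
    for f :: "'a \<Rightarrow> ennreal" and c
    by (subst (2) inv[of c, symmetric]) (simp add: nn_integral_distr)
  have "emeasure lborel A * emeasure M B
      = (\<integral>\<^sup>+x. indicator A x * (\<integral>\<^sup>+y. indicator B (x + y) \<partial>M) \<partial>lborel)"
    by (simp add: invM[where f="indicator B"] nn_integral_multc)
  also have "\<dots> = (\<integral>\<^sup>+x. (\<integral>\<^sup>+y. indicator A x * indicator B (x + y) \<partial>M) \<partial>lborel)"
    by (intro nn_integral_cong nn_integral_cmult[symmetric]) simp
  also have "\<dots> = (\<integral>\<^sup>+y. (\<integral>\<^sup>+x. indicator A x * indicator B (x + y) \<partial>lborel) \<partial>M)"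
    by (rule Fubini'[symmetric]) measurable
  also have "\<dots> = (\<integral>\<^sup>+y. (\<integral>\<^sup>+x. indicator A (x - y) * indicator B x \<partial>lborel) \<partial>M)"
  proof (rule nn_integral_cong)
    fix y
    show "(\<integral>\<^sup>+x. indicator A x * indicator B (x + y) \<partial>lborel) =
      (\<integral>\<^sup>+x. indicator A (x - y) * indicator B x \<partial>lborel)"
      using nn_integral_lborel_translate[of "\<lambda>x. indicator A (x - y) * indicator B x" y]
      by (simp add: add.commute)
  qed
  also have "\<dots> = (\<integral>\<^sup>+x. (\<integral>\<^sup>+y. indicator A (x - y) * indicator B x \<partial>M) \<partial>lborel)"
    by (rule Fubini') measurable
  \<comment> \<open>The ball is symmetric, so the indicator at x - y is the translate by - x of a
    function of y, and invariance of M removes the translation.\<close>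
  also have "\<dots> = (\<integral>\<^sup>+x. indicator B x * (\<integral>\<^sup>+y. indicator A (- x + y) \<partial>M) \<partial>lborel)"
  proof (rule nn_integral_cong)
    fix x
    have "(\<integral>\<^sup>+y. indicator A (x - y) * indicator B x \<partial>M) = (\<integral>\<^sup>+y. indicator B x * indicator A (- x + y) \<partial>M)"
      by (intro nn_integral_cong) (auto simp: indicator_def A_def dist_norm norm_minus_commute)
    then show "(\<integral>\<^sup>+y. indicator A (x - y) * indicator B x \<partial>M) = indicator B x * (\<integral>\<^sup>+y. indicator A (- x + y) \<partial>M)"
      by (simp add: nn_integral_cmult)
  qed
  also have "\<dots> = emeasure lborel B * emeasure M A"
    by (simp only: invM[where f="indicator A", OF borel_measurable_indicator[OF A]])
       (simp add: nn_integral_multc)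
  finally have key: "emeasure lborel A * emeasure M B = emeasure lborel A * emeasure lborel B"
    unfolding A_def ball by (simp only: mult.commute)
  have "unit_ball_vol (real DIM('a)) \<noteq> 0"
    by (rule less_imp_neq[THEN not_sym], rule unit_ball_vol_pos) simp
  then have "emeasure lborel A \<noteq> 0" "emeasure lborel A \<noteq> \<infinity>"
    by (auto simp: A_def emeasure_ball)
  with key show "emeasure M B = emeasure lborel B"
    by (simp add: ennreal_mult_cancel_left)
qed (simp add: sets)

text \<open>The image measure is again translation invariant, since T is linear and surjective, and
  it gives the unit ball its old measure, since T preserves norms. Uniqueness then settles the claim
  without determinants.\<close>

lemma distr_lborel_orthogonal_transformation:
  fixes T :: "'a::euclidean_space \<Rightarrow> 'a"
  assumes T: "orthogonal_transformation T"
  shows "distr lborel borel T = lborel"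
proof (rule translation_invariant_measure_eq_lborel)
  have lin: "linear T" using T by (rule orthogonal_transformation_linear)
  have [measurable]: "T \<in> borel \<rightarrow>\<^sub>M borel"
    using lin by (intro borel_measurable_continuous_onI linear_continuous_on)
      (simp add: linear_conv_bounded_linear)
  have norm: "norm (T x) = norm x" for x using T by (rule orthogonal_transformation_norm)
  have vb: "T -` ball 0 s = ball 0 s" for s
    by (auto simp: norm dist_norm)
  show "sets (distr lborel borel T) = sets borel" by simp
  show "emeasure (distr lborel borel T) (ball 0 1) = emeasure lborel (ball (0::'a) 1)"
    by (subst emeasure_distr) (auto simp: vb)
  show "distr (distr lborel borel T) borel (\<lambda>x. c + x) = distr lborel borel T" for c
  proof -
    obtain a where a: "T a = c"
      using orthogonal_transformation_surj[OF T] by (metis surjD)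
    have "distr (distr lborel borel T) borel (\<lambda>x. c + x) = distr lborel borel (\<lambda>x. c + T x)"
      by (subst distr_distr) (auto simp: o_def)
    also have "\<dots> = distr lborel borel (T \<circ> (\<lambda>x. a + x))"
      by (simp add: o_def linear_add[OF lin] a)
    also have "\<dots> = distr (distr lborel borel (\<lambda>x. a + x)) borel T"
      by (subst distr_distr) auto
    also have "distr lborel borel (\<lambda>x. a + x) = lborel" by (rule lborel_distr_plus)
    finally show ?thesis .
  qed
  show "sigma_finite_measure (distr lborel borel T)"
  proof
    show "\<exists>A. countable A \<and> A \<subseteq> sets (distr lborel borel T) \<and> \<Union>A = space (distr lborel borel T) \<and>
      (\<forall>a\<in>A. emeasure (distr lborel borel T) a \<noteq> \<infinity>)"
    proof (intro exI[of _ "range (\<lambda>n::nat. ball 0 (real n))"] conjI ballI)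
      show "\<Union>(range (\<lambda>n::nat. ball 0 (real n))) = space (distr lborel borel T)"
        using reals_Archimedean2 by (auto simp: dist_norm)
      show "emeasure (distr lborel borel T) a \<noteq> \<infinity>" if "a \<in> range (\<lambda>n::nat. ball 0 (real n))" for a
      proof -
        from that obtain n where a: "a = ball 0 (real n)" by auto
        show ?thesis unfolding a
          by (subst emeasure_distr) (auto simp: vb emeasure_ball)
      qed
    qed auto
  qed
qed

lemma orthonormal_inner:
  assumes "pairwise orthogonal B" "\<And>b. b \<in> B \<Longrightarrow> norm b = 1" "b \<in> B" "c \<in> B"
  shows "b \<bullet> c = (if b = c then 1 else 0)"
  using assms by (auto simp: pairwise_def orthogonal_def norm_eq_1)

text \<open>A bijection from \<open>Basis\<close> to B extends linearly to an orthogonal map, which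
  preserves \<open>lborel\<close>. In the standard coordinates the claim is the product formula, so
  the basis selected in \<open>hyperplane_onb\<close> can be completed to one of the whole
  space.\<close>

lemma lborel_eq_distr_orthonormal_basis:
  fixes B :: "'a::euclidean_space set"
  assumes orth: "pairwise orthogonal B" and norm: "\<And>b. b \<in> B \<Longrightarrow> norm b = 1" and sp: "span B = UNIV"
  shows "lborel = distr (\<Pi>\<^sub>M b\<in>B. (lborel :: real measure)) borel (\<lambda>t. \<Sum>b\<in>B. t b *\<^sub>R b)"
proof -
  interpret product_sigma_finite "\<lambda>_::'a. lborel :: real measure" ..
  have "0 \<notin> B"
  proof
    assume "0 \<in> B"
    from norm[OF this] show False by simp
  qed
  with orth have ind: "independent B"
    by (rule pairwise_orthogonal_independent)
  have fin: "finite B" using finiteI_independent[OF ind] .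
  have card: "DIM('a) = card B"
    using dim_span_eq_card_independent[OF ind] sp by simp
  obtain \<beta> where \<beta>: "bij_betw \<beta> (Basis :: 'a set) B"
    using finite_same_card_bij[OF finite_Basis fin card] by blast
  note inn = orthonormal_inner[OF orth norm]
  define T where "T x = (\<Sum>e\<in>Basis. (x \<bullet> e) *\<^sub>R \<beta> e)" for x :: 'a
  have Tin: "T x \<bullet> \<beta> e = x \<bullet> e" if "e \<in> Basis" for x e
  proof -
    have "T x \<bullet> \<beta> e = (\<Sum>e'\<in>Basis. if e' = e then x \<bullet> e' else 0)"
      unfolding T_def inner_sum_left
    proof (intro sum.cong refl)
      fix e' :: 'a assume e': "e' \<in> Basis"
      have "\<beta> e' \<bullet> \<beta> e = (if \<beta> e' = \<beta> e then 1 else 0)"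
        using \<beta> that e' by (intro inn) (auto simp: bij_betw_def)
      also have "\<dots> = (if e' = e then 1 else 0)"
        using \<beta> that e' by (auto simp: bij_betw_def inj_on_def)
      finally show "(x \<bullet> e') *\<^sub>R \<beta> e' \<bullet> \<beta> e = (if e' = e then x \<bullet> e' else 0)"
        by simp
    qed
    then show ?thesis using that by simp
  qed
  have lin: "linear T" unfolding T_def
    by (intro linear_compose_sum ballI linearI) (auto simp: inner_simps algebra_simps)
  have "T x \<bullet> T y = x \<bullet> y" for x y
  proof -
    have "T x \<bullet> T y = (\<Sum>e\<in>Basis. (y \<bullet> e) * (T x \<bullet> \<beta> e))"
      by (subst (2) T_def) (simp add: inner_sum_right)
    also have "\<dots> = (\<Sum>e\<in>Basis. (x \<bullet> e) * (y \<bullet> e))"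
      by (intro sum.cong) (auto simp: Tin)
    also have "\<dots> = x \<bullet> y"
      by (rule euclidean_inner[symmetric])
    finally show ?thesis .
  qed
  with lin have T: "orthogonal_transformation T"
    by (simp add: orthogonal_transformation_def)
  have [measurable]: "T \<in> borel \<rightarrow>\<^sub>M borel"
    using lin by (intro borel_measurable_continuous_onI linear_continuous_on)
      (simp add: linear_conv_bounded_linear)
  \<comment> \<open>The coordinate map, inverse to the linear combination; restricted to B because
    the points of the product space are extensional functions.\<close>
  define c where "c x = (\<lambda>b\<in>B. x \<bullet> b)" for x :: 'a
  have c[measurable]: "c \<in> borel \<rightarrow>\<^sub>M (\<Pi>\<^sub>M b\<in>B. (lborel :: real measure))"
    unfolding c_def by (intro measurable_restrict) simp
  have "distr lborel (\<Pi>\<^sub>M b\<in>B. (lborel :: real measure)) c = (\<Pi>\<^sub>M b\<in>B. (lborel :: real measure))"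
  proof (rule PiM_eqI[OF fin])
    fix A assume A: "\<And>i. i \<in> B \<Longrightarrow> A i \<in> sets (lborel :: real measure)"
    have A'[measurable]: "A (\<beta> e) \<in> sets borel" if "e \<in> Basis" for e
      using A \<beta> that by (auto simp: bij_betw_def)
    have S: "Pi\<^sub>E B A \<in> sets (\<Pi>\<^sub>M b\<in>B. (lborel :: real measure))"
      using A fin by (intro sets_PiM_I_finite) auto
    have "emeasure (distr lborel (\<Pi>\<^sub>M b\<in>B. lborel) c) (Pi\<^sub>E B A) = emeasure (distr (distr lborel borel T) (\<Pi>\<^sub>M b\<in>B. lborel) c) (Pi\<^sub>E B A)"
      by (simp add: distr_lborel_orthogonal_transformation[OF T])
    also have "\<dots> = (\<integral>\<^sup>+x. indicator (Pi\<^sub>E B A) (c (T x)) \<partial>lborel)"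
      using S by (simp add: nn_integral_indicator[symmetric] nn_integral_distr del: nn_integral_indicator)
    also have "\<dots> = (\<integral>\<^sup>+x. (\<Prod>e\<in>Basis. indicator (A (\<beta> e)) (x \<bullet> e)) \<partial>lborel)"
    proof (rule nn_integral_cong)
      fix x :: 'a
      have "c (T x) \<in> Pi\<^sub>E B A \<longleftrightarrow> (\<forall>e\<in>Basis. x \<bullet> e \<in> A (\<beta> e))"
        using \<beta> by (auto simp: c_def PiE_iff bij_betw_def Tin)
      moreover have "(\<Prod>e\<in>Basis. indicator (A (\<beta> e)) (x \<bullet> e) :: ennreal) = (if \<forall>e\<in>Basis. x \<bullet> e \<in> A (\<beta> e) then 1 else 0)"
        by (auto simp: indicator_def intro!: prod.neutral)
      ultimately show "indicator (Pi\<^sub>E B A) (c (T x)) = (\<Prod>e\<in>Basis. indicator (A (\<beta> e)) (x \<bullet> e) :: ennreal)"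
        by (simp add: indicator_def)
    qed
    also have "\<dots> = (\<Prod>e\<in>Basis. emeasure lborel (A (\<beta> e)))"
      by (subst nn_integral_lborel_prod) auto
    also have "\<dots> = (\<Prod>b\<in>B. emeasure lborel (A b))"
      by (rule prod.reindex_bij_betw[OF \<beta>])
    finally show "emeasure (distr lborel (\<Pi>\<^sub>M b\<in>B. lborel) c) (Pi\<^sub>E B A) = (\<Prod>b\<in>B. emeasure lborel (A b))" .
  qed simp
  then have "distr (\<Pi>\<^sub>M b\<in>B. (lborel :: real measure)) borel (\<lambda>t. \<Sum>b\<in>B. t b *\<^sub>R b) =
    distr (distr lborel (\<Pi>\<^sub>M b\<in>B. (lborel :: real measure)) c) borel (\<lambda>t. \<Sum>b\<in>B. t b *\<^sub>R b)"
    by simp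
  also have "\<dots> = distr lborel borel (\<lambda>x. \<Sum>b\<in>B. c x b *\<^sub>R b)"
    by (subst distr_distr) (auto simp: o_def)
  also have "\<dots> = distr lborel borel (\<lambda>x. x)"
  proof (intro distr_cong refl)
    fix x
    have "(\<Sum>b\<in>B. c x b *\<^sub>R b) = (\<Sum>b\<in>B. (x \<bullet> b) *\<^sub>R b)"
      by (intro sum.cong) (auto simp: c_def)
    also have "\<dots> = x"
      by (rule orthonormal_basis_expand[OF orth norm _ fin]) (auto simp: sp)
    finally show "(\<Sum>b\<in>B. c x b *\<^sub>R b) = x" .
  qed
  also have "\<dots> = lborel" by (simp add: distr_id2)
  finally show ?thesis by simp
qed

lemma hyperplane_onb:
  fixes v :: "'a::euclidean_space"
  shows "pairwise orthogonal (hyperplane_onb v)" "b \<in> hyperplane_onb v \<Longrightarrow> norm b = 1"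
    "span (hyperplane_onb v) = {x. v \<bullet> x = 0}" "finite (hyperplane_onb v)"
proof -
  obtain B where "pairwise orthogonal B" "\<And>b. b \<in> B \<Longrightarrow> norm b = 1" "span B = {x. v \<bullet> x = 0}"
    using orthonormal_basis_subspace[OF subspace_hyperplane[of v]] by metis
  then have "\<exists>B. pairwise orthogonal B \<and> (\<forall>b\<in>B. norm b = 1) \<and> span B = {x. v \<bullet> x = 0}" by blast
  from someI_ex[OF this, folded hyperplane_onb_def]
  show o: "pairwise orthogonal (hyperplane_onb v)" and n: "b \<in> hyperplane_onb v \<Longrightarrow> norm b = 1"
    and "span (hyperplane_onb v) = {x. v \<bullet> x = 0}" for b
    by auto
  have "0 \<notin> hyperplane_onb v"
  proof
    assume "0 \<in> hyperplane_onb v"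
    from n[OF this] show False by simp
  qed
  with o show "finite (hyperplane_onb v)"
    using finiteI_independent[OF pairwise_orthogonal_independent] by blast
qed

lemma sets_hyperplane_lborel [simp, measurable_cong]: "sets (hyperplane_lborel v p) = sets borel"
  by (simp add: hyperplane_lborel_def)

lemma space_hyperplane_lborel [simp]: "space (hyperplane_lborel v p) = UNIV"
  by (simp add: hyperplane_lborel_def)

lemma nn_integral_hyperplane_lborel:
  assumes [measurable]: "f \<in> borel_measurable borel"
  shows "(\<integral>\<^sup>+y. f y \<partial>hyperplane_lborel v p) =
    (\<integral>\<^sup>+t. f (p + (\<Sum>b\<in>hyperplane_onb v. t b *\<^sub>R b)) \<partial>(\<Pi>\<^sub>M b\<in>hyperplane_onb v. (lborel :: real measure)))"
  by (simp add: hyperplane_lborel_def nn_integral_distr)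

lemma AE_hyperplane_lborel: "AE y in hyperplane_lborel v p. v \<bullet> y = v \<bullet> p"
proof -
  have "v \<bullet> (\<Sum>b\<in>hyperplane_onb v. t b *\<^sub>R b) = 0" for t
  proof -
    have "(\<Sum>b\<in>hyperplane_onb v. t b *\<^sub>R b) \<in> span (hyperplane_onb v)"
      by (intro span_sum span_scale span_base)
    then show ?thesis unfolding hyperplane_onb by simp
  qed
  then show ?thesis
    unfolding hyperplane_lborel_def by (subst AE_distr_iff) (auto simp: inner_add_right)
qed

text \<open>Coordinates in an orthonormal basis are bounded by the norm, so in coordinates the ball
  lies in a cube, whose product measure is finite.\<close>

lemma emeasure_hyperplane_lborel_ball:
  fixes v p :: "'a::euclidean_space"
  shows "emeasure (hyperplane_lborel v p) (ball p R) < \<infinity>"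
proof -
  interpret product_sigma_finite "\<lambda>_::'a. lborel :: real measure" ..
  let ?B = "hyperplane_onb v"
  have sub: "t \<in> (\<Pi>\<^sub>E b\<in>?B. {- R..R})"
    if t: "p + (\<Sum>b\<in>?B. t b *\<^sub>R b) \<in> ball p R" "t \<in> extensional ?B" for t
  proof -
    have "\<bar>t c\<bar> \<le> R" if c: "c \<in> ?B" for c
    proof -
      have "t c = (\<Sum>b\<in>?B. t b * (b \<bullet> c))"
        using c hyperplane_onb(4)[of v]
        by (simp add: orthonormal_inner[OF hyperplane_onb(1,2)] if_distrib cong: if_cong sum.cong)
      also have "\<dots> = (\<Sum>b\<in>?B. t b *\<^sub>R b) \<bullet> c" by (simp add: inner_sum_left)
      finally have "\<bar>t c\<bar> \<le> norm (\<Sum>b\<in>?B. t b *\<^sub>R b) * norm c"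
        by (metis Cauchy_Schwarz_ineq2)
      with t c show ?thesis by (simp add: dist_norm hyperplane_onb(2))
    qed
    with t(2) show ?thesis by (auto simp: PiE_iff abs_le_iff minus_le_iff)
  qed
  have "emeasure (hyperplane_lborel v p) (ball p R) \<le>
      emeasure (\<Pi>\<^sub>M b\<in>?B. (lborel :: real measure)) (\<Pi>\<^sub>E b\<in>?B. {- R..R})"
    unfolding hyperplane_lborel_def
  proof (subst emeasure_distr)
    show "emeasure (\<Pi>\<^sub>M b\<in>?B. (lborel :: real measure))
       ((\<lambda>t. p + (\<Sum>b\<in>?B. t b *\<^sub>R b)) -` ball p R \<inter> space (\<Pi>\<^sub>M b\<in>?B. lborel))
      \<le> emeasure (\<Pi>\<^sub>M b\<in>?B. (lborel :: real measure)) (\<Pi>\<^sub>E b\<in>?B. {- R..R})"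
      by (intro emeasure_mono subsetI sub sets_PiM_I_finite hyperplane_onb)
         (auto simp: space_PiM PiE_def)
  qed auto
  also have "\<dots> = (\<Prod>b\<in>?B. emeasure (lborel :: real measure) {- R..R})"
    using hyperplane_onb(4)[of v] by (intro emeasure_PiM) auto
  also have "\<dots> < \<infinity>"
    by (cases "- R \<le> R") (simp_all add: power_less_top_ennreal)
  finally show ?thesis .
qed

lemma emeasure_hyperplane_lborel_bounded:
  assumes "bounded A" "A \<in> sets borel"
  shows "emeasure (hyperplane_lborel v p) A < \<infinity>"
proof -
  obtain R where "A \<subseteq> ball p R" using assms(1) by (meson bounded_subset_ballD)
  then have "emeasure (hyperplane_lborel v p) A \<le> emeasure (hyperplane_lborel v p) (ball p R)"
    using assms by (intro emeasure_mono) auto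
  with emeasure_hyperplane_lborel_ball[of v p R] show ?thesis by (rule le_less_trans[rotated])
qed

lemma sigma_finite_hyperplane_lborel:
  "sigma_finite_measure (hyperplane_lborel v (p::'a::euclidean_space))"
proof
  let ?\<mu> = "hyperplane_lborel v p"
  show "\<exists>A. countable A \<and> A \<subseteq> sets ?\<mu> \<and> \<Union>A = space ?\<mu> \<and> (\<forall>a\<in>A. emeasure ?\<mu> a \<noteq> \<infinity>)"
  proof (intro exI[of _ "range (\<lambda>n::nat. ball p (real n))"] conjI ballI)
    show "\<Union>(range (\<lambda>n::nat. ball p (real n))) = space ?\<mu>"
      using reals_Archimedean2 by auto
    show "emeasure ?\<mu> a \<noteq> \<infinity>" if "a \<in> range (\<lambda>n::nat. ball p (real n))" for a
      using that emeasure_hyperplane_lborel_ball[of v p] by (auto simp: less_top)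
  qed auto
qed

text \<open>Fubini in the orthonormal basis that consists of the unit normal and the basis of the
  hyperplane. It is the bridge by which facts about \<open>lborel\<close> are transferred to
  hyperplanes and integrals over P are cut into slices parallel to a facet.\<close>

lemma nn_integral_lborel_hyperplane:
  fixes v p :: "'a::euclidean_space" and f :: "'a \<Rightarrow> ennreal"
  assumes v: "v \<noteq> 0" and [measurable]: "f \<in> borel_measurable borel"
  shows "(\<integral>\<^sup>+x. f x \<partial>lborel) =
    (\<integral>\<^sup>+\<tau>. (\<integral>\<^sup>+y. f (y + \<tau> *\<^sub>R (v /\<^sub>R norm v)) \<partial>hyperplane_lborel v p) \<partial>lborel)"
proof -
  let ?B = "hyperplane_onb v" and ?\<nu> = "v /\<^sub>R norm v"
  interpret product_sigma_finite "\<lambda>_::'a. lborel :: real measure" ..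
  have inB: "v \<bullet> b = 0" if "b \<in> ?B" for b
    using span_base[OF that] unfolding hyperplane_onb by simp
  have notin: "?\<nu> \<notin> ?B"
    using inB[of ?\<nu>] v by auto
  have sp: "span (insert ?\<nu> ?B) = UNIV"
  proof (intro set_eqI iffI UNIV_I)
    fix x
    have "v \<bullet> ?\<nu> = norm v" using v by (simp add: dot_square_norm power2_eq_square)
    then have "v \<bullet> (x - (x \<bullet> ?\<nu>) *\<^sub>R ?\<nu>) = v \<bullet> x - (x \<bullet> ?\<nu>) * norm v"
      by (simp only: inner_diff_right inner_scaleR_right)
    also have "\<dots> = 0" using v by (simp add: inner_commute)
    finally have "v \<bullet> (x - (x \<bullet> ?\<nu>) *\<^sub>R ?\<nu>) = 0" .
    then have "x - (x \<bullet> ?\<nu>) *\<^sub>R ?\<nu> \<in> span ?B" unfolding hyperplane_onb by simp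
    then show "x \<in> span (insert ?\<nu> ?B)" by (rule span_breakdown_eq[THEN iffD2, OF exI])
  qed
  have orth: "pairwise orthogonal (insert ?\<nu> ?B)"
    using hyperplane_onb(1)[of v] inB
    by (simp add: pairwise_insert orthogonal_def inner_commute)
  have [simp]: "finite ?B" by (rule hyperplane_onb)
  have "(\<integral>\<^sup>+x. f x \<partial>lborel) = (\<integral>\<^sup>+x. f (p + x) \<partial>lborel)"
    by (rule nn_integral_lborel_translate[symmetric]) measurable
  also have "\<dots> = (\<integral>\<^sup>+t. f (p + (\<Sum>b\<in>insert ?\<nu> ?B. t b *\<^sub>R b)) \<partial>(\<Pi>\<^sub>M b\<in>insert ?\<nu> ?B. (lborel :: real measure)))"
    using v
    by (subst lborel_eq_distr_orthonormal_basis[OF orth _ sp])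
       (auto simp: hyperplane_onb(2) nn_integral_distr)
  also have "\<dots> = (\<integral>\<^sup>+\<tau>. (\<integral>\<^sup>+t. f (p + (\<Sum>b\<in>insert ?\<nu> ?B. (t(?\<nu> := \<tau>)) b *\<^sub>R b)) \<partial>(\<Pi>\<^sub>M b\<in>?B. (lborel :: real measure))) \<partial>lborel)"
    using notin by (intro product_nn_integral_insert_rev) (auto simp del: sum.insert)
  also have "\<dots> = (\<integral>\<^sup>+\<tau>. (\<integral>\<^sup>+y. f (y + \<tau> *\<^sub>R ?\<nu>) \<partial>hyperplane_lborel v p) \<partial>lborel)"
  proof (intro nn_integral_cong)
    fix \<tau> :: real
    have "(\<Sum>b\<in>insert ?\<nu> ?B. (t(?\<nu> := \<tau>)) b *\<^sub>R b) = \<tau> *\<^sub>R ?\<nu> + (\<Sum>b\<in>?B. t b *\<^sub>R b)" for t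
    proof -
      have "(\<Sum>b\<in>?B. (t(?\<nu> := \<tau>)) b *\<^sub>R b) = (\<Sum>b\<in>?B. t b *\<^sub>R b)"
        using notin by (intro sum.cong) auto
      then show ?thesis using notin by (subst sum.insert) auto
    qed
    then show "(\<integral>\<^sup>+t. f (p + (\<Sum>b\<in>insert ?\<nu> ?B. (t(?\<nu> := \<tau>)) b *\<^sub>R b)) \<partial>(\<Pi>\<^sub>M b\<in>?B. (lborel :: real measure))) =
      (\<integral>\<^sup>+y. f (y + \<tau> *\<^sub>R ?\<nu>) \<partial>hyperplane_lborel v p)"
      by (subst nn_integral_hyperplane_lborel) (simp_all add: ac_simps)
  qed
  finally show ?thesis .
qed

text \<open>The dilation of the hyperplane extends to a dilation of the whole space, whose effect on
  Lebesgue measure is known; integrating over a slab of unit height recovers the hyperplane.\<close>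

lemma nn_integral_hyperplane_lborel_scale:
  fixes v p q :: "'a::euclidean_space" and f :: "'a \<Rightarrow> ennreal"
  assumes v: "v \<noteq> 0" and q: "v \<bullet> q = v \<bullet> p" and s: "s \<noteq> 0" and [measurable]: "f \<in> borel_measurable borel"
  shows "(\<integral>\<^sup>+y. f y \<partial>hyperplane_lborel v p) =
    ennreal (\<bar>s\<bar> ^ (DIM('a) - 1)) * (\<integral>\<^sup>+y. f (q + s *\<^sub>R (y - q)) \<partial>hyperplane_lborel v p)"
proof -
  let ?\<mu> = "hyperplane_lborel v p" and ?\<nu> = "v /\<^sub>R norm v"
  interpret \<mu>: sigma_finite_measure ?\<mu> by (rule sigma_finite_hyperplane_lborel)
  define h where "h x = ?\<nu> \<bullet> (x - p)" for x
  define g where "g x = f (x - h x *\<^sub>R ?\<nu>) * indicator {0..1} (h x)" for x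
  have [measurable]: "h \<in> borel_measurable borel" unfolding h_def by measurable
  have [measurable]: "g \<in> borel_measurable borel" unfolding g_def by measurable
  have nn: "?\<nu> \<bullet> ?\<nu> = 1" using v by (simp add: dot_square_norm power2_eq_square)
  have vq: "?\<nu> \<bullet> q = ?\<nu> \<bullet> p" using q by simp
  have AE: "AE y in ?\<mu>. ?\<nu> \<bullet> y = ?\<nu> \<bullet> p"
    using AE_hyperplane_lborel[of v p] by eventually_elim simp
  have lhs: "(\<integral>\<^sup>+x. g x \<partial>lborel) = (\<integral>\<^sup>+y. f y \<partial>?\<mu>)"
  proof -
    have "(\<integral>\<^sup>+x. g x \<partial>lborel) = (\<integral>\<^sup>+\<tau>. (\<integral>\<^sup>+y. g (y + \<tau> *\<^sub>R ?\<nu>) \<partial>?\<mu>) \<partial>lborel)"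
      by (rule nn_integral_lborel_hyperplane[OF v]) measurable
    also have "\<dots> = (\<integral>\<^sup>+\<tau>. (\<integral>\<^sup>+y. f y * indicator {0..1::real} \<tau> \<partial>?\<mu>) \<partial>lborel)"
    proof (rule nn_integral_cong)
      fix \<tau> :: real
      have "AE y in ?\<mu>. g (y + \<tau> *\<^sub>R ?\<nu>) = f y * indicator {0..1::real} \<tau>"
        using AE
      proof eventually_elim
        case (elim y)
        have "h (y + \<tau> *\<^sub>R ?\<nu>) = \<tau>"
          unfolding h_def using elim nn by (simp only: inner_diff_right inner_add_right inner_scaleR_right)
        then show ?case by (simp add: g_def)
      qed
      then show "(\<integral>\<^sup>+y. g (y + \<tau> *\<^sub>R ?\<nu>) \<partial>?\<mu>) = (\<integral>\<^sup>+y. f y * indicator {0..1::real} \<tau> \<partial>?\<mu>)"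
        by (rule nn_integral_cong_AE)
    qed
    also have "\<dots> = (\<integral>\<^sup>+y. f y \<partial>?\<mu>)"
      by (simp add: nn_integral_multc nn_integral_cmult)
    finally show ?thesis .
  qed
  have rhs: "(\<integral>\<^sup>+x. g (q + s *\<^sub>R (x - q)) \<partial>lborel) = (\<integral>\<^sup>+y. f (q + s *\<^sub>R (y - q)) \<partial>?\<mu>) * ennreal (1 / \<bar>s\<bar>)"
  proof -
    have "(\<integral>\<^sup>+x. g (q + s *\<^sub>R (x - q)) \<partial>lborel) = (\<integral>\<^sup>+\<tau>. (\<integral>\<^sup>+y. g (q + s *\<^sub>R (y + \<tau> *\<^sub>R ?\<nu> - q)) \<partial>?\<mu>) \<partial>lborel)"
      by (rule nn_integral_lborel_hyperplane[OF v]) measurable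
    also have "\<dots> = (\<integral>\<^sup>+\<tau>. (\<integral>\<^sup>+y. f (q + s *\<^sub>R (y - q)) * indicator {0..1} (s * \<tau>) \<partial>?\<mu>) \<partial>lborel)"
    proof (rule nn_integral_cong)
      fix \<tau> :: real
      have "AE y in ?\<mu>. g (q + s *\<^sub>R (y + \<tau> *\<^sub>R ?\<nu> - q)) = f (q + s *\<^sub>R (y - q)) * indicator {0..1} (s * \<tau>)"
        using AE
      proof eventually_elim
        case (elim y)
        have h: "h (q + s *\<^sub>R (y + \<tau> *\<^sub>R ?\<nu> - q)) = s * \<tau>"
          unfolding h_def using elim nn vq
          by (simp only: inner_diff_right inner_add_right inner_scaleR_right) (simp add: algebra_simps)
        have "q + s *\<^sub>R (y + \<tau> *\<^sub>R ?\<nu> - q) - (s * \<tau>) *\<^sub>R ?\<nu> = q + s *\<^sub>R (y - q)"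
          by (simp add: algebra_simps)
        then show ?case by (simp only: g_def h)
      qed
      then show "(\<integral>\<^sup>+y. g (q + s *\<^sub>R (y + \<tau> *\<^sub>R ?\<nu> - q)) \<partial>?\<mu>) =
          (\<integral>\<^sup>+y. f (q + s *\<^sub>R (y - q)) * indicator {0..1} (s * \<tau>) \<partial>?\<mu>)"
        by (rule nn_integral_cong_AE)
    qed
    also have "\<dots> = (\<integral>\<^sup>+y. f (q + s *\<^sub>R (y - q)) \<partial>?\<mu>) * (\<integral>\<^sup>+\<tau>. indicator {0..1} (s * \<tau>) \<partial>lborel)"
      by (simp add: nn_integral_multc nn_integral_cmult)
    \<comment> \<open>The height of the slab scales as well; this factor lowers the exponent from
      the full dimension to that of the hyperplane.\<close>
    also have "(\<integral>\<^sup>+\<tau>. indicator {0..1} (s * \<tau>) \<partial>lborel) = ennreal (1 / \<bar>s\<bar>)"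
    proof -
      have "1 = \<bar>s\<bar> * (\<integral>\<^sup>+\<tau>. indicator {0..1::real} (0 + s * \<tau>) \<partial>lborel)"
        using nn_integral_real_affine[of "indicator {0..1::real}" s 0] s by simp
      then have "ennreal (1 / \<bar>s\<bar>) * 1 = ennreal (1 / \<bar>s\<bar>) * (\<bar>s\<bar> * (\<integral>\<^sup>+\<tau>. indicator {0..1::real} (s * \<tau>) \<partial>lborel))"
        by simp
      also have "\<dots> = (\<integral>\<^sup>+\<tau>. indicator {0..1::real} (s * \<tau>) \<partial>lborel)"
        using s by (simp add: mult.assoc[symmetric] ennreal_mult'[symmetric])
      finally show ?thesis by simp
    qed
    finally show ?thesis .
  qed
  have "(\<integral>\<^sup>+y. f y \<partial>?\<mu>) = ennreal (\<bar>s\<bar> ^ DIM('a)) * (\<integral>\<^sup>+x. g ((q - s *\<^sub>R q) + s *\<^sub>R x) \<partial>lborel)"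
    unfolding lhs[symmetric] by (rule nn_integral_lborel_scale) (use s in auto)
  also have "(\<lambda>x. g ((q - s *\<^sub>R q) + s *\<^sub>R x)) = (\<lambda>x. g (q + s *\<^sub>R (x - q)))"
    by (simp add: algebra_simps)
  also have "ennreal (\<bar>s\<bar> ^ DIM('a)) * (\<integral>\<^sup>+x. g (q + s *\<^sub>R (x - q)) \<partial>lborel) =
      ennreal (\<bar>s\<bar> ^ DIM('a)) * ennreal (1 / \<bar>s\<bar>) * (\<integral>\<^sup>+y. f (q + s *\<^sub>R (y - q)) \<partial>?\<mu>)"
    unfolding rhs by (simp add: ac_simps)
  also have "ennreal (\<bar>s\<bar> ^ DIM('a)) * ennreal (1 / \<bar>s\<bar>) = ennreal (\<bar>s\<bar> ^ (DIM('a) - 1))"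
    using s DIM_positive[where 'a='a]
    by (cases "DIM('a)") (auto simp: ennreal_mult'[symmetric])
  finally show ?thesis .
qed

section \<open>Lower semicontinuous convex functions\<close>

lemma openin_lsc_greater:
  assumes "lsc_on P f" shows "openin (top_of_set P) {x \<in> P. c < f x}"
proof (subst openin_subopen, intro ballI)
  fix x assume x: "x \<in> {x \<in> P. c < f x}"
  then have "c < Liminf (at x within P) f"
    using assms by (auto simp: lsc_on_def intro: less_le_trans)
  then have "eventually (\<lambda>y. c < f y) (at x within P)" by (rule less_LiminfD)
  then obtain S where S: "open S" "x \<in> S" "\<And>y. y \<in> S \<Longrightarrow> y \<noteq> x \<Longrightarrow> y \<in> P \<Longrightarrow> c < f y"
    unfolding eventually_at_topological by auto
  have "P \<inter> S \<subseteq> {x \<in> P. c < f x}" using S(3) x by blast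
  with S x show "\<exists>T. openin (top_of_set P) T \<and> x \<in> T \<and> T \<subseteq> {x \<in> P. c < f x}"
    by (intro exI[of _ "P \<inter> S"]) auto
qed

lemma measurable_lsc_on:
  fixes f :: "'a::topological_space \<Rightarrow> ereal"
  assumes lsc: "lsc_on P f" and P: "P \<in> sets borel"
  shows "f \<in> borel_measurable (restrict_space borel P)"
proof (rule borel_measurableI_greater)
  fix c :: ereal
  obtain T where "open T" "{x \<in> P. c < f x} = P \<inter> T"
    using openin_lsc_greater[OF lsc, of c] unfolding openin_open by blast
  moreover have "{x \<in> space (restrict_space borel P). c < f x} = {x \<in> P. c < f x}"
    by (auto simp: space_restrict_space)
  ultimately show "{x \<in> space (restrict_space borel P). c < f x} \<in> sets (restrict_space borel P)"
    using P by (simp add: sets_restrict_space_iff)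
qed

text \<open>Since f omits the value - \<infinity>, the relatively open sets where f exceeds - n
  cover P, and finitely many of them suffice.\<close>

lemma lsc_on_compact_bounded_below:
  fixes f :: "'a::topological_space \<Rightarrow> ereal"
  assumes lsc: "lsc_on P f" and P: "compact P" and f: "\<And>x. x \<in> P \<Longrightarrow> f x \<noteq> -\<infinity>"
  obtains m :: real where "\<And>x. x \<in> P \<Longrightarrow> ereal m \<le> f x"
proof -
  have "\<forall>n::nat. \<exists>T. open T \<and> {x \<in> P. ereal (- real n) < f x} = P \<inter> T"
    using openin_lsc_greater[OF lsc] unfolding openin_open by blast
  then obtain T where T: "\<And>n::nat. open (T n)" "\<And>n. {x \<in> P. ereal (- real n) < f x} = P \<inter> T n"
    by metis
  have "P \<subseteq> (\<Union>n\<in>UNIV. T n)"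
  proof
    fix x assume x: "x \<in> P"
    have "\<exists>n::nat. ereal (- real n) < f x"
    proof (cases "f x")
      case (real z)
      obtain n :: nat where "- z < real n" using reals_Archimedean2 by blast
      then show ?thesis using real by (intro exI[of _ n]) simp
    qed (use f[OF x] in auto)
    then show "x \<in> (\<Union>n\<in>UNIV. T n)" using T(2) x by blast
  qed
  then obtain C where C: "finite C" "P \<subseteq> (\<Union>n\<in>C. T n)"
    by (rule compactE_image[OF P T(1)]) simp
  show ?thesis
  proof (rule that)
    fix x assume x: "x \<in> P"
    then obtain n where n: "n \<in> C" "x \<in> T n" using C by blast
    then have "ereal (- real n) < f x" using T(2)[of n] x by blast
    moreover have "n \<le> Max C" using n C by simp
    ultimately show "ereal (- real (Max C)) \<le> f x"
      by (intro less_imp_le) (simp add: order_le_less_trans[rotated])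
  qed
qed

section \<open>Affine minorants and subgradients of extended-valued convex functions\<close>

definition epigraph :: "'a set \<Rightarrow> ('a \<Rightarrow> ereal) \<Rightarrow> ('a \<times> real) set" where
  "epigraph P f = {(x, z). x \<in> P \<and> f x \<le> ereal z}"

lemma ereal_convex_onD:
  assumes "ereal_convex_on P f" "x \<in> P" "y \<in> P" "0 < t" "t < 1"
  shows "f ((1 - t) *\<^sub>R x + t *\<^sub>R y) \<le> ereal (1 - t) * f x + ereal t * f y"
  using assms by (auto simp: ereal_convex_on_def)

lemma ereal_convex_on_le:
  assumes "ereal_convex_on P f" "x \<in> P" "y \<in> P" "0 \<le> t" "t \<le> 1" "f x \<le> ereal a" "f y \<le> ereal b"
  shows "f ((1 - t) *\<^sub>R x + t *\<^sub>R y) \<le> ereal ((1 - t) * a + t * b)"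
proof (cases "t = 0 \<or> t = 1")
  case True
  then show ?thesis using assms by auto
next
  case False
  then have t: "0 < t" "t < 1" using assms by auto
  have "f ((1 - t) *\<^sub>R x + t *\<^sub>R y) \<le> ereal (1 - t) * f x + ereal t * f y"
    by (rule ereal_convex_onD[OF assms(1-3) t])
  also have "\<dots> \<le> ereal (1 - t) * ereal a + ereal t * ereal b"
    using t assms by (intro add_mono ereal_mult_left_mono) auto
  finally show ?thesis by simp
qed

lemma convex_epigraph:
  assumes "ereal_convex_on P f" "convex P"
  shows "convex (epigraph P f)"
  unfolding convex_alt epigraph_def
  using assms by (auto simp: ereal_convex_on_le convex_alt)

lemma closed_epigraph:
  fixes f :: "'a::topological_space \<Rightarrow> ereal"
  assumes lsc: "lsc_on P f" and P: "closed P"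
  shows "closed (epigraph P f)"
  unfolding closed_def
proof (subst open_subopen, intro ballI)
  fix p assume p: "p \<in> - epigraph P f"
  obtain x z where xz: "p = (x, z)" by (cases p)
  show "\<exists>T. open T \<and> p \<in> T \<and> T \<subseteq> - epigraph P f"
  proof (cases "x \<in> P")
    case False
    then show ?thesis using P
      by (intro exI[of _ "(- P) \<times> UNIV"]) (auto simp: xz epigraph_def intro!: open_Times)
  next
    case True
    with p have "ereal z < f x" by (auto simp: xz epigraph_def)
    then obtain w where w: "ereal z < ereal w" "ereal w < f x" by (metis ereal_dense2)
    obtain T where T: "open T" "{y \<in> P. ereal w < f y} = P \<inter> T"
      using openin_lsc_greater[OF lsc, of "ereal w"] unfolding openin_open by blast
    have "T \<times> {..<w} \<subseteq> - epigraph P f"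
    proof
      fix q assume q: "q \<in> T \<times> {..<w}"
      show "q \<in> - epigraph P f"
      proof
        assume "q \<in> epigraph P f"
        then obtain y u where yu: "q = (y, u)" "y \<in> P" "f y \<le> ereal u" by (auto simp: epigraph_def)
        then have "y \<in> {y \<in> P. ereal w < f y}" using q T by auto
        then have "ereal w < ereal u" using yu less_le_trans[of "ereal w" "f y" "ereal u"] by blast
        then show False using q yu by simp
      qed
    qed
    moreover have "p \<in> T \<times> {..<w}" using w T True by (auto simp: xz)
    ultimately show ?thesis using T by (intro exI[of _ "T \<times> {..<w}"]) (auto simp: open_Times)
  qed
qed

text \<open>Separation of \<open>(y, t)\<close> from the closed convex epigraph. The separating
  hyperplane may be vertical when f y is infinite, and then it is not the graph of an affine
  function; in this case nonnegativity of f supplies a minorant.\<close>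

lemma lsc_convex_affine_minorant:
  fixes f :: "'a::euclidean_space \<Rightarrow> ereal"
  assumes P: "closed P" "convex P" and lsc: "lsc_on P f" and cvx: "ereal_convex_on P f"
    and nonneg: "\<And>x. x \<in> P \<Longrightarrow> 0 \<le> f x" and y: "y \<in> P" and t: "ereal t < f y"
  obtains a b where "\<And>x. x \<in> P \<Longrightarrow> ereal (a \<bullet> x + b) \<le> f x" "t < a \<bullet> y + b"
proof (cases "\<forall>x\<in>P. f x = \<infinity>")
  case True
  then show ?thesis using that[of 0 "t + 1"] by simp
next
  case False
  then obtain x1 z1 where x1: "x1 \<in> P" "f x1 = ereal z1"
    using nonneg by (metis ereal_cases ereal_infty_less_eq(2) not_infty_ereal zero_ereal_def ereal_less_eq(2))
  have "(y, t) \<notin> epigraph P f" using t by (auto simp: epigraph_def)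
  from separating_hyperplane_closed_point[OF convex_epigraph[OF cvx P(2)] closed_epigraph[OF lsc P(1)] this]
  obtain p c where pc: "p \<bullet> (y, t) < c" "\<And>q. q \<in> epigraph P f \<Longrightarrow> c < p \<bullet> q" by blast
  obtain \<alpha> \<beta> where p: "p = (\<alpha>, \<beta>)" by (cases p)
  have sep: "\<alpha> \<bullet> y + \<beta> * t < c" using pc(1) by (simp add: p inner_Pair)
  have epi: "c < \<alpha> \<bullet> x + \<beta> * z" if "x \<in> P" "f x \<le> ereal z" for x z
    using pc(2)[of "(x, z)"] that by (simp add: p inner_Pair epigraph_def)
  \<comment> \<open>The epigraph is closed under moving upwards, and with a negative \<beta> this
    would push the linear form below c.\<close>
  have "\<beta> \<ge> 0"
  proof (rule ccontr)
    assume "\<not> \<beta> \<ge> 0"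
    define s where "s = (\<alpha> \<bullet> x1 + \<beta> * z1 - c) / (- \<beta>)"
    have "\<alpha> \<bullet> x1 + \<beta> * z1 - c > 0" using epi[of x1 z1] x1 by simp
    then have "s \<ge> 0" using \<open>\<not> \<beta> \<ge> 0\<close> unfolding s_def by (intro divide_nonneg_pos) auto
    then have "c < \<alpha> \<bullet> x1 + \<beta> * (z1 + s)" using epi[of x1 "z1 + s"] x1 by simp
    moreover have "\<beta> * s = - (\<alpha> \<bullet> x1 + \<beta> * z1 - c)" using \<open>\<not> \<beta> \<ge> 0\<close> by (simp add: s_def)
    ultimately show False by (simp add: distrib_left)
  qed
  then consider "\<beta> > 0" | "\<beta> = 0" by linarith
  then show ?thesis
  proof cases
    case 1
    show ?thesis
    proof (rule that)
      fix x assume x: "x \<in> P"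
      show "ereal ((- (1 / \<beta>) *\<^sub>R \<alpha>) \<bullet> x + c / \<beta>) \<le> f x"
      proof (cases "f x")
        case (real z)
        with epi[OF x, of z] 1 show ?thesis by (simp add: field_simps)
      next
        case PInf
        then show ?thesis by simp
      next
        case MInf
        then show ?thesis using nonneg[OF x] by simp
      qed
    next
      show "t < (- (1 / \<beta>) *\<^sub>R \<alpha>) \<bullet> y + c / \<beta>" using sep 1 by (simp add: field_simps)
    qed
  next
    case 2
    \<comment> \<open>The affine function c - \<alpha> \<bullet> x is negative wherever f is finite
      and positive at y. Every positive multiple stays below f \<ge> 0, and this multiple takes the
      value \<bar>t\<bar> + 1 > t at y.\<close>
    define N where "N = (\<bar>t\<bar> + 1) / (c - \<alpha> \<bullet> y)"
    have gap: "c - \<alpha> \<bullet> y > 0" using sep 2 by simp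
    then have N: "N > 0" "N * (c - \<alpha> \<bullet> y) = \<bar>t\<bar> + 1" by (auto simp: N_def intro!: divide_pos_pos)
    show ?thesis
    proof (rule that)
      fix x assume x: "x \<in> P"
      show "ereal ((- N *\<^sub>R \<alpha>) \<bullet> x + N * c) \<le> f x"
      proof (cases "f x")
        case (real z)
        have "c < \<alpha> \<bullet> x" using epi[OF x, of z] real 2 by simp
        then have "N * (c - \<alpha> \<bullet> x) \<le> 0" using N by (simp add: mult_le_0_iff)
        then have "ereal ((- N *\<^sub>R \<alpha>) \<bullet> x + N * c) \<le> 0" by (simp add: algebra_simps zero_ereal_def)
        also have "\<dots> \<le> f x" by (rule nonneg[OF x])
        finally show ?thesis .
      next
        case PInf
        then show ?thesis by simp
      next
        case MInf
        then show ?thesis using nonneg[OF x] by simp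
      qed
    next
      show "t < (- N *\<^sub>R \<alpha>) \<bullet> y + N * c" using N(2) by (simp add: algebra_simps)
    qed
  qed
qed

definition rational_affine :: "((real ^ 'n) \<times> real) set" where
  "rational_affine = {(a, b). (\<forall>i. a $ i \<in> \<rat>) \<and> b \<in> \<rat>}"

lemma countable_rational_affine: "countable rational_affine"
proof -
  have "rational_affine \<subseteq> range (\<lambda>(g :: 'n \<Rightarrow> rat, q). ((\<chi> i. of_rat (g i)) :: real ^ 'n, of_rat q :: real))"
  proof
    fix p :: "(real ^ 'n) \<times> real" assume p: "p \<in> rational_affine"
    obtain a b where ab: "p = (a, b)" by (cases p)
    with p have "\<forall>i. \<exists>q. a $ i = of_rat q" "\<exists>q. b = of_rat q"
      by (auto simp: rational_affine_def Rats_def)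
    then obtain g q where "\<And>i. a $ i = of_rat (g i)" "b = of_rat q" by metis
    then have "p = (\<lambda>(g, q). ((\<chi> i. of_rat (g i)), of_rat q)) (g, q)"
      by (simp add: ab vec_eq_iff)
    then show "p \<in> range (\<lambda>(g :: 'n \<Rightarrow> rat, q). ((\<chi> i. of_rat (g i)) :: real ^ 'n, of_rat q :: real))"
      by (rule range_eqI)
  qed
  then show ?thesis by (rule countable_subset) simp
qed

text \<open>The strict inequality at y leaves a margin of 4 \<eta>. On the bounded set P a rational
  slope close to a changes values by at most \<eta>, and lowering the constant by an amount between
  \<eta> and 2 \<eta> restores the minorant, so at y less than 3 \<eta> is lost.\<close>

lemma lsc_convex_rational_minorant:
  fixes f :: "real ^ 'n \<Rightarrow> ereal"
  assumes P: "compact P" "convex P" and lsc: "lsc_on P f" and cvx: "ereal_convex_on P f"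
    and nonneg: "\<And>x. x \<in> P \<Longrightarrow> 0 \<le> f x" and y: "y \<in> P" and t: "ereal t < f y"
  obtains a b where "(a, b) \<in> rational_affine" "\<And>x. x \<in> P \<Longrightarrow> ereal (a \<bullet> x + b) \<le> f x" "t < a \<bullet> y + b"
proof -
  obtain a b where ab: "\<And>x. x \<in> P \<Longrightarrow> ereal (a \<bullet> x + b) \<le> f x" "t < a \<bullet> y + b"
    using lsc_convex_affine_minorant[OF compact_imp_closed[OF P(1)] P(2) lsc cvx nonneg y t] by metis
  define \<eta> where "\<eta> = (a \<bullet> y + b - t) / 4"
  have \<eta>: "\<eta> > 0" using ab(2) by (simp add: \<eta>_def)
  obtain R where R: "R > 0" "\<And>x. x \<in> P \<Longrightarrow> norm x \<le> R"
    using compact_imp_bounded[OF P(1)] bounded_pos by metis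
  define \<epsilon> where "\<epsilon> = \<eta> / (R * real CARD('n))"
  have \<epsilon>: "\<epsilon> > 0" using \<eta> R by (simp add: \<epsilon>_def)
  have "\<forall>i. \<exists>q\<in>\<rat>. a $ i < q \<and> q < a $ i + \<epsilon>"
    using \<epsilon> by (intro allI Rats_dense_in_real) simp
  then obtain g where g: "\<And>i. g i \<in> \<rat>" "\<And>i. a $ i < g i" "\<And>i. g i < a $ i + \<epsilon>" by metis
  obtain q where q: "q \<in> \<rat>" "b - 2 * \<eta> < q" "q < b - \<eta>"
    using Rats_dense_in_real[of "b - 2 * \<eta>" "b - \<eta>"] \<eta> by auto
  define a' where "a' = (\<chi> i. g i)"
  have "norm (a' - a) \<le> (\<Sum>i\<in>UNIV. \<bar>(a' - a) $ i\<bar>)" by (rule norm_le_l1_cart)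
  also have "\<dots> \<le> (\<Sum>i\<in>(UNIV :: 'n set). \<epsilon>)"
  proof (intro sum_mono)
    fix i show "\<bar>(a' - a) $ i\<bar> \<le> \<epsilon>" using g(2)[of i] g(3)[of i] by (simp add: a'_def)
  qed
  finally have na: "norm (a' - a) * R \<le> \<eta>" using R by (simp add: \<epsilon>_def field_simps)
  have close: "\<bar>a' \<bullet> x - a \<bullet> x\<bar> \<le> \<eta>" if "x \<in> P" for x
  proof -
    have "\<bar>a' \<bullet> x - a \<bullet> x\<bar> \<le> norm (a' - a) * norm x"
      using Cauchy_Schwarz_ineq2[of "a' - a" x] by (simp add: inner_diff_left)
    also have "\<dots> \<le> norm (a' - a) * R" using R that by (intro mult_left_mono) auto
    finally show ?thesis using na by simp
  qed
  show ?thesis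
  proof (rule that)
    show "(a', q) \<in> rational_affine" using g q by (simp add: rational_affine_def a'_def)
    show "ereal (a' \<bullet> x + q) \<le> f x" if "x \<in> P" for x
    proof -
      have "a' \<bullet> x + q \<le> a \<bullet> x + b" using close[OF that] q by linarith
      then show ?thesis using ab(1)[OF that] by (metis ereal_less_eq(3) order_trans)
    qed
    show "t < a' \<bullet> y + q" 
    proof -
      have "4 * \<eta> = a \<bullet> y + b - t" unfolding \<eta>_def by simp
      then show ?thesis using close[OF y] q \<eta> by linarith
    qed
  qed
qed

definition max_affine :: "('a::euclidean_space \<times> real) set \<Rightarrow> 'a \<Rightarrow> real" where
  "max_affine T x = Max ((\<lambda>(a, b). a \<bullet> x + b) ` T)"

lemma max_affine_ge: "finite T \<Longrightarrow> (a, b) \<in> T \<Longrightarrow> a \<bullet> x + b \<le> max_affine T x"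
  unfolding max_affine_def by (rule Max_ge) force+

lemma max_affine_in:
  assumes "finite T" "T \<noteq> {}"
  obtains a b where "(a, b) \<in> T" "max_affine T x = a \<bullet> x + b"
proof -
  have "max_affine T x \<in> (\<lambda>(a, b). a \<bullet> x + b) ` T"
    unfolding max_affine_def using assms by (intro Max_in) auto
  then show ?thesis using that by auto
qed

lemma max_affine_mono: "finite T' \<Longrightarrow> T \<noteq> {} \<Longrightarrow> T \<subseteq> T' \<Longrightarrow> max_affine T x \<le> max_affine T' x"
  unfolding max_affine_def by (intro Max_mono) auto

text \<open>There are only countably many rational affine minorants, and their supremum is f; finite
  sections of an enumeration give the sequence. The zero function is put into every
  \<open>T k\<close> so that the approximants are nonnegative, and hence vanish at \<open>x0\<close>
  if f does: they inherit the normalization.\<close>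

lemma lsc_convex_rational_PL_approx:
  fixes f :: "real ^ 'n \<Rightarrow> ereal"
  assumes P: "compact P" "convex P" and lsc: "lsc_on P f" and cvx: "ereal_convex_on P f"
    and nonneg: "\<And>x. x \<in> P \<Longrightarrow> 0 \<le> f x"
  obtains T :: "nat \<Rightarrow> ((real ^ 'n) \<times> real) set"
  where "\<And>k. finite (T k)" "\<And>k. (0, 0) \<in> T k" "\<And>k. T k \<subseteq> rational_affine" "incseq T"
    "\<And>k x. x \<in> P \<Longrightarrow> ereal (max_affine (T k) x) \<le> f x"
    "\<And>x. x \<in> P \<Longrightarrow> (SUP k. ereal (max_affine (T k) x)) = f x"
proof -
  define M where "M = {(a, b). (a, b) \<in> rational_affine \<and> (\<forall>x\<in>P. ereal (a \<bullet> x + b) \<le> f x)}"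
  have "M \<subseteq> rational_affine" by (auto simp: M_def)
  then have cM: "countable M" using countable_rational_affine by (rule countable_subset)
  have zM: "(0, 0) \<in> M" using nonneg by (auto simp: M_def rational_affine_def zero_ereal_def)
  define T where "T k = insert (0, 0) (from_nat_into M ` {..k})" for k
  have TM: "T k \<subseteq> M" for k using zM from_nat_into[of M] unfolding T_def by blast
  have fin: "finite (T k)" for k by (simp add: T_def)
  have ne: "T k \<noteq> {}" for k by (simp add: T_def)
  have le: "ereal (max_affine (T k) x) \<le> f x" if "x \<in> P" for k x
  proof -
    obtain a b where "(a, b) \<in> T k" "max_affine (T k) x = a \<bullet> x + b"
      using max_affine_in[OF fin ne] by metis
    then show ?thesis using TM[of k] that by (auto simp: M_def)
  qed
  have ge: "f x \<le> (SUP k. ereal (max_affine (T k) x))" if x: "x \<in> P" for x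
  proof (rule ccontr)
    assume "\<not> ?thesis"
    then have "(SUP k. ereal (max_affine (T k) x)) < f x" by simp
    then obtain t where t: "(SUP k. ereal (max_affine (T k) x)) < ereal t" "ereal t < f x"
      by (metis ereal_dense2)
    obtain a b where ab: "(a, b) \<in> rational_affine" "\<And>x. x \<in> P \<Longrightarrow> ereal (a \<bullet> x + b) \<le> f x" "t < a \<bullet> x + b"
      using lsc_convex_rational_minorant[OF P lsc cvx nonneg x t(2)] by metis
    then have "(a, b) \<in> M" by (auto simp: M_def)
    then obtain k where "from_nat_into M k = (a, b)" using from_nat_into_surj[OF cM] by blast
    then have "(a, b) \<in> T k" by (force simp: T_def)
    then have "ereal (a \<bullet> x + b) \<le> ereal (max_affine (T k) x)" using max_affine_ge[OF fin] by simp
    also have "\<dots> \<le> (SUP k. ereal (max_affine (T k) x))" by (rule SUP_upper) simp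
    finally have "ereal (a \<bullet> x + b) < ereal t" using t(1) by (rule le_less_trans)
    then show False using ab(3) by simp
  qed
  show ?thesis
  proof (rule that[of T])
    show "incseq T" by (auto simp: incseq_def T_def)
    show "(SUP k. ereal (max_affine (T k) x)) = f x" if "x \<in> P" for x
      using ge[OF that] le[OF that] by (intro antisym SUP_least) auto
    show "T k \<subseteq> rational_affine" for k using TM[of k] \<open>M \<subseteq> rational_affine\<close> by (rule order_trans)
  qed (use fin le in \<open>auto simp: T_def\<close>)
qed

text \<open>A supporting hyperplane of the epigraph at the point over \<open>x0\<close>. It is not
  vertical, because f is finite on a whole neighbourhood of \<open>x0\<close>.\<close>

lemma ereal_convex_subgradient:
  fixes f :: "'a::euclidean_space \<Rightarrow> ereal"
  assumes P: "convex P" and cvx: "ereal_convex_on P f" and x0: "x0 \<in> interior P"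
    and fin: "\<And>x. x \<in> P \<Longrightarrow> f x \<noteq> -\<infinity>" "\<And>x. x \<in> interior P \<Longrightarrow> f x \<noteq> \<infinity>"
  obtains a where "\<And>x. x \<in> P \<Longrightarrow> f x0 + ereal (a \<bullet> (x - x0)) \<le> f x"
proof -
  have x0P: "x0 \<in> P" using x0 interior_subset by blast
  obtain z0 where z0: "f x0 = ereal z0" using fin(1)[OF x0P] fin(2)[OF x0] by (cases "f x0") auto
  \<comment> \<open>The strict epigraph, so that the point on the graph over \<open>x0\<close> lies
    outside and two disjoint convex sets can be separated.\<close>
  define S where "S = {(x, z). x \<in> P \<and> f x < ereal z}"
  have "convex S"
    unfolding convex_alt S_def
  proof (clarsimp, intro conjI)
    fix x z y w and t :: real
    assume xy: "x \<in> P" "f x < ereal z" "y \<in> P" "f y < ereal w" and t: "0 \<le> t" "t \<le> 1"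
    show "(1 - t) *\<^sub>R x + t *\<^sub>R y \<in> P" using P xy t by (simp add: convex_alt)
    obtain z' where z': "f x = ereal z'" using xy fin(1) by (cases "f x") auto
    obtain w' where w': "f y = ereal w'" using xy fin(1) by (cases "f y") auto
    have "f ((1 - t) *\<^sub>R x + t *\<^sub>R y) \<le> ereal ((1 - t) * z' + t * w')"
      using cvx xy t z' w' by (intro ereal_convex_on_le) auto
    also have "(1 - t) * z' + t * w' < (1 - t) * z + t * w"
    proof (cases "t = 0")
      case False
      then show ?thesis using xy z' w' t by (intro add_le_less_mono mult_left_mono mult_strict_left_mono) auto
    qed (use xy z' in auto)
    finally show "f ((1 - t) *\<^sub>R x + t *\<^sub>R y) < ereal ((1 - t) * z + t * w)" by simp
  qed
  moreover have "S \<noteq> {}" using x0P z0 by (auto simp: S_def intro!: exI[of _ x0] exI[of _ "z0 + 1"])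
  moreover have "S \<inter> {(x0, z0)} = {}" by (auto simp: S_def z0)
  ultimately obtain p c where p: "p \<noteq> 0" "\<forall>q\<in>{(x0, z0)}. p \<bullet> q \<le> c" "\<forall>q\<in>S. c \<le> p \<bullet> q"
    using separating_hyperplane_sets[of "{(x0, z0)}" S] by auto
  obtain \<alpha> \<beta> where ab: "p = (\<alpha>, \<beta>)" by (cases p)
  have sep: "\<alpha> \<bullet> x0 + \<beta> * z0 \<le> \<alpha> \<bullet> x + \<beta> * z" if "x \<in> P" "f x < ereal z" for x z
  proof -
    have "(x, z) \<in> S" using that by (simp add: S_def)
    with p show ?thesis by (fastforce simp: ab inner_Pair)
  qed
  have "\<beta> \<ge> 0" using sep[of x0 "z0 + 1"] x0P z0 by (simp add: distrib_left)
  have "\<beta> \<noteq> 0"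
  proof
    assume "\<beta> = 0"
    then have "\<alpha> \<noteq> 0" using p(1) by (auto simp: ab zero_prod_def)
    obtain e where e: "e > 0" "ball x0 e \<subseteq> interior P"
      using x0 open_interior open_contains_ball by blast
    \<comment> \<open>A step against \<alpha> that stays in the interior, where f is finite; it
      lowers the linear form below its value at \<open>x0\<close>.\<close>
    define x where "x = x0 - (e / (2 * norm \<alpha>)) *\<^sub>R \<alpha>"
    have "x \<in> ball x0 e" using e \<open>\<alpha> \<noteq> 0\<close> by (simp add: x_def dist_norm)
    then have xi: "x \<in> interior P" using e by blast
    then have xP: "x \<in> P" using interior_subset by blast
    obtain z where "f x = ereal z" using fin(1)[OF xP] fin(2)[OF xi] by (cases "f x") auto
    then have "\<alpha> \<bullet> x0 \<le> \<alpha> \<bullet> x" using sep[OF xP, of "z + 1"] \<open>\<beta> = 0\<close> by simp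
    then have "(e / (2 * norm \<alpha>)) * (\<alpha> \<bullet> \<alpha>) \<le> 0" by (simp add: x_def inner_diff_right)
    moreover have "(e / (2 * norm \<alpha>)) * (\<alpha> \<bullet> \<alpha>) > 0" using e \<open>\<alpha> \<noteq> 0\<close> by simp
    ultimately show False by linarith
  qed
  with \<open>\<beta> \<ge> 0\<close> have \<beta>: "\<beta> > 0" by simp
  show ?thesis
  proof (rule that[of "- (1 / \<beta>) *\<^sub>R \<alpha>"])
    fix x assume x: "x \<in> P"
    show "f x0 + ereal ((- (1 / \<beta>) *\<^sub>R \<alpha>) \<bullet> (x - x0)) \<le> f x"
    proof (rule ereal_le_real)
      fix z assume z: "f x \<le> ereal z"
      have le: "\<alpha> \<bullet> x0 + \<beta> * z0 \<le> \<alpha> \<bullet> x + \<beta> * (z + e)" if "e > 0" for e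
      proof (rule sep[OF x])
        have "ereal z < ereal (z + e)" using that by simp
        with z show "f x < ereal (z + e)" by (rule le_less_trans)
      qed
      have "(\<beta> * z0 + \<alpha> \<bullet> x0 - \<alpha> \<bullet> x - \<beta> * z) / \<beta> \<le> 0 + e" if "e > 0" for e
      proof -
        have "\<beta> * z0 + \<alpha> \<bullet> x0 - \<alpha> \<bullet> x - \<beta> * z \<le> e * \<beta>"
          using le[OF that] by (simp add: algebra_simps)
        then show ?thesis using \<beta> by (simp add: pos_divide_le_eq)
      qed
      then have "(\<beta> * z0 + \<alpha> \<bullet> x0 - \<alpha> \<bullet> x - \<beta> * z) / \<beta> \<le> 0" by (rule field_le_epsilon)
      then have "\<beta> * z0 - \<alpha> \<bullet> (x - x0) \<le> \<beta> * z"
        using \<beta> by (simp add: divide_le_0_iff inner_diff_right)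
      then have "z0 - (\<alpha> \<bullet> (x - x0)) / \<beta> \<le> z" using \<beta> by (simp add: field_simps)
      then show "f x0 + ereal ((- (1 / \<beta>) *\<^sub>R \<alpha>) \<bullet> (x - x0)) \<le> ereal z" by (simp add: z0)
    qed
  qed
qed

text \<open>Convexity together with the minimum 0 at \<open>x0\<close> makes f nondecreasing along
  rays from \<open>x0\<close>. This monotonicity is all that the cone estimate asks of f.\<close>

lemma ereal_convex_on_ray_le:
  assumes cvx: "ereal_convex_on P f" and x0: "x0 \<in> P" "f x0 = 0" and nonneg: "\<And>x. x \<in> P \<Longrightarrow> 0 \<le> f x"
    and y: "y \<in> P" and s: "0 \<le> s" "s \<le> 1"
  shows "f (x0 + s *\<^sub>R (y - x0)) \<le> f y"
proof -
  have eq: "x0 + s *\<^sub>R (y - x0) = (1 - s) *\<^sub>R x0 + s *\<^sub>R y" by (simp add: algebra_simps)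
  show ?thesis
  proof (cases "f y")
    case (real z)
    then have "z \<ge> 0" using nonneg[OF y] by simp
    then have "s * z \<le> z" using s by (simp add: mult_left_le_one_le)
    moreover have "f (x0 + s *\<^sub>R (y - x0)) \<le> ereal ((1 - s) * 0 + s * z)"
      unfolding eq using assms real by (intro ereal_convex_on_le) auto
    ultimately show ?thesis by (simp add: real) (metis ereal_less_eq(3) order_trans)
  qed (use nonneg[OF y] in auto)
qed

text \<open>The mean value inequality for convex functions: every point of the ball is paired with
  its reflection in the centre. The measure is left general so that the same inequality serves
  \<open>lborel\<close> in the interior and the facet measures on the boundary, where the midpoint
  inequality holds only almost everywhere.\<close>

lemma emeasure_ball_mult_le_nn_integral:
  fixes M :: "'a::euclidean_space measure" and \<phi> :: "'a \<Rightarrow> ennreal"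
  assumes sets[measurable_cong]: "sets M = sets borel" and [measurable]: "\<phi> \<in> borel_measurable borel"
    and refl: "\<And>g. g \<in> borel_measurable borel \<Longrightarrow> (\<integral>\<^sup>+x. g x \<partial>M) = (\<integral>\<^sup>+x. g (2 *\<^sub>R c - x) \<partial>M)"
    and mid: "AE x in M. x \<in> ball c \<rho> \<longrightarrow> 2 * \<phi> c \<le> \<phi> x + \<phi> (2 *\<^sub>R c - x)"
  shows "emeasure M (ball c \<rho>) * \<phi> c \<le> (\<integral>\<^sup>+x. \<phi> x * indicator (ball c \<rho>) x \<partial>M)"
proof -
  define B where "B = ball c \<rho>"
  have [measurable]: "B \<in> sets borel" by (simp add: B_def)
  have ind: "indicator B (2 *\<^sub>R c - x) = (indicator B x :: ennreal)" for x
  proof -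
    have "c - (2 *\<^sub>R c - x) = x - c" by (simp add: algebra_simps scaleR_2)
    then have "dist c (2 *\<^sub>R c - x) = dist c x"
      unfolding dist_norm by (simp only: norm_minus_commute)
    then show ?thesis by (simp add: indicator_def B_def)
  qed
  have "2 * (emeasure M B * \<phi> c) = (\<integral>\<^sup>+x. 2 * \<phi> c * indicator B x \<partial>M)"
    by (subst nn_integral_cmult_indicator) (auto simp: sets ac_simps)
  also have "\<dots> \<le> (\<integral>\<^sup>+x. \<phi> x * indicator B x + \<phi> (2 *\<^sub>R c - x) * indicator B (2 *\<^sub>R c - x) \<partial>M)"
    using mid by (intro nn_integral_mono_AE, eventually_elim) (auto simp: ind, auto simp: indicator_def B_def)
  also have "\<dots> = (\<integral>\<^sup>+x. \<phi> x * indicator B x \<partial>M) + (\<integral>\<^sup>+x. \<phi> (2 *\<^sub>R c - x) * indicator B (2 *\<^sub>R c - x) \<partial>M)"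
    by (intro nn_integral_add) measurable
  also have "(\<integral>\<^sup>+x. \<phi> (2 *\<^sub>R c - x) * indicator B (2 *\<^sub>R c - x) \<partial>M) = (\<integral>\<^sup>+x. \<phi> x * indicator B x \<partial>M)"
    by (rule refl[symmetric]) measurable
  also have "(\<integral>\<^sup>+x. \<phi> x * indicator B x \<partial>M) + (\<integral>\<^sup>+x. \<phi> x * indicator B x \<partial>M) = 2 * (\<integral>\<^sup>+x. \<phi> x * indicator B x \<partial>M)"
    by (simp add: mult_2)
  finally show ?thesis
    unfolding B_def by (subst (asm) ennreal_mult_le_mult_iff) auto
qed

lemma nn_integral_lborel_reflect:
  fixes g :: "'a::euclidean_space \<Rightarrow> ennreal"
  assumes "g \<in> borel_measurable borel"
  shows "(\<integral>\<^sup>+x. g x \<partial>lborel) = (\<integral>\<^sup>+x. g (2 *\<^sub>R c - x) \<partial>lborel)"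
  using nn_integral_lborel_scale[OF assms, of "- 1" "2 *\<^sub>R c"] by simp

lemma nn_integral_hyperplane_lborel_reflect:
  fixes g :: "'a::euclidean_space \<Rightarrow> ennreal"
  assumes "g \<in> borel_measurable borel" "v \<noteq> 0" "v \<bullet> c = v \<bullet> p"
  shows "(\<integral>\<^sup>+x. g x \<partial>hyperplane_lborel v p) = (\<integral>\<^sup>+x. g (2 *\<^sub>R c - x) \<partial>hyperplane_lborel v p)"
proof -
  have eq: "c + - 1 *\<^sub>R (x - c) = 2 *\<^sub>R c - x" for x by (simp add: algebra_simps scaleR_2)
  have "(\<integral>\<^sup>+x. g x \<partial>hyperplane_lborel v p) =
      ennreal (\<bar>- 1\<bar> ^ (DIM('a) - 1)) * (\<integral>\<^sup>+x. g (c + - 1 *\<^sub>R (x - c)) \<partial>hyperplane_lborel v p)"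
    by (rule nn_integral_hyperplane_lborel_scale[OF assms(2,3) _ assms(1)]) simp
  then show ?thesis unfolding eq by simp
qed

section \<open>The boundary measure and the trace inequality\<close>

lemma ivec_eq_0_iff: "ivec v = 0 \<longleftrightarrow> v = 0"
  by (simp add: ivec_def vec_eq_iff)

lemma primitive_nonzero: "primitive v \<Longrightarrow> v \<noteq> 0"
  by (auto simp: primitive_def)

locale delzant_polytope =
  fixes r :: nat and lam :: "nat \<Rightarrow> int ^ 'n" and d :: "nat \<Rightarrow> int" and x0 :: "real ^ 'n"
  assumes delzant: "integral_delzant r lam d" and x0_interior: "x0 \<in> interior (poly_of r lam d)"
begin

abbreviation "P \<equiv> poly_of r lam d"
abbreviation "\<sigma> \<equiv> bdry_measure r lam d"
abbreviation "F \<equiv> facet r lam d"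
abbreviation "el \<equiv> ell lam d"
abbreviation "nrm j \<equiv> ivec (lam j)"
abbreviation "\<mu> \<equiv> facet_lborel lam d"

lemma polytope_P: "polytope P" and aff_dim_P: "aff_dim P = int CARD('n)"
  and facets: "bij_betw F {1..r} {F. F facet_of P}" and primitive: "j \<in> {1..r} \<Longrightarrow> primitive (lam j)"
  using delzant by (auto simp: integral_delzant_def Let_def)

lemma compact_P: "compact P" and convex_P: "convex P" and closed_P: "closed P" and bounded_P: "bounded P"
  using polytope_P by (auto simp: polytope_imp_compact polytope_imp_convex polytope_imp_closed polytope_imp_bounded)

lemma borel_P [measurable]: "P \<in> sets borel"
  by (simp add: borel_closed closed_P)

lemma x0_P: "x0 \<in> P"
  using x0_interior interior_subset by blast

lemma frontier_subset: "frontier P \<subseteq> P"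
  by (rule frontier_subset_closed[OF closed_P])

lemma nrm_nonzero: "j \<in> {1..r} \<Longrightarrow> nrm j \<noteq> 0"
  using primitive_nonzero[OF primitive] by (simp add: ivec_eq_0_iff)

lemma facet_of_P: "j \<in> {1..r} \<Longrightarrow> F j facet_of P"
  using facets by (auto simp: bij_betw_def)

lemma frontier_P: "frontier P = (\<Union>j\<in>{1..r}. F j)"
proof -
  have "frontier P = rel_frontier P"
    using x0_interior by (intro rel_frontier_nonempty_interior[symmetric]) auto
  also have "\<dots> = \<Union>{F. F facet_of P}"
    by (rule rel_frontier_of_polyhedron[OF polytope_imp_polyhedron[OF polytope_P]])
  also have "\<dots> = (\<Union>j\<in>{1..r}. F j)"
    using facets by (auto simp: bij_betw_def)
  finally show ?thesis .
qed

lemma ell_nonneg: "j \<in> {1..r} \<Longrightarrow> x \<in> P \<Longrightarrow> el j x \<ge> 0"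
  by (simp add: poly_of_def)

lemma ell_x0: assumes j: "j \<in> {1..r}" shows "el j x0 > 0"
proof (rule ccontr)
  assume "\<not> ?thesis"
  then have "x0 \<in> F j" using ell_nonneg[OF j x0_P] x0_P by (simp add: facet_def)
  then have "x0 \<in> frontier P" using j frontier_P by auto
  with x0_interior show False by (simp add: frontier_def)
qed

lemma ell_diff: "el j (x + t *\<^sub>R (y - x)) = (1 - t) * el j x + t * el j y"
  by (simp add: ell_def inner_simps algebra_simps)

lemma continuous_on_ell: "continuous_on A (el j)"
  unfolding ell_def by (intro continuous_intros)

lemma measurable_ell [measurable]: "el j \<in> borel_measurable borel"
  by (intro borel_measurable_continuous_onI continuous_on_ell)

lemma closed_facet: "closed (F j)"
proof -
  have "F j = P \<inter> {x. el j x = 0}" by (auto simp: facet_def)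
  moreover have "closed {x. el j x = 0}"
    by (intro closed_Collect_eq continuous_on_ell continuous_on_const)
  ultimately show ?thesis using closed_P by (simp add: closed_Int)
qed

lemma borel_facet [measurable]: "F j \<in> sets borel"
  by (simp add: borel_closed closed_facet)

lemma facet_subset: "F j \<subseteq> P"
  by (auto simp: facet_def)

lemma sets_facet_lborel [simp, measurable_cong]: "sets (\<mu> j) = sets borel"
  by (simp add: facet_lborel_def)

lemma space_facet_lborel [simp]: "space (\<mu> j) = UNIV"
  by (simp add: facet_lborel_def)

lemma emeasure_facet: "emeasure (\<mu> j) (F j) < \<infinity>"
  unfolding facet_lborel_def
  using bounded_subset[OF bounded_P facet_subset] borel_facet
  by (rule emeasure_hyperplane_lborel_bounded)

lemma base_point:
  assumes "j \<in> {1..r}"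
  shows "nrm j \<bullet> (- (real_of_int (d j) / (norm (nrm j))\<^sup>2) *\<^sub>R nrm j) = - real_of_int (d j)"
  using nrm_nonzero[OF assms] by (simp add: dot_square_norm)

lemma AE_facet_lborel:
  assumes "j \<in> {1..r}" shows "AE y in \<mu> j. el j y = 0"
  using AE_hyperplane_lborel[of "nrm j" "- (real_of_int (d j) / (norm (nrm j))\<^sup>2) *\<^sub>R nrm j"]
  unfolding facet_lborel_def ell_def base_point[OF assms] by eventually_elim simp

lemma space_bdry [simp]: "space \<sigma> = frontier P"
  unfolding bdry_measure_def Let_def
  by (subst space_measure_of) (auto simp: sets_restrict_space)

lemma sets_bdry [simp, measurable_cong]: "sets \<sigma> = sets (restrict_space borel (frontier P))"
proof -
  have "space (restrict_space borel (frontier P)) = frontier P" by (simp add: space_restrict_space)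
  then show ?thesis
    unfolding bdry_measure_def Let_def
    using sets.sets_measure_of_eq[of "restrict_space borel (frontier P)"] by (simp only:)
qed

text \<open>The measure is declared by \<open>measure_of\<close>, so its values are available only
  after the weighted sum has been shown to be countably additive.\<close>

lemma emeasure_bdry:
  assumes "A \<in> sets \<sigma>"
  shows "emeasure \<sigma> A = (\<Sum>j\<in>{1..r}. ennreal (1 / norm (nrm j)) * emeasure (\<mu> j) (A \<inter> F j))"
proof -
  let ?R = "restrict_space borel (frontier P) :: (real^'n) measure"
  let ?m = "\<lambda>A. \<Sum>j\<in>{1..r}. ennreal (1 / norm (nrm j)) * emeasure (\<mu> j) (A \<inter> F j)"
  have sp: "space ?R = frontier P" by (simp add: space_restrict_space)
  have mb: "A \<in> sets borel" if "A \<in> sets ?R" for A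
    using that by (subst (asm) sets_restrict_space_iff) auto
  have "emeasure (measure_of (frontier P) (sets ?R) ?m) A = ?m A"
  proof (rule emeasure_measure_of_sigma)
    show "sigma_algebra (frontier P) (sets ?R)"
      using sets.sigma_algebra_axioms[of ?R] by (simp add: sp)
    show "positive (sets ?R) ?m" by (simp add: positive_def)
    show "A \<in> sets ?R" using assms by simp
    show "countably_additive (sets ?R) ?m"
    proof (rule countably_additiveI)
      fix X :: "nat \<Rightarrow> (real^'n) set"
      assume X: "range X \<subseteq> sets ?R" "disjoint_family X"
      have "(\<Sum>i. ?m (X i)) = (\<Sum>j\<in>{1..r}. \<Sum>i. ennreal (1 / norm (nrm j)) * emeasure (\<mu> j) (X i \<inter> F j))"
        by (intro suminf_sum) simp
      also have "\<dots> = ?m (\<Union>i. X i)"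
      proof (intro sum.cong refl)
        fix j
        have "(\<Sum>i. emeasure (\<mu> j) (X i \<inter> F j)) = emeasure (\<mu> j) (\<Union>i. X i \<inter> F j)"
        proof (rule suminf_emeasure)
          show "range (\<lambda>i. X i \<inter> F j) \<subseteq> sets (\<mu> j)"
            using X(1) mb by (auto intro!: sets.Int)
          show "disjoint_family (\<lambda>i. X i \<inter> F j)"
            using X(2) unfolding disjoint_family_on_def by blast
        qed
        then show "(\<Sum>i. ennreal (1 / norm (nrm j)) * emeasure (\<mu> j) (X i \<inter> F j)) =
          ennreal (1 / norm (nrm j)) * emeasure (\<mu> j) ((\<Union>i. X i) \<inter> F j)"
          by (simp add: ennreal_suminf_cmult)
      qed
      finally show "(\<Sum>i. ?m (X i)) = ?m (\<Union>i. X i)" .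
    qed
  qed
  then show ?thesis by (simp add: bdry_measure_def Let_def)
qed

lemma finite_measure_bdry: "finite_measure \<sigma>"
proof
  have "emeasure \<sigma> (frontier P) < \<infinity>"
    using sets.top[of \<sigma>]
  proof (subst emeasure_bdry)
    have "emeasure (\<mu> j) (frontier P \<inter> F j) < \<infinity>" for j
      by (rule le_less_trans[OF emeasure_mono emeasure_facet[of j]]) auto
    then show "(\<Sum>j\<in>{1..r}. ennreal (1 / norm (nrm j)) * emeasure (\<mu> j) (frontier P \<inter> F j)) < \<infinity>"
      by (auto simp: ennreal_mult_less_top)
  qed simp
  then show "emeasure \<sigma> (space \<sigma>) \<noteq> \<infinity>" by simp
qed

sublocale bdry: finite_measure \<sigma> by (rule finite_measure_bdry)

lemma measurable_bdryI [measurable (raw)]: "f \<in> borel_measurable borel \<Longrightarrow> f \<in> borel_measurable \<sigma>"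
  by (subst measurable_cong_sets[OF sets_bdry refl]) (rule measurable_restrict_space1)

lemma nn_integral_bdry:
  assumes "f \<in> borel_measurable borel"
  shows "(\<integral>\<^sup>+x. f x \<partial>\<sigma>) = (\<Sum>j\<in>{1..r}. ennreal (1 / norm (nrm j)) * (\<integral>\<^sup>+x. f x * indicator (F j) x \<partial>\<mu> j))"
  using assms
proof (induction f rule: borel_measurable_induct)
  case (cong f g)
  then have "f = g" by auto
  with cong show ?case by simp
next
  case (set A)
  have "A \<inter> frontier P \<in> sets \<sigma>" using set by (simp add: sets_restrict_space_iff)
  have "(\<integral>\<^sup>+x. indicator A x \<partial>\<sigma>) = (\<integral>\<^sup>+x. indicator (A \<inter> frontier P) x \<partial>\<sigma>)"
    by (intro nn_integral_cong) (auto simp: indicator_def)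
  also have "\<dots> = emeasure \<sigma> (A \<inter> frontier P)"
    by (rule nn_integral_indicator) fact
  also have "\<dots> = (\<Sum>j\<in>{1..r}. ennreal (1 / norm (nrm j)) * (\<integral>\<^sup>+x. indicator A x * indicator (F j) x \<partial>\<mu> j))"
  proof (subst emeasure_bdry[OF \<open>A \<inter> frontier P \<in> sets \<sigma>\<close>], intro sum.cong refl arg_cong2[where f="(*)"])
    fix j assume "j \<in> {1..r}"
    then have "A \<inter> frontier P \<inter> F j = A \<inter> F j" using frontier_P by auto
    then show "emeasure (\<mu> j) (A \<inter> frontier P \<inter> F j) = (\<integral>\<^sup>+x. indicator A x * indicator (F j) x \<partial>\<mu> j)"
      using set by (simp add: indicator_inter_arith[symmetric])
  qed
  finally show ?case .
next
  case (mult u c)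
  then show ?case
    by (simp add: nn_integral_cmult mult.assoc sum_distrib_left)
       (simp add: ac_simps)
next
  case (add u v)
  then show ?case
    by (simp add: nn_integral_add distrib_right distrib_left sum.distrib)
next
  case (seq U)
  have [measurable]: "U i \<in> borel_measurable borel" for i by (rule seq)
  have "(\<integral>\<^sup>+x. (SUP i. U i) x \<partial>\<sigma>) = (\<integral>\<^sup>+x. (SUP i. U i x) \<partial>\<sigma>)" by (simp add: image_comp)
  also have "\<dots> = (SUP i. \<integral>\<^sup>+x. U i x \<partial>\<sigma>)"
    using seq by (intro nn_integral_monotone_convergence_SUP) auto
  also have "\<dots> = (SUP i. \<Sum>j\<in>{1..r}. ennreal (1 / norm (nrm j)) * (\<integral>\<^sup>+x. U i x * indicator (F j) x \<partial>\<mu> j))"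
    by (simp add: seq)
  also have "\<dots> = (\<Sum>j\<in>{1..r}. SUP i. ennreal (1 / norm (nrm j)) * (\<integral>\<^sup>+x. U i x * indicator (F j) x \<partial>\<mu> j))"
    using seq by (intro ennreal_SUP_sum)
      (auto simp: incseq_def le_fun_def intro!: mult_left_mono nn_integral_mono mult_right_mono)
  also have "\<dots> = (\<Sum>j\<in>{1..r}. ennreal (1 / norm (nrm j)) * (\<integral>\<^sup>+x. (SUP i. U i) x * indicator (F j) x \<partial>\<mu> j))"
  proof (intro sum.cong refl)
    fix j
    have "(SUP i. ennreal (1 / norm (nrm j)) * (\<integral>\<^sup>+x. U i x * indicator (F j) x \<partial>\<mu> j)) =
        ennreal (1 / norm (nrm j)) * (SUP i. \<integral>\<^sup>+x. U i x * indicator (F j) x \<partial>\<mu> j)"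
      by (rule SUP_mult_left_ennreal[symmetric])
    also have "(SUP i. \<integral>\<^sup>+x. U i x * indicator (F j) x \<partial>\<mu> j) = (\<integral>\<^sup>+x. (SUP i. U i x * indicator (F j) x) \<partial>\<mu> j)"
      using seq by (intro nn_integral_monotone_convergence_SUP[symmetric])
        (auto simp: incseq_def le_fun_def intro!: mult_right_mono)
    also have "\<dots> = (\<integral>\<^sup>+x. (SUP i. U i) x * indicator (F j) x \<partial>\<mu> j)"
      by (simp add: SUP_mult_right_ennreal image_comp)
    finally show "(SUP i. ennreal (1 / norm (nrm j)) * (\<integral>\<^sup>+x. U i x * indicator (F j) x \<partial>\<mu> j)) =
        ennreal (1 / norm (nrm j)) * (\<integral>\<^sup>+x. (SUP i. U i) x * indicator (F j) x \<partial>\<mu> j)" .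
  qed
  finally show ?case .
qed

lemma nn_integral_facet_le_bdry:
  assumes "f \<in> borel_measurable borel" "j \<in> {1..r}"
  shows "ennreal (1 / norm (nrm j)) * (\<integral>\<^sup>+x. f x * indicator (F j) x \<partial>\<mu> j) \<le> (\<integral>\<^sup>+x. f x \<partial>\<sigma>)"
  unfolding nn_integral_bdry[OF assms(1)]
  using assms(2) by (intro member_le_sum) auto

text \<open>Points of \<open>P\<close> outside the copy of \<open>P\<close> contracted by the factor \<open>a\<close> towards \<open>x0\<close>; the
  number \<open>1 - el j x / el j x0\<close> is the contraction factor of the hyperplane \<open>j\<close> for which it
  passes through \<open>x\<close>.\<close>

definition shell :: "real \<Rightarrow> (real ^ 'n) set" where
  "shell a = {x \<in> P. \<exists>j\<in>{1..r}. a < 1 - el j x / el j x0}"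

lemma borel_shell [measurable]: "shell a \<in> sets borel"
proof -
  have "shell a = P \<inter> (\<Union>j\<in>{1..r}. {x \<in> space borel. a < 1 - el j x / el j x0})"
    by (auto simp: shell_def)
  also have "\<dots> \<in> sets borel" by measurable
  finally show ?thesis .
qed

text \<open>The ray from \<open>x0\<close> through x leaves P through the facet whose contraction
  factor at x is largest; dividing by the largest factor keeps all the other inequalities
  valid.\<close>

lemma shell_decompose:
  assumes a: "0 \<le> a" and x: "x \<in> shell a"
  obtains j where "j \<in> {1..r}" "a < 1 - el j x / el j x0"
    "x0 + (1 / (1 - el j x / el j x0)) *\<^sub>R (x - x0) \<in> F j"
proof -
  define s where "s i = 1 - el i x / el i x0" for i
  from x obtain i0 where i0: "i0 \<in> {1..r}" "a < s i0" by (auto simp: shell_def s_def)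
  then have "finite (s ` {1..r})" "s ` {1..r} \<noteq> {}" by auto
  from Max_in[OF this] obtain j where j: "Max (s ` {1..r}) = s j" "j \<in> {1..r}" by (rule imageE)
  have le: "s i \<le> s j" if "i \<in> {1..r}" for i
    unfolding j(1)[symmetric] using that by (intro Max_ge) auto
  have pos: "s j > a" using le[OF i0(1)] i0 by linarith
  let ?y = "x0 + (1 / s j) *\<^sub>R (x - x0)"
  have ell: "el i ?y = el i x0 * (1 - s i / s j)" if "i \<in> {1..r}" for i
  proof -
    have eq: "el i x = el i x0 * (1 - s i)" using ell_x0[OF that] by (simp add: s_def)
    show ?thesis unfolding ell_diff eq by (simp add: algebra_simps)
  qed
  have "s i / s j \<le> 1" if "i \<in> {1..r}" for i
    using le[OF that] pos a by simp
  then have "el i ?y \<ge> 0" if "i \<in> {1..r}" for i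
    unfolding ell[OF that] using ell_x0[OF that] that by (intro mult_nonneg_nonneg) auto
  moreover have "el j ?y = 0" using ell[OF j(2)] pos a by simp
  ultimately have "?y \<in> F j" unfolding facet_def poly_of_def by blast
  with j(2) pos that show ?thesis by (simp add: s_def)
qed

text \<open>If no contraction factor is positive at x, every \<open>el j\<close> is nondecreasing
  along the ray from \<open>x0\<close> through x, so the whole ray stays in P. Boundedness then
  leaves only \<open>x0\<close>.\<close>

lemma shell_0: "P - shell 0 \<subseteq> {x0}"
proof
  fix x assume x: "x \<in> P - shell 0"
  show "x \<in> {x0}"
  proof (rule ccontr)
    assume "x \<notin> {x0}"
    then have ne: "norm (x - x0) > 0" by simp
    obtain R where R: "\<And>y. y \<in> P \<Longrightarrow> norm (y - x0) \<le> R"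
      using bounded_P bounded_subset_ballD[of P x0]
      by (metis dist_commute dist_norm less_imp_le mem_ball subsetD)
    define t where "t = (\<bar>R\<bar> + 1) / norm (x - x0)"
    have t: "t > 0" using ne by (simp add: t_def)
    have "x0 + t *\<^sub>R (x - x0) \<in> P"
      unfolding poly_of_def mem_Collect_eq
    proof
      fix j assume j: "j \<in> {1..r}"
      have "\<not> 0 < 1 - el j x / el j x0" using x j unfolding shell_def by blast
      then have "el j x / el j x0 \<ge> 1" by simp
      then have "el j x \<ge> el j x0" using ell_x0[OF j] by simp
      then have "t * (el j x - el j x0) \<ge> 0" using t by simp
      then show "el j (x0 + t *\<^sub>R (x - x0)) \<ge> 0"
        unfolding ell_diff using ell_x0[OF j] by (simp add: algebra_simps)
    qed
    from R[OF this] have "t * norm (x - x0) \<le> R" using t by simp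
    then show False using ne by (simp add: t_def)
  qed
qed

text \<open>The cone from \<open>x0\<close> over facet j has height
  \<open>el j x0 / norm (nrm j)\<close>, and \<sigma> carries the weight
  \<open>1 / norm (nrm j)\<close> there. The norms cancel, which leaves the sum of the values
  \<open>el j x0\<close>.\<close>

definition trace_const :: real where "trace_const = (\<Sum>j\<in>{1..r}. el j x0)"

lemma trace_const_nonneg: "trace_const \<ge> 0"
  unfolding trace_const_def using ell_x0 by (intro sum_nonneg) (auto intro: less_imp_le)

text \<open>The second condition says that the central projection from \<open>x0\<close> onto the
  hyperplane of facet j hits the facet itself; by \<open>shell_decompose\<close> these sets cover
  the shell.\<close>

definition cone :: "real \<Rightarrow> nat \<Rightarrow> (real ^ 'n) set" where
  "cone a j = {x \<in> P. a < 1 - el j x / el j x0 \<and> x0 + (1 / (1 - el j x / el j x0)) *\<^sub>R (x - x0) \<in> F j}"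

lemma borel_cone [measurable]: "cone a j \<in> sets borel"
proof -
  have "(\<lambda>x. x0 + (1 / (1 - el j x / el j x0)) *\<^sub>R (x - x0)) \<in> borel \<rightarrow>\<^sub>M borel" by measurable
  from measurable_sets[OF this borel_facet[of j]]
  have "{x \<in> space borel. x0 + (1 / (1 - el j x / el j x0)) *\<^sub>R (x - x0) \<in> F j} \<in> sets borel"
    by (simp add: vimage_def)
  then have "P \<inter> {x \<in> space borel. a < 1 - el j x / el j x0} \<inter> {x \<in> space borel. x0 + (1 / (1 - el j x / el j x0)) *\<^sub>R (x - x0) \<in> F j} \<in> sets borel"
    by measurable
  also have "P \<inter> {x \<in> space borel. a < 1 - el j x / el j x0} \<inter> {x \<in> space borel. x0 + (1 / (1 - el j x / el j x0)) *\<^sub>R (x - x0) \<in> F j} = cone a j"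
    by (auto simp: cone_def)
  finally show ?thesis .
qed

text \<open>The slices of the cone over a facet by hyperplanes parallel to it are contracted copies of
  the facet.\<close>

lemma nn_integral_cone_le:
  assumes [measurable]: "\<phi> \<in> borel_measurable borel" and a: "0 \<le> a" "a < 1" and j: "j \<in> {1..r}"
    and mono: "\<And>y s. y \<in> F j \<Longrightarrow> 0 < s \<Longrightarrow> s \<le> 1 \<Longrightarrow> \<phi> (x0 + s *\<^sub>R (y - x0)) \<le> \<phi> y"
  shows "(\<integral>\<^sup>+x. \<phi> x * indicator (cone a j) x \<partial>lborel)
    \<le> ennreal ((1 - a) * el j x0) * (\<integral>\<^sup>+x. \<phi> x \<partial>\<sigma>)"
proof -
  define v where "v = nrm j"
  define \<nu> where "\<nu> = v /\<^sub>R norm v"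
  define D where "D = el j x0 / norm v"
  define K where "K = cone a j"
  define I where "I = (\<integral>\<^sup>+x. \<phi> x * indicator (F j) x \<partial>\<mu> j)"
  have v: "v \<noteq> 0" using nrm_nonzero[OF j] by (simp add: v_def)
  then have nv: "norm v > 0" by simp
  have L: "el j x0 > 0" by (rule ell_x0[OF j])
  have D: "D > 0" using L nv by (simp add: D_def)
  have v\<nu>: "v \<bullet> \<nu> = norm v" using v by (simp add: \<nu>_def dot_square_norm power2_eq_square)
  have ell_add: "el j (y + \<tau> *\<^sub>R \<nu>) = el j y + \<tau> * norm v" for y \<tau>
    using v\<nu> by (simp add: ell_def v_def inner_simps)
  have [measurable]: "K \<in> sets borel" by (simp add: K_def)
  \<comment> \<open>The foot of the perpendicular from \<open>x0\<close> to the hyperplane. Dilating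
    the hyperplane about q by s and then shifting by (1 - s) D along the normal is the contraction
    towards \<open>x0\<close> by s.\<close>
  define q where "q = x0 - D *\<^sub>R \<nu>"
  have q: "el j q = 0" using ell_add[of x0 "- D"] nv by (simp add: q_def D_def)
  \<comment> \<open>Here \<tau> is the height of the slice above the facet hyperplane; the truncated
    cone meets only heights from 0 to (1 - a) D, and each such slice contributes at most the
    integral over the facet.\<close>
  have inner_le: "(\<integral>\<^sup>+y. \<phi> (y + \<tau> *\<^sub>R \<nu>) * indicator K (y + \<tau> *\<^sub>R \<nu>) \<partial>\<mu> j) \<le> I * indicator {0..<(1 - a) * D} \<tau>" for \<tau>
  proof (cases "\<tau> \<in> {0..<(1 - a) * D}")
    case False
    have "AE y in \<mu> j. \<phi> (y + \<tau> *\<^sub>R \<nu>) * indicator K (y + \<tau> *\<^sub>R \<nu>) = 0"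
      using AE_facet_lborel[OF j]
    proof eventually_elim
      case (elim y)
      have "y + \<tau> *\<^sub>R \<nu> \<notin> K"
      proof
        assume y: "y + \<tau> *\<^sub>R \<nu> \<in> K"
        then have "el j (y + \<tau> *\<^sub>R \<nu>) \<ge> 0" using ell_nonneg[OF j] by (auto simp: K_def cone_def)
        then have "\<tau> \<ge> 0" using elim ell_add nv by (simp add: zero_le_mult_iff)
        moreover have "a < 1 - \<tau> / D"
          using y elim ell_add nv L by (simp add: K_def cone_def D_def field_simps)
        then have "\<tau> < (1 - a) * D" using D by (simp add: field_simps)
        ultimately show False using False by simp
      qed
      then show ?case by simp
    qed
    then have "(\<integral>\<^sup>+y. \<phi> (y + \<tau> *\<^sub>R \<nu>) * indicator K (y + \<tau> *\<^sub>R \<nu>) \<partial>\<mu> j) = 0"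
      by (subst nn_integral_0_iff_AE) auto
    then show ?thesis by simp
  next
    case True
    define s where "s = 1 - \<tau> / D"
    have s: "0 < s" "s \<le> 1" using True D a by (auto simp: s_def field_simps) (smt (verit) mult_nonneg_nonneg)
    have \<tau>: "\<tau> = (1 - s) * D" using D by (simp add: s_def)
    have "(\<integral>\<^sup>+y. \<phi> (y + \<tau> *\<^sub>R \<nu>) * indicator K (y + \<tau> *\<^sub>R \<nu>) \<partial>\<mu> j) =
      ennreal (\<bar>s\<bar> ^ (DIM(real^'n) - 1)) * (\<integral>\<^sup>+y. \<phi> (q + s *\<^sub>R (y - q) + \<tau> *\<^sub>R \<nu>) * indicator K (q + s *\<^sub>R (y - q) + \<tau> *\<^sub>R \<nu>) \<partial>\<mu> j)"
      unfolding facet_lborel_def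
    proof (rule nn_integral_hyperplane_lborel_scale[where f="\<lambda>y. \<phi> (y + \<tau> *\<^sub>R \<nu>) * indicator K (y + \<tau> *\<^sub>R \<nu>)"])
      show "nrm j \<bullet> q = nrm j \<bullet> (- (real_of_int (d j) / (norm (nrm j))\<^sup>2) *\<^sub>R nrm j)"
        unfolding base_point[OF j] using q by (simp add: ell_def)
    qed (use s nrm_nonzero[OF j] in auto)
    also have "\<dots> \<le> 1 * I"
    proof (rule mult_mono)
      \<comment> \<open>The shrinking of the slice is simply bounded by 1; no sharp constant is
        sought.\<close>
      have "\<bar>s\<bar> ^ (DIM(real^'n) - 1) \<le> 1" using s by (intro power_le_one) auto
      then show "ennreal (\<bar>s\<bar> ^ (DIM(real^'n) - 1)) \<le> 1" by (metis ennreal_1 ennreal_leI)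
      show "(\<integral>\<^sup>+y. \<phi> (q + s *\<^sub>R (y - q) + \<tau> *\<^sub>R \<nu>) * indicator K (q + s *\<^sub>R (y - q) + \<tau> *\<^sub>R \<nu>) \<partial>\<mu> j) \<le> I"
        unfolding I_def
      proof (rule nn_integral_mono_AE)
        show "AE y in \<mu> j. \<phi> (q + s *\<^sub>R (y - q) + \<tau> *\<^sub>R \<nu>) * indicator K (q + s *\<^sub>R (y - q) + \<tau> *\<^sub>R \<nu>)
          \<le> \<phi> y * indicator (F j) y"
          using AE_facet_lborel[OF j]
        proof eventually_elim
          case (elim y)
          have eq: "q + s *\<^sub>R (y - q) + \<tau> *\<^sub>R \<nu> = x0 + s *\<^sub>R (y - x0)"
            by (simp add: q_def \<tau> algebra_simps)
          have "el j (x0 + s *\<^sub>R (y - x0)) = (1 - s) * el j x0" using elim by (simp add: ell_diff)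
          then have "1 - el j (x0 + s *\<^sub>R (y - x0)) / el j x0 = s" using L by simp
          then have "x0 + s *\<^sub>R (y - x0) \<in> K \<Longrightarrow> y \<in> F j"
            using s by (simp add: K_def cone_def)
          then show ?case unfolding eq using mono[of y s] s by (auto simp: indicator_def)
        qed
      qed
    qed auto
    finally show ?thesis using True by simp
  qed
  have "(\<integral>\<^sup>+x. \<phi> x * indicator K x \<partial>lborel) =
      (\<integral>\<^sup>+\<tau>. (\<integral>\<^sup>+y. \<phi> (y + \<tau> *\<^sub>R \<nu>) * indicator K (y + \<tau> *\<^sub>R \<nu>) \<partial>\<mu> j) \<partial>lborel)"
    unfolding facet_lborel_def \<nu>_def v_def
    by (rule nn_integral_lborel_hyperplane[OF nrm_nonzero[OF j]]) measurable
  also have "\<dots> \<le> (\<integral>\<^sup>+\<tau>. I * indicator {0..<(1 - a) * D} \<tau> \<partial>lborel)"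
    by (intro nn_integral_mono inner_le)
  also have "\<dots> = I * ennreal ((1 - a) * D)"
    using D a by (simp add: nn_integral_cmult)
  also have "\<dots> = ennreal ((1 - a) * el j x0) * (ennreal (1 / norm (nrm j)) * I)"
    using L a by (simp add: D_def v_def ennreal_mult'[symmetric] mult.assoc[symmetric])
      (simp add: ac_simps)
  also have "\<dots> \<le> ennreal ((1 - a) * el j x0) * (\<integral>\<^sup>+x. \<phi> x \<partial>\<sigma>)"
    unfolding I_def by (intro mult_left_mono nn_integral_facet_le_bdry j) auto
  finally show ?thesis by (simp add: K_def)
qed

text \<open>The factor 1 - a matters in the compactness argument: for a given boundary integral the
  mass in a thin shell is small, uniformly over all functions that increase along rays.\<close>

lemma nn_integral_shell_le:
  assumes [measurable]: "\<phi> \<in> borel_measurable borel" and a: "0 \<le> a" "a < 1"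
    and mono: "\<And>y s. y \<in> frontier P \<Longrightarrow> 0 < s \<Longrightarrow> s \<le> 1 \<Longrightarrow> \<phi> (x0 + s *\<^sub>R (y - x0)) \<le> \<phi> y"
  shows "(\<integral>\<^sup>+x. \<phi> x * indicator (shell a) x \<partial>lborel) \<le> ennreal ((1 - a) * trace_const) * (\<integral>\<^sup>+x. \<phi> x \<partial>\<sigma>)"
proof -
  have "(\<integral>\<^sup>+x. \<phi> x * indicator (shell a) x \<partial>lborel) \<le> (\<integral>\<^sup>+x. (\<Sum>j\<in>{1..r}. \<phi> x * indicator (cone a j) x) \<partial>lborel)"
  proof (rule nn_integral_mono)
    fix x
    show "\<phi> x * indicator (shell a) x \<le> (\<Sum>j\<in>{1..r}. \<phi> x * indicator (cone a j) x)"
    proof (cases "x \<in> shell a")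
      case True
      then obtain j where j: "j \<in> {1..r}" "x \<in> cone a j"
        using shell_decompose[OF a(1) True] by (auto simp: cone_def shell_def)
      have "\<phi> x * indicator (cone a j) x \<le> (\<Sum>j\<in>{1..r}. \<phi> x * indicator (cone a j) x)"
        using j by (intro member_le_sum) auto
      with j True show ?thesis by simp
    qed simp
  qed
  also have "\<dots> = (\<Sum>j\<in>{1..r}. \<integral>\<^sup>+x. \<phi> x * indicator (cone a j) x \<partial>lborel)"
    by (intro nn_integral_sum) measurable
  also have "\<dots> \<le> (\<Sum>j\<in>{1..r}. ennreal ((1 - a) * el j x0) * (\<integral>\<^sup>+x. \<phi> x \<partial>\<sigma>))"
    using a by (intro sum_mono nn_integral_cone_le mono) (auto simp: frontier_P)
  also have "\<dots> = ennreal ((1 - a) * trace_const) * (\<integral>\<^sup>+x. \<phi> x \<partial>\<sigma>)"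
  proof -
    have "(\<Sum>j\<in>{1..r}. ennreal ((1 - a) * el j x0)) = ennreal (\<Sum>j\<in>{1..r}. (1 - a) * el j x0)"
      using a ell_x0 by (intro sum_ennreal) (auto intro!: mult_nonneg_nonneg less_imp_le)
    then show ?thesis by (simp add: sum_distrib_right[symmetric] trace_const_def sum_distrib_left)
  qed
  finally show ?thesis .
qed

lemma nn_integral_P_le_bdry:
  assumes [measurable]: "\<phi> \<in> borel_measurable borel"
    and mono: "\<And>y s. y \<in> frontier P \<Longrightarrow> 0 < s \<Longrightarrow> s \<le> 1 \<Longrightarrow> \<phi> (x0 + s *\<^sub>R (y - x0)) \<le> \<phi> y"
  shows "(\<integral>\<^sup>+x. \<phi> x \<partial>leb_on P) \<le> ennreal trace_const * (\<integral>\<^sup>+x. \<phi> x \<partial>\<sigma>)"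
proof -
  have "(\<integral>\<^sup>+x. \<phi> x \<partial>leb_on P) = (\<integral>\<^sup>+x. \<phi> x * indicator P x \<partial>lborel)"
    by (subst nn_integral_restrict_space) auto
  also have "\<dots> \<le> (\<integral>\<^sup>+x. \<phi> x * indicator (shell 0) x \<partial>lborel)"
  proof (rule nn_integral_mono_AE)
    have "AE x in lborel. x \<noteq> x0" by (rule AE_lborel_singleton)
    then show "AE x in lborel. \<phi> x * indicator P x \<le> \<phi> x * indicator (shell 0) x"
      by eventually_elim (use shell_0 in \<open>auto simp: indicator_def\<close>)
  qed
  also have "\<dots> \<le> ennreal trace_const * (\<integral>\<^sup>+x. \<phi> x \<partial>\<sigma>)"
    using nn_integral_shell_le[of \<phi> 0] mono by simp
  finally show ?thesis .
qed

end

section \<open>Integrals of extended-valued functions bounded below\<close>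

lemma e2ennreal_add: "0 \<le> a \<Longrightarrow> 0 \<le> b \<Longrightarrow> e2ennreal (a + b) = e2ennreal a + e2ennreal b"
  by (cases a; cases b) (auto simp: ennreal_plus)

lemma ereal_integral_nonneg:
  assumes "\<And>x. x \<in> space M \<Longrightarrow> 0 \<le> f x"
  shows "ereal_integral M f = enn2ereal (\<integral>\<^sup>+x. e2ennreal (f x) \<partial>M)"
proof -
  have "(\<integral>\<^sup>+x. e2ennreal (- f x) \<partial>M) = (\<integral>\<^sup>+x. 0 \<partial>M)"
    using assms by (intro nn_integral_cong e2ennreal_neg) (simp add: ereal_uminus_le_reorder)
  then show ?thesis by (simp add: ereal_integral_def zero_ennreal.rep_eq)
qed

lemma ereal_integral_cong:
  assumes "\<And>x. x \<in> space M \<Longrightarrow> f x = g x"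
  shows "ereal_integral M f = ereal_integral M g"
proof -
  have "(\<integral>\<^sup>+x. e2ennreal (f x) \<partial>M) = (\<integral>\<^sup>+x. e2ennreal (g x) \<partial>M)"
    "(\<integral>\<^sup>+x. e2ennreal (- f x) \<partial>M) = (\<integral>\<^sup>+x. e2ennreal (- g x) \<partial>M)"
    using assms by (auto intro!: nn_integral_cong)
  then show ?thesis by (simp add: ereal_integral_def)
qed

lemma ereal_integral_eq_lebesgue_integral:
  assumes "integrable M g" "\<And>x. x \<in> space M \<Longrightarrow> f x = ereal (g x)"
  shows "ereal_integral M f = ereal (\<integral>x. g x \<partial>M)"
proof -
  have eq: "ereal_integral M f = ereal_integral M (\<lambda>x. ereal (g x))"
    by (rule ereal_integral_cong) (rule assms(2))
  have fin: "(\<integral>\<^sup>+x. ennreal (g x) \<partial>M) \<noteq> \<infinity>" "(\<integral>\<^sup>+x. ennreal (- g x) \<partial>M) \<noteq> \<infinity>"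
    using assms(1) by (auto elim: integrableE)
  obtain a where a: "0 \<le> a" "(\<integral>\<^sup>+x. ennreal (g x) \<partial>M) = ennreal a"
    using fin(1) by (cases "\<integral>\<^sup>+x. ennreal (g x) \<partial>M") auto
  obtain b where b: "0 \<le> b" "(\<integral>\<^sup>+x. ennreal (- g x) \<partial>M) = ennreal b"
    using fin(2) by (cases "\<integral>\<^sup>+x. ennreal (- g x) \<partial>M") auto
  show ?thesis
    using a b by (subst eq) (simp add: ereal_integral_def real_lebesgue_integral_def[OF assms(1)])
qed

text \<open>Replaces the difference of two integrals by one nonnegative integral: adding c makes f
  nonnegative, and on a finite measure space the integral of c can be subtracted again, even if the
  integral of f is infinite.\<close>

lemma (in finite_measure) ereal_integral_shift:
  assumes [measurable]: "f \<in> borel_measurable M" and c: "0 \<le> c"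
    and bd: "\<And>x. x \<in> space M \<Longrightarrow> ereal (- c) \<le> f x"
  shows "ereal_integral M f = enn2ereal (\<integral>\<^sup>+x. e2ennreal (f x + ereal c) \<partial>M) - ereal (c * measure M (space M))"
proof -
  have pt: "e2ennreal (f x + ereal c) + e2ennreal (- f x) = e2ennreal (f x) + ennreal c" if x: "x \<in> space M" for x
  proof (cases "f x")
    case (real z)
    then have z: "- c \<le> z" using bd[OF x] by simp
    show ?thesis
    proof (cases "z \<ge> 0")
      case True
      then show ?thesis using real c by (simp add: ennreal_plus ennreal_neg)
    next
      case False
      then show ?thesis using real c z by (simp add: ennreal_plus[symmetric] ennreal_neg del: ennreal_plus)
    qed
  next
    case MInf
    then show ?thesis using bd[OF x] by simp
  qed (auto simp: e2ennreal_neg)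
  let ?A = "\<integral>\<^sup>+x. e2ennreal (f x + ereal c) \<partial>M" and ?N = "\<integral>\<^sup>+x. e2ennreal (- f x) \<partial>M"
    and ?B = "\<integral>\<^sup>+x. e2ennreal (f x) \<partial>M"
  have "?A + ?N = (\<integral>\<^sup>+x. e2ennreal (f x + ereal c) + e2ennreal (- f x) \<partial>M)"
    by (rule nn_integral_add[symmetric]) measurable
  also have "\<dots> = (\<integral>\<^sup>+x. e2ennreal (f x) + ennreal c \<partial>M)"
    by (intro nn_integral_cong pt)
  also have "\<dots> = ?B + ennreal (c * measure M (space M))"
    using c by (subst nn_integral_add) (auto simp: emeasure_eq_measure ennreal_mult)
  finally have eq: "?A + ?N = ?B + ennreal (c * measure M (space M))" .
  have "?N \<le> (\<integral>\<^sup>+x. ennreal c \<partial>M)"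
  proof (rule nn_integral_mono)
    fix x assume "x \<in> space M"
    then have "- f x \<le> ereal c" using bd[of x] by (simp add: ereal_uminus_le_reorder)
    then show "e2ennreal (- f x) \<le> ennreal c" using e2ennreal_mono[of "- f x" "ereal c"] by simp
  qed
  also have "\<dots> = ennreal (c * measure M (space M))"
    using c by (simp add: emeasure_eq_measure ennreal_mult)
  finally have "?N \<noteq> top" by (metis ennreal_less_top infinity_ennreal_def leD less_top)
  then obtain n where n: "0 \<le> n" "?N = ennreal n" by (cases ?N) auto
  have cm: "0 \<le> c * measure M (space M)" using c by simp
  show ?thesis
  proof (cases ?B)
    case (real b)
    then have "?A \<noteq> top" using eq n by (metis ennreal_add_eq_top ennreal_neq_top)
    then obtain a where a: "0 \<le> a" "?A = ennreal a" by (cases ?A) auto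
    have "ennreal (a + n) = ennreal (b + c * measure M (space M))"
      using eq a n real cm by (simp add: ennreal_plus)
    then have "a + n = b + c * measure M (space M)"
      using a n real cm by (subst (asm) ennreal_inj) auto
    then show ?thesis using a n real by (simp add: ereal_integral_def)
  next
    case top
    then have "?A = top" using eq n by (simp add: ennreal_add_eq_top)
    then show ?thesis using top n by (simp add: ereal_integral_def)
  qed
qed

text \<open>Additivity is imported from nonnegative functions by shifting both summands, f by c and
  g by k'. The integral of f may be infinite, as boundary integrals of elements of
  \<open>E1 P\<close> can be.\<close>

lemma (in finite_measure) ereal_integral_add_real:
  assumes [measurable]: "f \<in> borel_measurable M" and bd: "\<And>x. x \<in> space M \<Longrightarrow> ereal m \<le> f x"
    and int: "integrable M g" and k: "\<And>x. x \<in> space M \<Longrightarrow> \<bar>g x\<bar> \<le> k"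
  shows "ereal_integral M (\<lambda>x. f x + ereal (g x)) = ereal_integral M f + ereal (\<integral>x. g x \<partial>M)"
proof -
  define c where "c = \<bar>m\<bar>"
  define k' where "k' = \<bar>k\<bar>"
  have [measurable]: "g \<in> borel_measurable M" using int by simp
  have c: "0 \<le> c" "0 \<le> c + k'" by (auto simp: c_def k'_def)
  have bd': "ereal (- c) \<le> f x" if "x \<in> space M" for x
    using bd[OF that] by (rule order_trans[rotated]) (simp add: c_def)
  have k: "\<bar>g x\<bar> \<le> k'" if "x \<in> space M" for x using k[OF that] by (simp add: k'_def)
  let ?A = "\<integral>\<^sup>+x. e2ennreal (f x + ereal c) \<partial>M" and ?m = "measure M (space M)"
  have "(\<integral>\<^sup>+x. e2ennreal (f x + ereal (g x) + ereal (c + k')) \<partial>M) =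
      (\<integral>\<^sup>+x. e2ennreal (f x + ereal c) + ennreal (g x + k') \<partial>M)"
  proof (rule nn_integral_cong)
    fix x assume x: "x \<in> space M"
    have "0 \<le> f x + ereal c" using bd'[OF x] by (cases "f x") auto
    moreover have "0 \<le> ereal (g x + k')" using k[OF x] by simp
    ultimately have "e2ennreal ((f x + ereal c) + ereal (g x + k')) = e2ennreal (f x + ereal c) + e2ennreal (ereal (g x + k'))"
      by (rule e2ennreal_add)
    moreover have "f x + ereal (g x) + ereal (c + k') = (f x + ereal c) + ereal (g x + k')"
      by (cases "f x") auto
    ultimately show "e2ennreal (f x + ereal (g x) + ereal (c + k')) = e2ennreal (f x + ereal c) + ennreal (g x + k')"
      by simp
  qed
  also have "\<dots> = ?A + (\<integral>\<^sup>+x. ennreal (g x + k') \<partial>M)"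
    by (intro nn_integral_add) measurable
  also have "(\<integral>\<^sup>+x. ennreal (g x + k') \<partial>M) = ennreal (\<integral>x. g x + k' \<partial>M)"
    using k by (intro nn_integral_eq_integral AE_I2) (auto simp: int, metis abs_le_D2 diff_0 diff_le_eq add.commute neg_le_iff_le uminus_add_conv_diff le_iff_diff_le_0 minus_le_iff)
  also have "(\<integral>x. g x + k' \<partial>M) = (\<integral>x. g x \<partial>M) + k' * ?m"
    using int by (simp add: mult.commute)
  finally have A: "(\<integral>\<^sup>+x. e2ennreal (f x + ereal (g x) + ereal (c + k')) \<partial>M) =
    ?A + ennreal ((\<integral>x. g x \<partial>M) + k' * ?m)" .
  have "0 \<le> (\<integral>x. g x + k' \<partial>M)"
    using k by (intro integral_nonneg_AE AE_I2) (smt (verit))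
  then have pos: "0 \<le> (\<integral>x. g x \<partial>M) + k' * ?m"
    using int by (simp add: mult.commute)
  have "ereal_integral M (\<lambda>x. f x + ereal (g x)) =
      enn2ereal (?A + ennreal ((\<integral>x. g x \<partial>M) + k' * ?m)) - ereal ((c + k') * ?m)"
    unfolding A[symmetric]
  proof (rule ereal_integral_shift)
    fix x assume x: "x \<in> space M"
    show "ereal (- (c + k')) \<le> f x + ereal (g x)"
      using bd'[OF x] k[OF x] by (cases "f x") auto
  qed (use c in auto)
  also have "\<dots> = (enn2ereal ?A - ereal (c * ?m)) + ereal (\<integral>x. g x \<partial>M)"
    using pos by (cases ?A) (auto simp: plus_ennreal.rep_eq distrib_right)
  also have "enn2ereal ?A - ereal (c * ?m) = ereal_integral M f"
    by (rule ereal_integral_shift[symmetric]) (use bd' c in auto)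
  finally show ?thesis .
qed

lemma lsc_on_add_continuous:
  fixes f :: "'a::topological_space \<Rightarrow> ereal"
  assumes lsc: "lsc_on P f" and g: "continuous_on P g"
  shows "lsc_on P (\<lambda>x. f x + ereal (g x))"
  unfolding lsc_on_def
proof
  fix x assume x: "x \<in> P"
  show "f x + ereal (g x) \<le> Liminf (at x within P) (\<lambda>x. f x + ereal (g x))"
    unfolding le_Liminf_iff
  proof (intro allI impI)
    fix y assume "y < f x + ereal (g x)"
    then obtain y2 where y2: "y < ereal y2" "ereal y2 < f x + ereal (g x)" by (metis ereal_dense2)
    obtain y1 where y1: "y < ereal y1" "ereal y1 < ereal y2" using y2(1) by (metis ereal_dense2)
    have "ereal (y2 - g x) < f x" using y2(2) by (cases "f x") auto
    then have "ereal (y2 - g x) < Liminf (at x within P) f"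
      using lsc x by (auto simp: lsc_on_def intro: less_le_trans)
    then have "eventually (\<lambda>z. ereal (y2 - g x) < f z) (at x within P)" by (rule less_LiminfD)
    moreover have "(g \<longlongrightarrow> g x) (at x within P)"
      using g x by (simp add: continuous_on_def)
    then have "eventually (\<lambda>z. g x - (y2 - y1) < g z) (at x within P)"
      using y1 by (intro order_tendstoD) auto
    ultimately show "eventually (\<lambda>z. y < f z + ereal (g z)) (at x within P)"
    proof eventually_elim
      case (elim z)
      have "ereal y1 < f z + ereal (g z)" using elim by (cases "f z") auto
      with y1(1) show ?case by (rule less_trans)
    qed
  qed
qed

lemma ereal_convex_on_add_affine:
  assumes "ereal_convex_on P f" "\<And>x. x \<in> P \<Longrightarrow> f x \<noteq> -\<infinity>" "\<xi> \<in> affine_funs"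
  shows "ereal_convex_on P (\<lambda>x. f x + ereal (\<xi> x))"
  unfolding ereal_convex_on_def
proof (intro ballI)
  fix x y t assume xy: "x \<in> P" "y \<in> P" and t: "t \<in> {0<..<1::real}"
  obtain a b where \<xi>: "\<xi> = (\<lambda>x. a \<bullet> x + b)" using assms(3) by (auto simp: affine_funs_def)
  have e: "\<xi> ((1 - t) *\<^sub>R x + t *\<^sub>R y) = (1 - t) * \<xi> x + t * \<xi> y"
    by (simp add: \<xi> inner_simps algebra_simps)
  have "f ((1 - t) *\<^sub>R x + t *\<^sub>R y) + ereal (\<xi> ((1 - t) *\<^sub>R x + t *\<^sub>R y)) \<le>
     (ereal (1 - t) * f x + ereal t * f y) + ereal ((1 - t) * \<xi> x + t * \<xi> y)"
    unfolding e using ereal_convex_onD[OF assms(1) xy] t by (intro add_right_mono) auto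
  also have "\<dots> = ereal (1 - t) * (f x + ereal (\<xi> x)) + ereal t * (f y + ereal (\<xi> y))"
    using assms(2)[OF xy(1)] assms(2)[OF xy(2)] t by (cases "f x"; cases "f y") (auto simp: algebra_simps)
  finally show "f ((1 - t) *\<^sub>R x + t *\<^sub>R y) + ereal (\<xi> ((1 - t) *\<^sub>R x + t *\<^sub>R y)) \<le>
    ereal (1 - t) * (f x + ereal (\<xi> x)) + ereal t * (f y + ereal (\<xi> y))" .
qed

lemma ereal_convex_on_midpoint:
  assumes cvx: "ereal_convex_on P g" and nonneg: "\<And>x. x \<in> P \<Longrightarrow> 0 \<le> g x"
    and P: "x \<in> P" "2 *\<^sub>R c - x \<in> P" "c \<in> P"
  shows "2 * e2ennreal (g c) \<le> e2ennreal (g x) + e2ennreal (g (2 *\<^sub>R c - x))"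
proof (cases "g x = \<infinity> \<or> g (2 *\<^sub>R c - x) = \<infinity>")
  case True
  then show ?thesis by auto
next
  case False
  obtain u where u: "g x = ereal u" "0 \<le> u" using False nonneg[OF P(1)] by (cases "g x") auto
  obtain w where w: "g (2 *\<^sub>R c - x) = ereal w" "0 \<le> w" using False nonneg[OF P(2)] by (cases "g (2 *\<^sub>R c - x)") auto
  have c: "(1 - 1 / 2) *\<^sub>R x + (1 / 2) *\<^sub>R (2 *\<^sub>R c - x) = c"
    by (simp add: algebra_simps)
  have le: "g c \<le> ereal ((1 - 1 / 2) * u + 1 / 2 * w)"
    using ereal_convex_on_le[OF cvx P(1,2), of "1/2" u w] u w unfolding c by simp
  then obtain z where z: "g c = ereal z" "0 \<le> z" using nonneg[OF P(3)] by (cases "g c") auto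
  have "2 * z \<le> u + w" using le z by simp
  then have "ennreal (2 * z) \<le> ennreal (u + w)" by (rule ennreal_leI)
  then show ?thesis using u w z by (simp add: ennreal_mult ennreal_plus)
qed

section \<open>Measurability, integrability and mean value estimates on the polytope\<close>

context delzant_polytope
begin

lemma measurable_leb_iff: "f \<in> borel_measurable (leb_on P) \<longleftrightarrow> f \<in> borel_measurable (restrict_space borel P)"
  by (rule arg_cong2[where f="(\<in>)"], rule refl, rule measurable_cong_sets) (auto simp: sets_restrict_space)

lemma space_leb [simp]: "space (leb_on P) = P"
  by (simp add: space_restrict_space)

lemma finite_measure_leb: "finite_measure (leb_on P)"
proof
  have "emeasure lborel P < \<infinity>" using bounded_P by (rule emeasure_bounded_finite)
  then show "emeasure (leb_on P) (space (leb_on P)) \<noteq> \<infinity>"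
    by (simp add: emeasure_restrict_space)
qed

sublocale leb: finite_measure "leb_on P" by (rule finite_measure_leb)

lemma measure_leb: "measure (leb_on P) P = vol P"
  by (simp add: measure_restrict_space vol_def)

lemma vol_pos: "vol P > 0"
proof -
  obtain e where e: "e > 0" "ball x0 e \<subseteq> P" using x0_interior mem_interior by metis
  have "0 < measure lborel (ball x0 e)"
    using e by (simp add: content_ball_pos)
  also have "\<dots> \<le> measure lborel P"
    using e emeasure_bounded_finite[OF bounded_P] by (intro measure_mono_fmeasurable) (auto simp: fmeasurable_def)
  finally show ?thesis by (simp add: vol_def)
qed

lemma measurable_bdry:
  assumes "f \<in> borel_measurable (restrict_space borel P)" shows "f \<in> borel_measurable \<sigma>"
proof -
  have "f \<in> borel_measurable (restrict_space borel (frontier P))"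
    using assms frontier_subset by (rule measurable_restrict_mono)
  then show ?thesis by (subst measurable_cong_sets[OF sets_bdry refl])
qed

lemma integrable_leb_continuous:
  fixes g :: "real ^ 'n \<Rightarrow> 'b::{banach, second_countable_topology}"
  assumes "continuous_on P g" shows "integrable (leb_on P) g"
  using borel_integrable_compact[OF compact_P assms] by (subst integrable_restrict_space) auto

lemma integrable_bdry_continuous:
  fixes g :: "real ^ 'n \<Rightarrow> real"
  assumes "continuous_on P g" shows "integrable \<sigma> g"
proof -
  have "bounded (g ` P)"
    using compact_continuous_image[OF assms compact_P] by (rule compact_imp_bounded)
  then obtain k where k: "\<And>x. x \<in> P \<Longrightarrow> norm (g x) \<le> k" unfolding bounded_iff by auto
  show ?thesis
  proof (rule bdry.integrable_const_bound[of _ k])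
    show "AE x in \<sigma>. norm (g x) \<le> k" using k frontier_subset by (intro AE_I2) auto
    show "g \<in> borel_measurable \<sigma>"
      using assms by (intro measurable_bdry borel_measurable_continuous_on_restrict)
  qed
qed

lemma continuous_on_affine: "\<xi> \<in> affine_funs \<Longrightarrow> continuous_on A (\<xi> :: real ^ 'n \<Rightarrow> real)"
  by (auto simp: affine_funs_def continuous_on_eq_continuous_within[symmetric] intro!: continuous_intros
      cong: continuous_on_cong_simp)

lemma bounded_affine:
  assumes "\<xi> \<in> affine_funs"
  obtains k where "k > 0" "\<And>x. x \<in> P \<Longrightarrow> \<bar>\<xi> x :: real\<bar> \<le> k"
proof -
  have "bounded (\<xi> ` P)"
    using compact_continuous_image[OF continuous_on_affine[OF assms] compact_P] by (rule compact_imp_bounded)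
  then obtain k where "k > 0" "\<And>y. y \<in> \<xi> ` P \<Longrightarrow> norm y \<le> k" unfolding bounded_pos by auto
  then show ?thesis using that[of k] by auto
qed

lemma CVX_D:
  assumes "f \<in> CVX P"
  shows "x \<in> P \<Longrightarrow> f x \<noteq> -\<infinity>" "lsc_on P f" "ereal_convex_on P f" "f \<in> borel_measurable (restrict_space borel P)"
    "f \<in> borel_measurable (leb_on P)" "f \<in> borel_measurable \<sigma>"
  using assms measurable_lsc_on[OF _ borel_P] measurable_bdry
  by (auto simp: CVX_def measurable_leb_iff)

lemma CVX_bounded_below:
  assumes "f \<in> CVX P"
  obtains m where "\<And>x. x \<in> P \<Longrightarrow> ereal m \<le> f x"
  using lsc_on_compact_bounded_below[OF CVX_D(2)[OF assms] compact_P CVX_D(1)[OF assms]] by metis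

lemma CVX_add_affine:
  assumes f: "f \<in> CVX P" and \<xi>: "\<xi> \<in> affine_funs"
  shows "(\<lambda>x. f x + ereal (\<xi> x)) \<in> CVX P"
proof -
  have "\<exists>x\<in>P. f x \<noteq> \<infinity>" using f by (auto simp: CVX_def)
  then have "\<exists>x\<in>P. f x + ereal (\<xi> x) \<noteq> \<infinity>" by auto
  then show ?thesis
    using lsc_on_add_continuous[OF CVX_D(2)[OF f] continuous_on_affine[OF \<xi>]]
      ereal_convex_on_add_affine[OF CVX_D(3)[OF f] CVX_D(1)[OF f] \<xi>] CVX_D(1)[OF f]
    by (auto simp: CVX_def)
qed

lemma E1_CVX: "f \<in> E1 P \<Longrightarrow> f \<in> CVX P"
  by (simp add: E1_def)

lemma E1_AE: assumes "f \<in> E1 P" shows "AE x in leb_on P. f x = ereal (real_of_ereal (f x))"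
proof -
  have [measurable]: "f \<in> borel_measurable (leb_on P)" using assms by (simp add: E1_def CVX_D)
  have "(\<integral>\<^sup>+x. e2ennreal \<bar>f x\<bar> \<partial>leb_on P) \<noteq> \<infinity>"
    using assms by (intro less_imp_neq) (simp add: E1_def ereal_integrable_def)
  then have "AE x in leb_on P. e2ennreal \<bar>f x\<bar> \<noteq> \<infinity>"
    by (intro nn_integral_noteq_infinite) measurable
  then show ?thesis
  proof eventually_elim
    case (elim x)
    then show ?case by (cases "f x") auto
  qed
qed

lemma E1_integrable: assumes "f \<in> E1 P" shows "integrable (leb_on P) (\<lambda>x. real_of_ereal (f x))"
proof (rule integrableI_bounded)
  have [measurable]: "f \<in> borel_measurable (leb_on P)" using assms by (simp add: E1_def CVX_D)
  show "(\<lambda>x. real_of_ereal (f x)) \<in> borel_measurable (leb_on P)" by measurable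
  have "(\<integral>\<^sup>+x. ennreal (norm (real_of_ereal (f x))) \<partial>leb_on P) \<le> (\<integral>\<^sup>+x. e2ennreal \<bar>f x\<bar> \<partial>leb_on P)"
  proof (rule nn_integral_mono)
    fix x show "ennreal (norm (real_of_ereal (f x))) \<le> e2ennreal \<bar>f x\<bar>"
      by (cases "f x") auto
  qed
  also have "\<dots> < \<infinity>" using assms by (simp add: E1_def ereal_integrable_def)
  finally show "(\<integral>\<^sup>+x. ennreal (norm (real_of_ereal (f x))) \<partial>leb_on P) < \<infinity>" .
qed

text \<open>Only the positive part has to be controlled: lower semicontinuity on the compact set P
  bounds f from below.\<close>

lemma E1_I:
  assumes f: "f \<in> CVX P" and fin: "(\<integral>\<^sup>+x. e2ennreal (f x) \<partial>leb_on P) < \<infinity>"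
  shows "f \<in> E1 P"
proof -
  have [measurable]: "f \<in> borel_measurable (leb_on P)" using f by (rule CVX_D)
  obtain m where m: "\<And>x. x \<in> P \<Longrightarrow> ereal m \<le> f x" using CVX_bounded_below[OF f] by metis
  have "(\<integral>\<^sup>+x. e2ennreal \<bar>f x\<bar> \<partial>leb_on P) \<le> (\<integral>\<^sup>+x. e2ennreal (f x) + ennreal \<bar>m\<bar> \<partial>leb_on P)"
  proof (rule nn_integral_mono)
    fix x assume "x \<in> space (leb_on P)"
    then have x: "ereal m \<le> f x" using m by simp
    show "e2ennreal \<bar>f x\<bar> \<le> e2ennreal (f x) + ennreal \<bar>m\<bar>"
    proof (cases "f x")
      case (real z)
      then have "\<bar>z\<bar> \<le> max 0 z + \<bar>m\<bar>" using x by simp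
      then have "ennreal \<bar>z\<bar> \<le> ennreal (max 0 z + \<bar>m\<bar>)" by (rule ennreal_leI)
      moreover have "ennreal (max 0 z) = ennreal z" by (cases "z \<ge> 0") (auto simp: max_def ennreal_neg)
      ultimately show ?thesis using real by (simp add: ennreal_plus)
    qed (use x in auto)
  qed
  also have "\<dots> = (\<integral>\<^sup>+x. e2ennreal (f x) \<partial>leb_on P) + ennreal \<bar>m\<bar> * emeasure (leb_on P) P"
    by (subst nn_integral_add) auto
  also have "\<dots> < \<infinity>"
    using fin by (auto simp: ennreal_mult_less_top leb.emeasure_eq_measure)
  finally show ?thesis using f by (simp add: E1_def ereal_integrable_def CVX_D)
qed

lemma E1_add_affine:
  assumes f: "f \<in> E1 P" and \<xi>: "\<xi> \<in> affine_funs"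
  shows "(\<lambda>x. f x + ereal (\<xi> x)) \<in> E1 P"
proof (rule E1_I)
  show C: "(\<lambda>x. f x + ereal (\<xi> x)) \<in> CVX P" using E1_CVX[OF f] \<xi> by (rule CVX_add_affine)
  have [measurable]: "f \<in> borel_measurable (leb_on P)" using E1_CVX[OF f] by (rule CVX_D)
  obtain k where k: "k > 0" "\<And>x. x \<in> P \<Longrightarrow> \<bar>\<xi> x\<bar> \<le> k" using bounded_affine[OF \<xi>] by metis
  have "(\<integral>\<^sup>+x. e2ennreal (f x + ereal (\<xi> x)) \<partial>leb_on P) \<le> (\<integral>\<^sup>+x. e2ennreal \<bar>f x\<bar> + ennreal k \<partial>leb_on P)"
  proof (rule nn_integral_mono)
    fix x assume "x \<in> space (leb_on P)"
    then have x: "\<xi> x \<le> k" using k(2)[of x] by simp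
    show "e2ennreal (f x + ereal (\<xi> x)) \<le> e2ennreal \<bar>f x\<bar> + ennreal k"
    proof (cases "f x")
      case (real z)
      have "ennreal (z + \<xi> x) \<le> ennreal (\<bar>z\<bar> + k)" using x by (intro ennreal_leI) auto
      then show ?thesis using real k by (simp add: ennreal_plus)
    qed auto
  qed
  also have "\<dots> = (\<integral>\<^sup>+x. e2ennreal \<bar>f x\<bar> \<partial>leb_on P) + ennreal k * emeasure (leb_on P) P"
    by (subst nn_integral_add) auto
  also have "\<dots> < \<infinity>"
    using f by (auto simp: ennreal_mult_less_top leb.emeasure_eq_measure E1_def ereal_integrable_def)
  finally show "(\<integral>\<^sup>+x. e2ennreal (f x + ereal (\<xi> x)) \<partial>leb_on P) < \<infinity>" .
qed

lemma nn_integral_E1_nonneg: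
  assumes f: "f \<in> E1 P" and nonneg: "\<And>x. x \<in> P \<Longrightarrow> 0 \<le> f x"
  shows "(\<integral>\<^sup>+x. e2ennreal (f x) \<partial>leb_on P) = ennreal (\<integral>x. real_of_ereal (f x) \<partial>leb_on P)"
proof -
  have "(\<integral>\<^sup>+x. e2ennreal (f x) \<partial>leb_on P) = (\<integral>\<^sup>+x. ennreal (real_of_ereal (f x)) \<partial>leb_on P)"
    using E1_AE[OF f] by (intro nn_integral_cong_AE, eventually_elim) (metis e2ennreal_ereal)
  also have "\<dots> = ennreal (\<integral>x. real_of_ereal (f x) \<partial>leb_on P)"
    using nonneg by (intro nn_integral_eq_integral E1_integrable[OF f] AE_I2) (auto intro: real_of_ereal_pos)
  finally show ?thesis .
qed

text \<open>The estimates for cones and hyperplanes are formulated for Borel functions on the whole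
  space, so functions on P enter them extended by zero.\<close>

lemma borel_measurable_zero_extension:
  assumes "f \<in> borel_measurable (restrict_space borel P)"
  shows "(\<lambda>x. if x \<in> P then e2ennreal (f x) else 0) \<in> borel_measurable borel"
proof -
  have "(\<lambda>x. e2ennreal (f x)) \<in> borel_measurable (restrict_space borel P)"
    using assms by measurable
  then show ?thesis
    by (intro measurable_If_restrict_space_iff[THEN iffD2]) auto
qed

lemma mean_value_convex:
  assumes f: "f \<in> CVX P" and nonneg: "\<And>x. x \<in> P \<Longrightarrow> 0 \<le> f x" and ball: "ball c \<rho> \<subseteq> P" and \<rho>: "\<rho> > 0"
  shows "emeasure lborel (ball c \<rho>) * e2ennreal (f c) \<le> (\<integral>\<^sup>+x. e2ennreal (f x) \<partial>leb_on P)"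
proof -
  define \<phi> where "\<phi> x = (if x \<in> P then e2ennreal (f x) else 0)" for x
  have [measurable]: "\<phi> \<in> borel_measurable borel"
    unfolding \<phi>_def by (rule borel_measurable_zero_extension[OF CVX_D(4)[OF f]])
  have c: "c \<in> P" using ball \<rho> by auto
  have "emeasure lborel (ball c \<rho>) * \<phi> c \<le> (\<integral>\<^sup>+x. \<phi> x * indicator (ball c \<rho>) x \<partial>lborel)"
  proof (rule emeasure_ball_mult_le_nn_integral)
    show "AE x in lborel. x \<in> ball c \<rho> \<longrightarrow> 2 * \<phi> c \<le> \<phi> x + \<phi> (2 *\<^sub>R c - x)"
    proof (intro AE_I2 impI)
      fix x assume x: "x \<in> ball c \<rho>"
      have "c - (2 *\<^sub>R c - x) = x - c" by (simp add: algebra_simps scaleR_2)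
      then have "dist c (2 *\<^sub>R c - x) = dist c x" unfolding dist_norm by (simp only: norm_minus_commute)
      then have "2 *\<^sub>R c - x \<in> P" "x \<in> P" using x ball by auto
      then show "2 * \<phi> c \<le> \<phi> x + \<phi> (2 *\<^sub>R c - x)"
        using ereal_convex_on_midpoint[OF CVX_D(3)[OF f] nonneg, of x c] c by (simp add: \<phi>_def)
    qed
  qed (auto intro: nn_integral_lborel_reflect)
  also have "\<dots> \<le> (\<integral>\<^sup>+x. \<phi> x * indicator P x \<partial>lborel)"
    using ball by (intro nn_integral_mono) (auto simp: indicator_def)
  also have "\<dots> = (\<integral>\<^sup>+x. \<phi> x \<partial>leb_on P)" by (subst nn_integral_restrict_space) auto
  also have "\<dots> = (\<integral>\<^sup>+x. e2ennreal (f x) \<partial>leb_on P)"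
    by (intro nn_integral_cong) (simp add: \<phi>_def)
  finally show ?thesis using c by (simp add: \<phi>_def)
qed

text \<open>By the mean value inequality an infinite value at the centre of a ball in P would make
  the integral over P infinite.\<close>

lemma E1_finite_interior:
  assumes f: "f \<in> E1 P" and c: "c \<in> interior P"
  shows "f c \<noteq> \<infinity>"
proof
  assume inf: "f c = \<infinity>"
  obtain m where m: "\<And>x. x \<in> P \<Longrightarrow> ereal m \<le> f x" using CVX_bounded_below[OF E1_CVX[OF f]] by metis
  have aff: "(\<lambda>x. - m) \<in> affine_funs" by (auto simp: affine_funs_def intro!: exI[of _ 0] exI[of _ "- m"])
  define g where "g x = f x + ereal (- m)" for x
  have g: "g \<in> E1 P" using E1_add_affine[OF f aff] by (simp add: g_def[abs_def])
  have nn: "0 \<le> g x" if "x \<in> P" for x using m[OF that] by (cases "f x") (auto simp: g_def)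
  obtain \<rho> where \<rho>: "\<rho> > 0" "ball c \<rho> \<subseteq> P" using c mem_interior by metis
  have "emeasure lborel (ball c \<rho>) * e2ennreal (g c) \<le> (\<integral>\<^sup>+x. e2ennreal (g x) \<partial>leb_on P)"
    using E1_CVX[OF g] nn \<rho> by (intro mean_value_convex) auto
  also have "\<dots> < \<infinity>" by (simp add: nn_integral_E1_nonneg[OF g nn])
  finally have "emeasure lborel (ball c \<rho>) * top < \<infinity>" using inf by (simp add: g_def)
  moreover have "emeasure lborel (ball c \<rho>) \<noteq> 0"
    using content_ball_pos[OF \<rho>(1), of c] by (auto simp: measure_def)
  ultimately show False by (simp add: ennreal_mult_top)
qed

lemma E1_nonneg_mean_value:
  assumes f: "f \<in> E1 P" and nonneg: "\<And>x. x \<in> P \<Longrightarrow> 0 \<le> f x" and ball: "ball c \<rho> \<subseteq> P" and \<rho>: "\<rho> > 0"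
  shows "measure lborel (ball c \<rho>) * real_of_ereal (f c) \<le> (\<integral>x. real_of_ereal (f x) \<partial>leb_on P)"
proof -
  have "c \<in> interior P" using ball \<rho> by (meson mem_interior)
  then have fin: "f c \<noteq> \<infinity>" and cP: "c \<in> P" using E1_finite_interior[OF f] interior_subset by auto
  then obtain z where z: "f c = ereal z" "0 \<le> z" using nonneg[OF cP] by (cases "f c") auto
  have "emeasure lborel (ball c \<rho>) * e2ennreal (f c) \<le> ennreal (\<integral>x. real_of_ereal (f x) \<partial>leb_on P)"
    using mean_value_convex[OF E1_CVX[OF f] nonneg ball \<rho>] nn_integral_E1_nonneg[OF f nonneg] by simp
  moreover have "emeasure lborel (ball c \<rho>) = ennreal (measure lborel (ball c \<rho>))"
    by (intro emeasure_eq_ennreal_measure) (use emeasure_bounded_finite[of "ball c \<rho>"] in auto)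
  ultimately have "ennreal (measure lborel (ball c \<rho>) * z) \<le> ennreal (\<integral>x. real_of_ereal (f x) \<partial>leb_on P)"
    using z by (simp add: ennreal_mult)
  moreover have "0 \<le> (\<integral>x. real_of_ereal (f x) \<partial>leb_on P)"
    using nonneg by (intro integral_nonneg_AE AE_I2) (auto intro: real_of_ereal_pos)
  ultimately show ?thesis using z by (simp add: ennreal_le_iff)
qed

lemma normalizedD:
  assumes "f \<in> normalized P x0 \<F>"
  shows "f \<in> \<F>" "x \<in> P \<Longrightarrow> 0 \<le> f x" "f x0 = 0"
proof -
  show "f \<in> \<F>" "f x0 = 0" using assms by (auto simp: normalized_def)
  show "0 \<le> f x" if "x \<in> P"
  proof -
    have "(INF x\<in>P. f x) = 0" using assms by (auto simp: normalized_def)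
    then show ?thesis using INF_lower[OF that, of f] by simp
  qed
qed

lemma normalizedI:
  assumes "f \<in> \<F>" "\<And>x. x \<in> P \<Longrightarrow> 0 \<le> f x" "f x0 = 0"
  shows "f \<in> normalized P x0 \<F>"
proof -
  have "(INF x\<in>P. f x) = 0"
    using assms x0_P by (intro antisym INF_greatest) (metis INF_lower, auto)
  then show ?thesis using assms by (simp add: normalized_def)
qed

lemma trace_CVX:
  assumes f: "f \<in> CVX P" and nonneg: "\<And>x. x \<in> P \<Longrightarrow> 0 \<le> f x" and f0: "f x0 = 0"
  shows "(\<integral>\<^sup>+x. e2ennreal (f x) \<partial>leb_on P) \<le> ennreal trace_const * (\<integral>\<^sup>+x. e2ennreal (f x) \<partial>\<sigma>)"
proof -
  define \<phi> where "\<phi> x = (if x \<in> P then e2ennreal (f x) else 0)" for x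
  have [measurable]: "\<phi> \<in> borel_measurable borel"
    unfolding \<phi>_def by (rule borel_measurable_zero_extension[OF CVX_D(4)[OF f]])
  have "(\<integral>\<^sup>+x. \<phi> x \<partial>leb_on P) \<le> ennreal trace_const * (\<integral>\<^sup>+x. \<phi> x \<partial>\<sigma>)"
  proof (rule nn_integral_P_le_bdry)
    fix y and s :: real assume y: "y \<in> frontier P" and s: "0 < s" "s \<le> 1"
    then have "y \<in> P" using frontier_subset by auto
    then have "f (x0 + s *\<^sub>R (y - x0)) \<le> f y"
      using CVX_D(3)[OF f] x0_P f0 nonneg s by (intro ereal_convex_on_ray_le) auto
    then show "\<phi> (x0 + s *\<^sub>R (y - x0)) \<le> \<phi> y"
      using \<open>y \<in> P\<close> by (auto simp: \<phi>_def intro: e2ennreal_mono)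
  qed simp
  moreover have "(\<integral>\<^sup>+x. \<phi> x \<partial>leb_on P) = (\<integral>\<^sup>+x. e2ennreal (f x) \<partial>leb_on P)"
    by (intro nn_integral_cong) (simp add: \<phi>_def)
  moreover have "(\<integral>\<^sup>+x. \<phi> x \<partial>\<sigma>) = (\<integral>\<^sup>+x. e2ennreal (f x) \<partial>\<sigma>)"
    using frontier_subset by (intro nn_integral_cong) (auto simp: \<phi>_def)
  ultimately show ?thesis by simp
qed

end

section \<open>The functional and the J-norm\<close>

lemma convex_on_max_affine:
  assumes "finite T" "T \<noteq> {}" shows "convex_on UNIV (max_affine T)"
proof (rule convex_onI)
  fix t :: real and x y assume t: "0 < t" "t < 1"
  obtain a b where ab: "(a, b) \<in> T" "max_affine T ((1 - t) *\<^sub>R x + t *\<^sub>R y) = a \<bullet> ((1 - t) *\<^sub>R x + t *\<^sub>R y) + b"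
    using max_affine_in[OF assms] by metis
  have "max_affine T ((1 - t) *\<^sub>R x + t *\<^sub>R y) = (1 - t) * (a \<bullet> x + b) + t * (a \<bullet> y + b)"
    unfolding ab(2) by (simp add: inner_simps algebra_simps)
  also have "\<dots> \<le> (1 - t) * max_affine T x + t * max_affine T y"
    using t max_affine_ge[OF assms(1) ab(1)] by (intro add_mono mult_left_mono) auto
  finally show "max_affine T ((1 - t) *\<^sub>R x + t *\<^sub>R y) \<le> (1 - t) * max_affine T x + t * max_affine T y" .
qed simp

lemma continuous_on_max_affine:
  assumes "finite T" "T \<noteq> {}" shows "continuous_on A (max_affine T)"
  using convex_on_continuous[OF open_UNIV convex_on_max_affine[OF assms]]
  by (rule continuous_on_subset) simp

lemma lsc_on_cong:
  assumes "lsc_on P f" "\<And>x. x \<in> P \<Longrightarrow> f x = g x"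
  shows "lsc_on P g"
  unfolding lsc_on_def
proof
  fix x assume x: "x \<in> P"
  have "Liminf (at x within P) f = Liminf (at x within P) g"
    by (rule Liminf_eq) (auto simp: eventually_at_filter assms(2))
  then show "g x \<le> Liminf (at x within P) g"
    using assms x by (auto simp: lsc_on_def)
qed

lemma lsc_on_continuous:
  fixes g :: "'a::topological_space \<Rightarrow> real"
  assumes "continuous_on P g" shows "lsc_on P (\<lambda>x. ereal (g x))"
proof -
  have "lsc_on P (\<lambda>x. 0 :: ereal)" by (auto simp: lsc_on_def le_Liminf_iff)
  from lsc_on_add_continuous[OF this assms] show ?thesis by simp
qed

lemma CVX_real:
  assumes g: "continuous_on P g" "convex_on P g" and f: "\<And>x. x \<in> P \<Longrightarrow> f x = ereal (g x)" and P: "P \<noteq> {}"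
  shows "f \<in> CVX P"
proof -
  have "lsc_on P f" using lsc_on_continuous[OF g(1)] by (rule lsc_on_cong) (simp add: f)
  moreover have "ereal_convex_on P f"
    unfolding ereal_convex_on_def
  proof (intro ballI)
    fix x y t assume xy: "x \<in> P" "y \<in> P" and t: "t \<in> {0<..<1::real}"
    have "convex P" using g(2) by (rule convex_on_imp_convex)
    then have "(1 - t) *\<^sub>R x + t *\<^sub>R y \<in> P" using xy t by (simp add: convex_alt)
    moreover have "g ((1 - t) *\<^sub>R x + t *\<^sub>R y) \<le> (1 - t) * g x + t * g y"
      using t xy by (intro convex_onD[OF g(2)]) auto
    ultimately show "f ((1 - t) *\<^sub>R x + t *\<^sub>R y) \<le> ereal (1 - t) * f x + ereal t * f y"
      using f xy by simp
  qed
  ultimately show ?thesis using f P by (auto simp: CVX_def)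
qed

lemma affine_funs_uminus: assumes "\<xi> \<in> affine_funs" shows "(\<lambda>x. - \<xi> x) \<in> affine_funs"
proof -
  obtain a b where "\<And>x. \<xi> x = a \<bullet> x + b" using assms by (auto simp: affine_funs_def)
  then show ?thesis
    unfolding affine_funs_def by (intro CollectI exI[of _ "- a"] exI[of _ "- b"]) simp
qed

lemma affine_funs_add:
  assumes "\<xi> \<in> affine_funs" "\<eta> \<in> affine_funs" shows "(\<lambda>x. \<xi> x + \<eta> x) \<in> affine_funs"
proof -
  obtain a b where "\<And>x. \<xi> x = a \<bullet> x + b" using assms by (auto simp: affine_funs_def)
  moreover obtain a' b' where "\<And>x. \<eta> x = a' \<bullet> x + b'" using assms by (auto simp: affine_funs_def)
  ultimately show ?thesis
    unfolding affine_funs_def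
    by (intro CollectI exI[of _ "a + a'"] exI[of _ "b + b'"]) (simp add: inner_add_left)
qed

lemma affine_funs_const: "(\<lambda>x. c) \<in> affine_funs"
  unfolding affine_funs_def by (intro CollectI exI[of _ 0] exI[of _ c]) simp

lemma affine_funsI: "(\<lambda>x. a \<bullet> x + b) \<in> affine_funs"
  by (auto simp: affine_funs_def)

locale extremal_polytope = delzant_polytope r lam d x0
  for r :: nat and lam :: "nat \<Rightarrow> int ^ 'n" and d :: "nat \<Rightarrow> int" and x0 :: "real ^ 'n" +
  fixes V :: "real ^ 'n \<Rightarrow> real"
  assumes extremal: "extremal_affine r lam d V"
begin

abbreviation "L \<equiv> L_fun r lam d V"

definition W :: "real ^ 'n \<Rightarrow> real" where "W x = sbar r lam d + V x"

text \<open>The functional L on continuous functions, where both integrals are finite, as a real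
  number; \<open>L_real\<close> makes the connection.\<close>

definition Lam :: "(real ^ 'n \<Rightarrow> real) \<Rightarrow> real" where
  "Lam g = (\<integral>x. g x \<partial>\<sigma>) - (\<integral>x. W x * g x \<partial>leb_on P)"

lemma W_affine: "W \<in> affine_funs"
proof -
  have "V \<in> affine_funs" using extremal by (simp add: extremal_affine_def)
  from affine_funs_add[OF affine_funs_const this] show ?thesis by (simp add: W_def[abs_def])
qed

lemma W_bound: obtains C where "C > 0" "\<And>x. x \<in> P \<Longrightarrow> \<bar>W x\<bar> \<le> C"
  using bounded_affine[OF W_affine] by metis

lemma measurable_W [measurable]: "W \<in> borel_measurable borel"
  using W_affine by (intro borel_measurable_continuous_onI continuous_on_affine)

lemma measurable_W_leb [measurable]: "W \<in> borel_measurable (leb_on P)"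
  by (rule measurable_restrict_space1) simp

lemma integrable_W_mult:
  assumes "integrable (leb_on P) f" shows "integrable (leb_on P) (\<lambda>x. W x * f x)"
proof -
  obtain C where C: "C > 0" "\<And>x. x \<in> P \<Longrightarrow> \<bar>W x\<bar> \<le> C" using W_bound by metis
  have [measurable]: "f \<in> borel_measurable (leb_on P)" using assms by simp
  show ?thesis
  proof (rule Bochner_Integration.integrable_bound)
    show "integrable (leb_on P) (\<lambda>x. C * f x)" using assms by simp
    show "AE x in leb_on P. norm (W x * f x) \<le> norm (C * f x)"
      using C by (intro AE_I2) (auto simp: abs_mult intro!: mult_right_mono)
  qed measurable
qed

lemma integral_W_mult_le:
  assumes f: "integrable (leb_on P) f" and C: "\<And>x. x \<in> P \<Longrightarrow> \<bar>W x\<bar> \<le> C"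
  shows "\<bar>\<integral>x. W x * f x \<partial>leb_on P\<bar> \<le> C * (\<integral>x. \<bar>f x\<bar> \<partial>leb_on P)"
proof -
  have "\<bar>\<integral>x. W x * f x \<partial>leb_on P\<bar> \<le> (\<integral>x. \<bar>W x * f x\<bar> \<partial>leb_on P)"
    using integral_norm_bound[of "leb_on P" "\<lambda>x. W x * f x"] by simp
  also have "\<dots> \<le> (\<integral>x. C * \<bar>f x\<bar> \<partial>leb_on P)"
    using C f by (intro integral_mono integrable_abs integrable_W_mult integrable_mult_right)
      (auto simp: abs_mult intro!: mult_right_mono)
  finally show ?thesis by simp
qed

lemma L_real:
  assumes g: "continuous_on P g" and f: "\<And>x. x \<in> P \<Longrightarrow> f x = ereal (g x)"
  shows "ereal_integral \<sigma> f = ereal (\<integral>x. g x \<partial>\<sigma>)" "L f = ereal (Lam g)"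
proof -
  show 1: "ereal_integral \<sigma> f = ereal (\<integral>x. g x \<partial>\<sigma>)"
    using f frontier_subset
    by (intro ereal_integral_eq_lebesgue_integral integrable_bdry_continuous g) auto
  have "(\<integral>x. (sbar r lam d + V x) * real_of_ereal (f x) \<partial>leb_on P) = (\<integral>x. W x * g x \<partial>leb_on P)"
    using f by (intro Bochner_Integration.integral_cong) (auto simp: W_def)
  then show "L f = ereal (Lam g)" by (simp add: L_fun_def 1 Lam_def)
qed

lemma L_eq: "L f = ereal_integral \<sigma> f - ereal (\<integral>x. W x * real_of_ereal (f x) \<partial>leb_on P)"
  by (simp add: L_fun_def W_def)

lemma Lam_affine: "\<xi> \<in> affine_funs \<Longrightarrow> Lam \<xi> = 0"
  using extremal by (simp add: extremal_affine_def Lam_def W_def)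

text \<open>This is the defining property of V, extended to functions with infinite boundary
  integral. It permits replacing f by its normalization at \<open>x0\<close> wherever L is
  estimated.\<close>

lemma L_add_affine:
  assumes f: "f \<in> E1 P" and \<xi>: "\<xi> \<in> affine_funs"
  shows "L (\<lambda>x. f x + ereal (\<xi> x)) = L f"
proof -
  obtain m where m: "\<And>x. x \<in> P \<Longrightarrow> ereal m \<le> f x" using CVX_bounded_below[OF E1_CVX[OF f]] by metis
  obtain k where k: "\<And>x. x \<in> P \<Longrightarrow> \<bar>\<xi> x\<bar> \<le> k" using bounded_affine[OF \<xi>] by metis
  have c: "continuous_on P \<xi>" using \<xi> by (rule continuous_on_affine)
  have 1: "ereal_integral \<sigma> (\<lambda>x. f x + ereal (\<xi> x)) = ereal_integral \<sigma> f + ereal (\<integral>x. \<xi> x \<partial>\<sigma>)"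
    using m k frontier_subset
    by (intro bdry.ereal_integral_add_real CVX_D(6) E1_CVX f integrable_bdry_continuous c) auto
  have [measurable]: "f \<in> borel_measurable (leb_on P)" using E1_CVX[OF f] by (rule CVX_D)
  have [measurable]: "\<xi> \<in> borel_measurable (leb_on P)" using integrable_leb_continuous[OF c] by simp
  have "(\<integral>x. W x * real_of_ereal (f x + ereal (\<xi> x)) \<partial>leb_on P) =
      (\<integral>x. W x * real_of_ereal (f x) + W x * \<xi> x \<partial>leb_on P)"
  proof (rule integral_cong_AE)
    show "AE x in leb_on P. W x * real_of_ereal (f x + ereal (\<xi> x)) = W x * real_of_ereal (f x) + W x * \<xi> x"
      using E1_AE[OF f]
    proof eventually_elim
      case (elim x)
      then show ?case by (cases "f x") (auto simp: algebra_simps)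
    qed
  qed measurable
  also have "\<dots> = (\<integral>x. W x * real_of_ereal (f x) \<partial>leb_on P) + (\<integral>x. W x * \<xi> x \<partial>leb_on P)"
    by (intro Bochner_Integration.integral_add integrable_W_mult E1_integrable f integrable_leb_continuous c)
  also have "(\<integral>x. W x * \<xi> x \<partial>leb_on P) = (\<integral>x. \<xi> x \<partial>\<sigma>)"
    using Lam_affine[OF \<xi>] by (simp add: Lam_def)
  finally show ?thesis
    unfolding L_eq 1 by (cases "ereal_integral \<sigma> f") auto
qed

lemma L_affine:
  assumes "affine_on P f" shows "L f = 0"
proof -
  obtain \<xi> where \<xi>: "\<xi> \<in> affine_funs" "\<And>x. x \<in> P \<Longrightarrow> f x = ereal (\<xi> x)"
    using assms by (auto simp: affine_on_def)
  then show ?thesis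
    using L_real(2)[OF continuous_on_affine[OF \<xi>(1)] \<xi>(2)] Lam_affine by (simp add: zero_ereal_def)
qed

lemma bdry_nonneg:
  assumes "\<And>x. x \<in> P \<Longrightarrow> 0 \<le> f x"
  shows "ereal_integral \<sigma> f = enn2ereal (\<integral>\<^sup>+x. e2ennreal (f x) \<partial>\<sigma>)"
  using assms frontier_subset by (intro ereal_integral_nonneg) auto

definition J_term :: "(real ^ 'n \<Rightarrow> ereal) \<Rightarrow> (real ^ 'n \<Rightarrow> real) \<Rightarrow> ereal" where
  "J_term f \<xi> = ereal (1 / vol P * (\<integral>x. real_of_ereal (f x) + \<xi> x \<partial>leb_on P)) - (INF x\<in>P. f x + ereal (\<xi> x))"

lemma J_norm_eq: "J_norm P f = (INF \<xi>\<in>affine_funs. J_term f \<xi>)"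
  by (simp add: J_norm_def J_term_def)

lemma E1_integral_add:
  assumes f: "f \<in> E1 P" and c: "continuous_on P \<xi>"
  shows "(\<integral>x. real_of_ereal (f x + ereal (\<xi> x)) \<partial>leb_on P) = (\<integral>x. real_of_ereal (f x) + \<xi> x \<partial>leb_on P)"
    "(\<integral>x. real_of_ereal (f x) + \<xi> x \<partial>leb_on P) = (\<integral>x. real_of_ereal (f x) \<partial>leb_on P) + (\<integral>x. \<xi> x \<partial>leb_on P)"
proof -
  have [measurable]: "f \<in> borel_measurable (leb_on P)" using E1_CVX[OF f] by (rule CVX_D)
  have [measurable]: "\<xi> \<in> borel_measurable (leb_on P)" using integrable_leb_continuous[OF c] by simp
  show "(\<integral>x. real_of_ereal (f x + ereal (\<xi> x)) \<partial>leb_on P) = (\<integral>x. real_of_ereal (f x) + \<xi> x \<partial>leb_on P)"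
  proof (rule integral_cong_AE)
    show "AE x in leb_on P. real_of_ereal (f x + ereal (\<xi> x)) = real_of_ereal (f x) + \<xi> x"
      using E1_AE[OF f]
    proof eventually_elim
      case (elim x)
      then show ?case by (cases "f x") auto
    qed
  qed measurable
  show "(\<integral>x. real_of_ereal (f x) + \<xi> x \<partial>leb_on P) = (\<integral>x. real_of_ereal (f x) \<partial>leb_on P) + (\<integral>x. \<xi> x \<partial>leb_on P)"
    by (intro Bochner_Integration.integral_add E1_integrable f integrable_leb_continuous c)
qed

text \<open>Among all affine functions, zero is optimal up to a constant factor in the \<open>J\<close>-norm of a
  normalized function: an affine function that touches \<open>g \<ge> 0\<close> from below at \<open>x0\<close> can have a
  very negative mean only if it is large at points on the other side of \<open>x0\<close> from the barycenter,
  where \<open>g\<close> is controlled by its mean.\<close>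

lemma J_term_lower:
  obtains \<kappa> where "\<kappa> > 0"
    "\<And>f \<xi>. f \<in> normalized P x0 (E1 P) \<Longrightarrow> \<xi> \<in> affine_funs \<Longrightarrow>
      ereal (\<kappa> * (\<integral>x. real_of_ereal (f x) \<partial>leb_on P)) \<le> J_term f \<xi>"
proof -
  define v where "v = vol P"
  have v: "v > 0" using vol_pos by (simp add: v_def)
  \<comment> \<open>The barycenter of P: the mean of an affine function is its value there.\<close>
  define b where "b = (1 / v) *\<^sub>R (\<integral>x. x \<partial>leb_on P)"
  have bary: "(\<integral>x. a \<bullet> x + \<beta> \<partial>leb_on P) = v * (a \<bullet> b + \<beta>)" for a \<beta>
  proof -
    have i: "integrable (leb_on P) (\<lambda>x. x)" by (rule integrable_leb_continuous) (rule continuous_on_id)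
    have "(\<integral>x. a \<bullet> x + \<beta> \<partial>leb_on P) = a \<bullet> (\<integral>x. x \<partial>leb_on P) + v * \<beta>"
      using i by (simp add: measure_leb v_def)
    then show ?thesis using v by (simp add: b_def distrib_left)
  qed
  obtain e where e: "e > 0" "ball x0 e \<subseteq> P" using x0_interior mem_interior by metis
  \<comment> \<open>The summand 1 covers the case that \<open>x0\<close> is the barycenter. With
    \<epsilon> = e / (2 N) the point c below is within e / 2 of \<open>x0\<close>, which leaves a
    ball of radius e / 2 about c inside P for the mean value inequality.\<close>
  define N where "N = norm (b - x0) + 1"
  define \<epsilon> where "\<epsilon> = e / (2 * N)"
  have nb: "N > 0" by (simp add: N_def add_nonneg_pos)
  have \<epsilon>: "\<epsilon> > 0" using e nb by (simp add: \<epsilon>_def)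
  define c where "c = x0 - \<epsilon> *\<^sub>R (b - x0)"
  have "dist x0 c = \<epsilon> * norm (b - x0)" using \<epsilon> by (simp add: c_def dist_norm)
  also have "\<dots> \<le> \<epsilon> * N" using \<epsilon> by (simp add: N_def)
  also have "\<dots> = e / 2" using nb by (simp add: \<epsilon>_def)
  finally have dc: "dist x0 c \<le> e / 2" .
  have ball: "ball c (e / 2) \<subseteq> P"
  proof
    fix z assume "z \<in> ball c (e / 2)"
    then have "dist x0 z < e" using dc dist_triangle[of x0 z c] by simp
    then show "z \<in> P" using e by auto
  qed
  define B where "B = measure lborel (ball c (e / 2))"
  have B: "B > 0" using e by (simp add: B_def content_ball_pos)
  have cP: "c \<in> P" using ball e by auto
  \<comment> \<open>Read off from the end of the estimate: the integral of f is v T - v (\<xi> b -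
    m), and - (\<xi> b - m) is at most v T / (B \<epsilon>).\<close>
  define K where "K = v * (1 + v / (B * \<epsilon>))"
  have K: "K > 0" using v B \<epsilon> by (auto simp: K_def intro!: mult_pos_pos add_pos_pos)
  show ?thesis
  proof (rule that[of "1 / K"])
    show "1 / K > 0" using K by simp
    fix f \<xi> assume f: "f \<in> normalized P x0 (E1 P)" and \<xi>: "\<xi> \<in> (affine_funs :: (real ^ 'n \<Rightarrow> real) set)"
    obtain a \<beta> where ab: "\<xi> = (\<lambda>x. a \<bullet> x + \<beta>)" using \<xi> by (auto simp: affine_funs_def)
    have fE: "f \<in> E1 P" and nn: "\<And>x. x \<in> P \<Longrightarrow> 0 \<le> f x" and f0: "f x0 = 0"
      using normalizedD[OF f] by auto
    obtain k where k: "\<And>x. x \<in> P \<Longrightarrow> \<bar>\<xi> x\<bar> \<le> k" using bounded_affine[OF \<xi>] by metis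
    have "ereal (- k) \<le> (INF x\<in>P. f x + ereal (\<xi> x))"
    proof (rule INF_greatest)
      fix x assume x: "x \<in> P"
      show "ereal (- k) \<le> f x + ereal (\<xi> x)" using nn[OF x] k[OF x] by (cases "f x") auto
    qed
    moreover have m0: "(INF x\<in>P. f x + ereal (\<xi> x)) \<le> ereal (\<xi> x0)"
      using INF_lower[OF x0_P, of "\<lambda>x. f x + ereal (\<xi> x)"] f0 by simp
    ultimately obtain m where m: "(INF x\<in>P. f x + ereal (\<xi> x)) = ereal m"
      by (cases "INF x\<in>P. f x + ereal (\<xi> x)") auto
    have m\<xi>: "m \<le> \<xi> x0" using m0 m by simp
    define \<eta> where "\<eta> x = \<xi> x + (- m)" for x
    have \<eta>: "\<eta> \<in> affine_funs" unfolding \<eta>_def by (rule affine_funs_add[OF \<xi> affine_funs_const])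
    define g where "g x = f x + ereal (\<eta> x)" for x
    have g: "g \<in> E1 P" unfolding g_def by (rule E1_add_affine[OF fE \<eta>])
    have gn: "0 \<le> g x" if "x \<in> P" for x
    proof -
      have "ereal m \<le> f x + ereal (\<xi> x)" unfolding m[symmetric] by (rule INF_lower[OF that])
      then show ?thesis by (cases "f x") (auto simp: g_def \<eta>_def)
    qed
    define T where "T = 1 / v * (\<integral>x. real_of_ereal (f x) + \<xi> x \<partial>leb_on P) - m"
    have Jt: "J_term f \<xi> = ereal T" unfolding J_term_def m T_def v_def by simp
    have c\<xi>: "continuous_on P \<xi>" and c\<eta>: "continuous_on P \<eta>" using \<xi> \<eta> by (auto intro: continuous_on_affine)
    have i\<xi>: "(\<integral>x. \<xi> x \<partial>leb_on P) = v * \<xi> b" using bary[of a \<beta>] by (simp add: ab)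
    have i\<eta>: "(\<integral>x. \<eta> x \<partial>leb_on P) = v * (\<xi> b - m)" using bary[of a "\<beta> - m"] by (simp add: ab \<eta>_def algebra_simps)
    have ig: "(\<integral>x. real_of_ereal (g x) \<partial>leb_on P) = v * T"
      unfolding g_def E1_integral_add[OF fE c\<eta>] i\<eta> T_def E1_integral_add[OF fE c\<xi>] i\<xi>
      using v by (simp add: field_simps)
    have "B * real_of_ereal (g c) \<le> v * T"
      unfolding ig[symmetric] B_def using e by (intro E1_nonneg_mean_value g gn ball) auto
    moreover have "\<eta> c \<le> real_of_ereal (g c)"
    proof -
      have "c \<in> interior P" using ball e by (meson mem_interior half_gt_zero)
      then have "f c \<noteq> \<infinity>" by (rule E1_finite_interior[OF fE])
      then show ?thesis using nn[OF cP] by (cases "f c") (auto simp: g_def)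
    qed
    ultimately have "B * \<eta> c \<le> v * T" using B by (meson mult_left_mono less_imp_le order_trans)
    then have \<eta>c: "\<eta> c \<le> v * T / B" using B by (simp add: field_simps)
    \<comment> \<open>The point \<open>x0\<close> lies on the segment from c to b, so \<eta> at c is
      determined by its values at \<open>x0\<close> and b. The value at \<open>x0\<close> is
      nonnegative because m \<le> \<xi> x0, hence a very negative value at b makes \<eta> c
      large.\<close>
    have "\<eta> c = (1 + \<epsilon>) * (\<xi> x0 - m) - \<epsilon> * (\<xi> b - m)"
      by (simp add: \<eta>_def ab c_def inner_simps algebra_simps)
    moreover have "0 \<le> (1 + \<epsilon>) * (\<xi> x0 - m)" using \<epsilon> m\<xi> by simp
    ultimately have "- (\<epsilon> * (\<xi> b - m)) \<le> v * T / B" using \<eta>c by linarith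
    then have "- (\<xi> b - m) \<le> v * T / (B * \<epsilon>)" using \<epsilon> B by (simp add: field_simps)
    then have "v * (- (\<xi> b - m)) \<le> v * (v * T / (B * \<epsilon>))" using v by (intro mult_left_mono) auto
    moreover have "(\<integral>x. real_of_ereal (f x) \<partial>leb_on P) = v * T - v * (\<xi> b - m)"
    proof -
      have "v * T = (\<integral>x. real_of_ereal (f x) \<partial>leb_on P) + v * (\<xi> b - m)"
        unfolding ig[symmetric] g_def E1_integral_add[OF fE c\<eta>] i\<eta> ..
      then show ?thesis by simp
    qed
    ultimately have "(\<integral>x. real_of_ereal (f x) \<partial>leb_on P) \<le> K * T"
      by (simp add: K_def algebra_simps)
    then have "1 / K * (\<integral>x. real_of_ereal (f x) \<partial>leb_on P) \<le> T" using K by (simp add: field_simps)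
    then show "ereal (1 / K * (\<integral>x. real_of_ereal (f x) \<partial>leb_on P)) \<le> J_term f \<xi>"
      by (simp add: Jt)
  qed
qed

section \<open>Equivalence of (b) and (J) through integrals over the polytope\<close>

lemma cond_b_if_integral_bound:
  assumes sub: "\<F> \<subseteq> E1 P" and \<kappa>: "\<kappa> > 0"
    and le: "\<And>f. f \<in> normalized P x0 \<F> \<Longrightarrow> ereal (\<kappa> * (\<integral>x. real_of_ereal (f x) \<partial>leb_on P)) \<le> L f"
  shows "cond_b r lam d V x0 \<F>"
proof -
  obtain C where C: "C > 0" "\<And>x. x \<in> P \<Longrightarrow> \<bar>W x\<bar> \<le> C" using W_bound by metis
  \<comment> \<open>With boundary integral z, interior integral I of f and W-weighted integral A one
    has \<kappa> I \<le> z - A and \<bar>A\<bar> \<le> C I, so z = (z - A) + A \<le> (1 + C /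
    \<kappa>) (z - A).\<close>
  define \<delta> where "\<delta> = 1 / (1 + C / \<kappa>)"
  have pos: "1 + C / \<kappa> > 0" using C \<kappa> by (simp add: add_pos_pos)
  then have \<delta>: "\<delta> > 0" by (simp add: \<delta>_def)
  show ?thesis
    unfolding cond_b_def
  proof (intro exI[of _ \<delta>] conjI ballI)
    show "\<delta> > 0" by fact
    fix f assume f: "f \<in> normalized P x0 \<F>"
    then have fE: "f \<in> E1 P" and nn: "\<And>x. x \<in> P \<Longrightarrow> 0 \<le> f x" using normalizedD sub by blast+
    define I where "I = (\<integral>x. real_of_ereal (f x) \<partial>leb_on P)"
    define A where "A = (\<integral>x. W x * real_of_ereal (f x) \<partial>leb_on P)"
    have "\<bar>A\<bar> \<le> C * (\<integral>x. \<bar>real_of_ereal (f x)\<bar> \<partial>leb_on P)"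
      unfolding A_def by (rule integral_W_mult_le[OF E1_integrable[OF fE] C(2)])
    also have "(\<integral>x. \<bar>real_of_ereal (f x)\<bar> \<partial>leb_on P) = I"
      unfolding I_def using nn by (intro Bochner_Integration.integral_cong) (auto intro!: abs_of_nonneg real_of_ereal_pos)
    finally have A: "\<bar>A\<bar> \<le> C * I" .
    have L: "L f = ereal_integral \<sigma> f - ereal A" by (simp add: L_eq A_def)
    show "ereal \<delta> * ereal_integral \<sigma> f \<le> L f"
    proof (cases "ereal_integral \<sigma> f")
      case (real z)
      have "\<kappa> * I \<le> z - A" using le[OF f] real by (simp add: L I_def)
      then have "C / \<kappa> * (\<kappa> * I) \<le> C / \<kappa> * (z - A)" using C \<kappa> by (intro mult_left_mono) auto
      then have "C * I \<le> C / \<kappa> * (z - A)" using \<kappa> by simp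
      then have "z \<le> (z - A) * (1 + C / \<kappa>)" using A by (simp add: algebra_simps abs_le_iff)
      then have "\<delta> * z \<le> z - A" unfolding \<delta>_def using pos by (simp add: pos_divide_le_eq)
      then show ?thesis by (simp add: L real)
    next
      case PInf
      then show ?thesis by (simp add: L)
    next
      case MInf
      then show ?thesis using bdry_nonneg[OF nn] enn2ereal_nonneg[of "\<integral>\<^sup>+x. e2ennreal (f x) \<partial>\<sigma>"] by simp
    qed
  qed
qed

lemma cond_J_imp_cond_b:
  assumes sub: "\<F> \<subseteq> E1 P" and J: "cond_J r lam d V \<F>"
  shows "cond_b r lam d V x0 \<F>"
proof -
  obtain \<delta> where \<delta>: "\<delta> > 0" "\<And>f. f \<in> \<F> \<Longrightarrow> ereal \<delta> * J_norm P f \<le> L f"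
    using J by (auto simp: cond_J_def)
  obtain \<kappa> where \<kappa>: "\<kappa> > 0"
    "\<And>f \<xi>. f \<in> normalized P x0 (E1 P) \<Longrightarrow> \<xi> \<in> affine_funs \<Longrightarrow>
      ereal (\<kappa> * (\<integral>x. real_of_ereal (f x) \<partial>leb_on P)) \<le> J_term f \<xi>"
    using J_term_lower by metis
  show ?thesis
  proof (rule cond_b_if_integral_bound[OF sub])
    show "\<delta> * \<kappa> > 0" using \<delta> \<kappa> by simp
    fix f assume f: "f \<in> normalized P x0 \<F>"
    then have fE: "f \<in> normalized P x0 (E1 P)" and fF: "f \<in> \<F>" using sub by (auto simp: normalized_def)
    have "ereal (\<kappa> * (\<integral>x. real_of_ereal (f x) \<partial>leb_on P)) \<le> J_norm P f"
      unfolding J_norm_eq by (intro INF_greatest \<kappa> fE)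
    then have "ereal \<delta> * ereal (\<kappa> * (\<integral>x. real_of_ereal (f x) \<partial>leb_on P)) \<le> ereal \<delta> * J_norm P f"
      using \<delta> by (intro ereal_mult_left_mono) auto
    also have "\<dots> \<le> L f" by (rule \<delta>(2)[OF fF])
    finally show "ereal (\<delta> * \<kappa> * (\<integral>x. real_of_ereal (f x) \<partial>leb_on P)) \<le> L f"
      by (simp add: mult.assoc)
  qed
qed

text \<open>Subtracts a supporting affine function at \<open>x0\<close>. Finiteness in the interior
  is a separate hypothesis because the lemma is also applied to elements of
  \<open>C_star r lam d\<close> before these are known to lie in \<open>E1 P\<close>.\<close>

lemma normalize_at_x0:
  assumes f: "f \<in> CVX P" and fin: "\<And>x. x \<in> interior P \<Longrightarrow> f x \<noteq> \<infinity>"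
  obtains \<xi> where "\<xi> \<in> affine_funs" "\<And>x. x \<in> P \<Longrightarrow> 0 \<le> f x + ereal (\<xi> x)" "f x0 + ereal (\<xi> x0) = 0"
proof -
  obtain a where a: "\<And>x. x \<in> P \<Longrightarrow> f x0 + ereal (a \<bullet> (x - x0)) \<le> f x"
    using ereal_convex_subgradient[OF convex_P CVX_D(3)[OF f] x0_interior CVX_D(1)[OF f] fin] by metis
  obtain z where z: "f x0 = ereal z" using CVX_D(1)[OF f x0_P] fin[OF x0_interior] by (cases "f x0") auto
  show ?thesis
  proof (rule that[of "\<lambda>x. (- a) \<bullet> x + (a \<bullet> x0 - z)"])
    show "0 \<le> f x + ereal ((- a) \<bullet> x + (a \<bullet> x0 - z))" if "x \<in> P" for x
      using a[OF that] z by (cases "f x") (auto simp: inner_diff_right)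
    show "(\<lambda>x. (- a) \<bullet> x + (a \<bullet> x0 - z)) \<in> affine_funs" by (rule affine_funsI)
  qed (simp add: z)
qed

text \<open>One is added to \<open>trace_const\<close> to obtain a positive constant, by which
  \<open>cond_b_imp_cond_J\<close> divides.\<close>

lemma trace_E1:
  assumes f: "f \<in> E1 P" and nonneg: "\<And>x. x \<in> P \<Longrightarrow> 0 \<le> f x" and f0: "f x0 = 0"
  shows "ereal (\<integral>x. real_of_ereal (f x) \<partial>leb_on P) \<le> ereal (trace_const + 1) * ereal_integral \<sigma> f"
proof -
  have i: "0 \<le> (\<integral>x. real_of_ereal (f x) \<partial>leb_on P)"
    using nonneg by (intro integral_nonneg_AE AE_I2) (auto intro: real_of_ereal_pos)
  have "ennreal (\<integral>x. real_of_ereal (f x) \<partial>leb_on P) \<le> ennreal trace_const * (\<integral>\<^sup>+x. e2ennreal (f x) \<partial>\<sigma>)"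
    using trace_CVX[OF E1_CVX[OF f] nonneg f0] nn_integral_E1_nonneg[OF f nonneg] by simp
  also have "\<dots> \<le> ennreal (trace_const + 1) * (\<integral>\<^sup>+x. e2ennreal (f x) \<partial>\<sigma>)"
    by (intro mult_right_mono ennreal_leI) auto
  finally have "enn2ereal (ennreal (\<integral>x. real_of_ereal (f x) \<partial>leb_on P)) \<le>
      enn2ereal (ennreal (trace_const + 1) * (\<integral>\<^sup>+x. e2ennreal (f x) \<partial>\<sigma>))"
    by (simp add: less_eq_ennreal.rep_eq)
  then show ?thesis
    using i trace_const_nonneg by (simp add: bdry_nonneg[OF nonneg] times_ennreal.rep_eq del: ennreal_plus)
qed

text \<open>The supporting affine function at \<open>x0\<close> is one competitor in the J-norm, so
  the J-norm of f is at most the mean of its normalization h, which the boundary integral of h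
  controls. Closure under affine functions puts h into the class, and L takes the same value at f
  and h.\<close>

lemma cond_b_imp_cond_J:
  assumes sub: "\<F> \<subseteq> E1 P" and add: "\<And>f \<xi>. f \<in> \<F> \<Longrightarrow> \<xi> \<in> affine_funs \<Longrightarrow> (\<lambda>x. f x + ereal (\<xi> x)) \<in> \<F>"
    and b: "cond_b r lam d V x0 \<F>"
  shows "cond_J r lam d V \<F>"
proof -
  obtain \<delta> where \<delta>: "\<delta> > 0" "\<And>f. f \<in> normalized P x0 \<F> \<Longrightarrow> ereal \<delta> * ereal_integral \<sigma> f \<le> L f"
    using b by (auto simp: cond_b_def)
  define C where "C = trace_const + 1"
  have C: "C > 0" using trace_const_nonneg by (simp add: C_def)
  define \<delta>' where "\<delta>' = \<delta> * vol P / C"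
  have \<delta>': "\<delta>' > 0" using \<delta> C vol_pos by (simp add: \<delta>'_def)
  show ?thesis
    unfolding cond_J_def
  proof (intro exI[of _ \<delta>'] conjI ballI \<delta>')
    fix f assume f: "f \<in> \<F>"
    then have fE: "f \<in> E1 P" using sub by auto
    obtain \<xi> where \<xi>: "\<xi> \<in> affine_funs" "\<And>x. x \<in> P \<Longrightarrow> 0 \<le> f x + ereal (\<xi> x)" "f x0 + ereal (\<xi> x0) = 0"
      using normalize_at_x0[OF E1_CVX[OF fE] E1_finite_interior[OF fE]] by metis
    define h where "h x = f x + ereal (\<xi> x)" for x
    have h: "h \<in> normalized P x0 \<F>"
      unfolding h_def using add[OF f \<xi>(1)] \<xi> by (intro normalizedI) auto
    have hE: "h \<in> E1 P" unfolding h_def by (rule E1_add_affine[OF fE \<xi>(1)])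
    define I where "I = (\<integral>x. real_of_ereal (h x) \<partial>leb_on P)"
    have "(INF x\<in>P. f x + ereal (\<xi> x)) = 0" using h by (simp add: normalized_def h_def)
    then have "J_term f \<xi> = ereal (1 / vol P * I)"
      unfolding J_term_def I_def h_def E1_integral_add(1)[OF fE continuous_on_affine[OF \<xi>(1)]] by simp
    then have "J_norm P f \<le> ereal (1 / vol P * I)"
      unfolding J_norm_eq using INF_lower[OF \<xi>(1), of "J_term f"] by simp
    then have "ereal \<delta>' * J_norm P f \<le> ereal \<delta>' * ereal (1 / vol P * I)"
      using \<delta>' by (intro ereal_mult_left_mono) auto
    also have "\<dots> = ereal (\<delta> / C) * ereal I" using vol_pos by (simp add: \<delta>'_def)
    also have "\<dots> \<le> ereal (\<delta> / C) * (ereal C * ereal_integral \<sigma> h)"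
      unfolding I_def C_def using \<delta> C normalizedD[OF h] hE by (intro ereal_mult_left_mono trace_E1) (auto simp: C_def)
    also have "\<dots> = ereal \<delta> * ereal_integral \<sigma> h"
      using C by (simp add: mult.assoc[symmetric])
    also have "\<dots> \<le> L h" by (rule \<delta>(2)[OF h])
    also have "L h = L f" unfolding h_def by (rule L_add_affine[OF fE \<xi>(1)])
    finally show "ereal \<delta>' * J_norm P f \<le> L f" .
  qed
qed

lemma cond_b_mono: "\<F> \<subseteq> \<G> \<Longrightarrow> cond_b r lam d V x0 \<G> \<Longrightarrow> cond_b r lam d V x0 \<F>"
  by (fastforce simp: cond_b_def normalized_def)

lemma cond_J_mono: "\<F> \<subseteq> \<G> \<Longrightarrow> cond_J r lam d V \<G> \<Longrightarrow> cond_J r lam d V \<F>"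
  by (fastforce simp: cond_J_def)

section \<open>Inclusions between the function spaces\<close>

lemma E1_continuous:
  assumes g: "continuous_on P g" "convex_on P g" and f: "\<And>x. x \<in> P \<Longrightarrow> f x = ereal (g x)"
  shows "f \<in> E1 P"
proof (rule E1_I)
  show "f \<in> CVX P" using g f x0_P by (intro CVX_real) auto
  have "(\<integral>\<^sup>+x. e2ennreal (f x) \<partial>leb_on P) = (\<integral>\<^sup>+x. ennreal (g x) \<partial>leb_on P)"
    using f by (intro nn_integral_cong) auto
  also have "\<dots> < \<infinity>"
    using integrable_leb_continuous[OF g(1)] by (auto elim: integrableE simp: less_top)
  finally show "(\<integral>\<^sup>+x. e2ennreal (f x) \<partial>leb_on P) < \<infinity>" .
qed

lemma poly_star_subset: "poly_star r lam d \<subseteq> P"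
  unfolding poly_star_def using interior_subset rel_interior_subset facet_subset by blast

lemma interior_poly_star: "interior P \<subseteq> poly_star r lam d"
  by (auto simp: poly_star_def)

lemma C_PL_eq: "C_PL P = {f. \<exists>T. finite T \<and> T \<noteq> {} \<and> (\<forall>x\<in>P. f x = ereal (max_affine T x))}"
  by (simp add: C_PL_def max_affine_def)

lemma C_PL_rat_eq: "C_PL_rat P = {f. \<exists>T. finite T \<and> T \<noteq> {} \<and> T \<subseteq> rational_affine \<and> (\<forall>x\<in>P. f x = ereal (max_affine T x))}"
proof -
  have "(\<forall>(a, b)\<in>T. (\<forall>i. a $ i \<in> \<rat>) \<and> b \<in> \<rat>) \<longleftrightarrow> T \<subseteq> rational_affine" for T :: "((real ^ 'n) \<times> real) set"
    by (auto simp: rational_affine_def)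
  then show ?thesis by (simp add: C_PL_rat_def max_affine_def)
qed

lemma C_PL_rat_subset: "C_PL_rat P \<subseteq> C_PL P"
  unfolding C_PL_rat_eq C_PL_eq by blast

lemma C_PL_subset: "C_PL P \<subseteq> C_star r lam d"
proof
  fix f assume "f \<in> C_PL P"
  then obtain T where T: "finite T" "T \<noteq> {}" "\<And>x. x \<in> P \<Longrightarrow> f x = ereal (max_affine T x)" unfolding C_PL_eq by blast
  have c: "continuous_on P (max_affine T)" by (rule continuous_on_max_affine[OF T(1,2)])
  have "convex_on P (max_affine T)"
    by (rule convex_on_subset[OF convex_on_max_affine[OF T(1,2)] subset_UNIV convex_P])
  then have CVX: "f \<in> CVX P" using c T(3) x0_P by (intro CVX_real) auto
  have "continuous_on (poly_star r lam d) (\<lambda>x. ereal (max_affine T x))"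
    by (intro continuous_on_ereal continuous_on_max_affine T)
  then have "continuous_on (poly_star r lam d) f"
    using T(3) poly_star_subset by (subst continuous_on_cong[OF refl]) auto
  moreover have "(\<integral>\<^sup>+x. e2ennreal \<bar>f x\<bar> \<partial>\<sigma>) < \<infinity>"
  proof -
    have "(\<integral>\<^sup>+x. e2ennreal \<bar>f x\<bar> \<partial>\<sigma>) = (\<integral>\<^sup>+x. ennreal (norm (max_affine T x)) \<partial>\<sigma>)"
      using T(3) frontier_subset by (intro nn_integral_cong) auto
    also have "\<dots> < \<infinity>" using integrable_bdry_continuous[OF c] by (simp add: integrable_iff_bounded)
    finally show ?thesis .
  qed
  ultimately show "f \<in> C_star r lam d"
    using CVX T(3) poly_star_subset CVX_D(6)[OF CVX] by (auto simp: C_star_def ereal_integrable_def)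
qed

text \<open>Integrability over P follows from integrability over the boundary by the trace
  inequality. That inequality wants minimum 0 at \<open>x0\<close>, so the function is normalized
  first and the affine function is restored at the end.\<close>

lemma C_star_subset: "C_star r lam d \<subseteq> E1 P"
proof
  fix f assume f: "f \<in> C_star r lam d"
  then have CVX: "f \<in> CVX P" and fin: "\<And>x. x \<in> interior P \<Longrightarrow> f x \<noteq> \<infinity>"
    and int: "(\<integral>\<^sup>+x. e2ennreal \<bar>f x\<bar> \<partial>\<sigma>) < \<infinity>"
    using interior_poly_star by (auto simp: C_star_def ereal_integrable_def)
  have [measurable]: "f \<in> borel_measurable \<sigma>" using CVX by (rule CVX_D)
  obtain \<xi> where \<xi>: "\<xi> \<in> affine_funs" "\<And>x. x \<in> P \<Longrightarrow> 0 \<le> f x + ereal (\<xi> x)" "f x0 + ereal (\<xi> x0) = 0"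
    using normalize_at_x0[OF CVX fin] by metis
  obtain k where k: "k > 0" "\<And>x. x \<in> P \<Longrightarrow> \<bar>\<xi> x\<bar> \<le> k" using bounded_affine[OF \<xi>(1)] by metis
  define h where "h x = f x + ereal (\<xi> x)" for x
  have h: "h \<in> CVX P" unfolding h_def by (rule CVX_add_affine[OF CVX \<xi>(1)])
  have "(\<integral>\<^sup>+x. e2ennreal (h x) \<partial>\<sigma>) \<le> (\<integral>\<^sup>+x. e2ennreal \<bar>f x\<bar> + ennreal k \<partial>\<sigma>)"
  proof (rule nn_integral_mono)
    fix x assume "x \<in> space \<sigma>"
    then have x: "\<bar>\<xi> x\<bar> \<le> k" using k(2) frontier_subset by auto
    show "e2ennreal (h x) \<le> e2ennreal \<bar>f x\<bar> + ennreal k"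
    proof (cases "f x")
      case (real z)
      have "ennreal (z + \<xi> x) \<le> ennreal (\<bar>z\<bar> + k)" using x by (intro ennreal_leI) auto
      then show ?thesis using real k by (simp add: ennreal_plus h_def)
    qed auto
  qed
  also have "\<dots> = (\<integral>\<^sup>+x. e2ennreal \<bar>f x\<bar> \<partial>\<sigma>) + ennreal k * emeasure \<sigma> (space \<sigma>)"
    by (subst nn_integral_add) auto
  also have "\<dots> < \<infinity>"
    using int by (auto simp: ennreal_mult_less_top bdry.emeasure_eq_measure)
  finally have "(\<integral>\<^sup>+x. e2ennreal (h x) \<partial>\<sigma>) < \<infinity>" .
  then have "ennreal trace_const * (\<integral>\<^sup>+x. e2ennreal (h x) \<partial>\<sigma>) < \<infinity>"
    by (simp add: ennreal_mult_less_top)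
  then have "(\<integral>\<^sup>+x. e2ennreal (h x) \<partial>leb_on P) < \<infinity>"
    using trace_CVX[OF h] \<xi> by (auto simp: h_def intro: le_less_trans)
  then have "h \<in> E1 P" by (rule E1_I[OF h])
  then have "(\<lambda>x. h x + ereal (- \<xi> x)) \<in> E1 P" by (rule E1_add_affine[OF _ affine_funs_uminus[OF \<xi>(1)]])
  moreover have "h x + ereal (- \<xi> x) = f x" for x by (cases "f x") (auto simp: h_def)
  ultimately show "f \<in> E1 P" by simp
qed

lemma C_infty_subset: "C_infty P \<subseteq> E1 P"
  by (auto simp: C_infty_def intro: E1_continuous)

text \<open>Two modes of convergence are combined: monotone convergence on the boundary, where the
  integral of f may be infinite, and dominated convergence on P, where f itself is an integrable
  majorant up to the bound C for W. If the boundary integral is infinite, so is L f.\<close>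

lemma cond_b_C_PL_rat_imp_E1:
  assumes b: "cond_b r lam d V x0 (C_PL_rat P)"
  shows "cond_b r lam d V x0 (E1 P)"
proof -
  obtain \<delta> where \<delta>: "\<delta> > 0" "\<And>f. f \<in> normalized P x0 (C_PL_rat P) \<Longrightarrow> ereal \<delta> * ereal_integral \<sigma> f \<le> L f"
    using b by (auto simp: cond_b_def)
  obtain C where C: "C > 0" "\<And>x. x \<in> P \<Longrightarrow> \<bar>W x\<bar> \<le> C" using W_bound by metis
  show ?thesis
    unfolding cond_b_def
  proof (intro exI[of _ \<delta>] conjI ballI \<delta>(1))
    fix f assume f: "f \<in> normalized P x0 (E1 P)"
    then have fE: "f \<in> E1 P" and nn: "\<And>x. x \<in> P \<Longrightarrow> 0 \<le> f x" and f0: "f x0 = 0" using normalizedD by blast+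
    have [measurable]: "f \<in> borel_measurable (leb_on P)" using E1_CVX[OF fE] by (rule CVX_D)
    obtain T where T: "\<And>k::nat. finite (T k)" "\<And>k. (0, 0) \<in> T k" "\<And>k. T k \<subseteq> rational_affine" "incseq T"
      and le: "\<And>k x. x \<in> P \<Longrightarrow> ereal (max_affine (T k) x) \<le> f x"
      and sup: "\<And>x. x \<in> P \<Longrightarrow> (SUP k. ereal (max_affine (T k) x)) = f x"
      using lsc_convex_rational_PL_approx[OF compact_P convex_P CVX_D(2,3)[OF E1_CVX[OF fE]] nn] by metis
    define g where "g k = max_affine (T k)" for k
    have ne: "T k \<noteq> {}" for k using T(2) by auto
    have cg: "continuous_on A (g k)" for A k unfolding g_def by (rule continuous_on_max_affine[OF T(1) ne])
    have g0: "0 \<le> g k x" for k x using max_affine_ge[OF T(1) T(2), of x] by (simp add: g_def)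
    have inc: "mono (\<lambda>k. g k x)" for x
      unfolding g_def using T(4) by (intro monoI max_affine_mono T(1) ne) (auto simp: incseq_def)
    have norm: "(\<lambda>x. ereal (g k x)) \<in> normalized P x0 (C_PL_rat P)" for k
    proof (rule normalizedI)
      show "(\<lambda>x. ereal (g k x)) \<in> C_PL_rat P" 
        unfolding C_PL_rat_eq using T ne by (intro CollectI exI[of _ "T k"]) (auto simp: g_def)
      show "ereal (g k x0) = 0" using le[OF x0_P, of k] f0 g0[of k x0] by (simp add: g_def zero_ereal_def)
    qed (use g0 in auto)
    define \<beta> where "\<beta> k = (\<integral>x. g k x \<partial>\<sigma>)" for k
    define A where "A k = (\<integral>x. W x * g k x \<partial>leb_on P)" for k
    have ineq: "\<delta> * \<beta> k \<le> \<beta> k - A k" for k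
      using \<delta>(2)[OF norm[of k]] L_real[of "g k" "\<lambda>x. ereal (g k x)", OF cg]
      by (simp add: Lam_def \<beta>_def A_def)
    have lim: "(\<lambda>k. g k x) \<longlonglongrightarrow> real_of_ereal (f x)" if "x \<in> P" "f x = ereal (real_of_ereal (f x))" for x
    proof -
      have "incseq (\<lambda>k. ereal (g k x))" using inc[of x] by (auto simp: incseq_def mono_def)
      from LIMSEQ_SUP[OF this] have "(\<lambda>k. ereal (g k x)) \<longlonglongrightarrow> ereal (real_of_ereal (f x))"
        using sup[OF that(1)] that(2) by (simp add: g_def)
      then show ?thesis by simp
    qed
    have [measurable]: "g k \<in> borel_measurable (leb_on P)" for k using integrable_leb_continuous[OF cg] by simp
    have A: "A \<longlonglongrightarrow> (\<integral>x. W x * real_of_ereal (f x) \<partial>leb_on P)"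
      unfolding A_def
    proof (rule integral_dominated_convergence[where w="\<lambda>x. C * real_of_ereal (f x)"])
      show "integrable (leb_on P) (\<lambda>x. C * real_of_ereal (f x))" using E1_integrable[OF fE] by simp
      show "AE x in leb_on P. (\<lambda>k. W x * g k x) \<longlonglongrightarrow> W x * real_of_ereal (f x)"
        using E1_AE[OF fE] AE_space[of "leb_on P"]
        by eventually_elim (auto intro!: tendsto_mult_left lim)
      fix k
      show "AE x in leb_on P. norm (W x * g k x) \<le> C * real_of_ereal (f x)"
        using E1_AE[OF fE] AE_space[of "leb_on P"]
      proof eventually_elim
        case (elim x)
        then have "g k x \<le> real_of_ereal (f x)" using le[of x k] by (cases "f x") (auto simp: g_def)
        then show ?case using C elim g0 by (auto simp: abs_mult intro!: mult_mono)
      qed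
    qed measurable
    have nn\<beta>: "(\<integral>\<^sup>+x. ennreal (g k x) \<partial>\<sigma>) = ennreal (\<beta> k)" for k
      unfolding \<beta>_def using g0 by (intro nn_integral_eq_integral integrable_bdry_continuous cg) auto
    have "(\<integral>\<^sup>+x. e2ennreal (f x) \<partial>\<sigma>) = (\<integral>\<^sup>+x. (SUP k. ennreal (g k x)) \<partial>\<sigma>)"
    proof (rule nn_integral_cong)
      fix x assume "x \<in> space \<sigma>"
      then have x: "x \<in> P" using frontier_subset by auto
      have "mono (\<lambda>k. ereal (g k x))" using inc[of x] by (auto simp: mono_def)
      moreover have "sup_continuous (\<lambda>x::ereal. x)" by (simp add: sup_continuous_def)
      ultimately have "e2ennreal (SUP k. ereal (g k x)) = (SUP k. e2ennreal (ereal (g k x)))"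
        using sup_continuousD[OF sup_continuous_e2ennreal] by blast
      then show "e2ennreal (f x) = (SUP k. ennreal (g k x))"
        using sup[OF x] by (simp add: g_def)
    qed
    also have "\<dots> = (SUP k. \<integral>\<^sup>+x. ennreal (g k x) \<partial>\<sigma>)"
      using inc integrable_bdry_continuous[OF cg]
      by (intro nn_integral_monotone_convergence_SUP)
         (auto simp: incseq_def le_fun_def mono_def intro!: ennreal_leI)
    also have "\<dots> = (SUP k. ennreal (\<beta> k))" by (simp add: nn\<beta>)
    finally have SUP: "(\<integral>\<^sup>+x. e2ennreal (f x) \<partial>\<sigma>) = (SUP k. ennreal (\<beta> k))" .
    have \<beta>0: "0 \<le> \<beta> k" for k unfolding \<beta>_def using g0 by simp
    have inc\<beta>: "incseq \<beta>"
      unfolding \<beta>_def incseq_def using inc by (auto intro!: integral_mono integrable_bdry_continuous cg simp: mono_def)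
    show "ereal \<delta> * ereal_integral \<sigma> f \<le> L f"
    proof (cases "\<integral>\<^sup>+x. e2ennreal (f x) \<partial>\<sigma>")
      case top
      then have "ereal_integral \<sigma> f = \<infinity>" using bdry_nonneg[of f] nn by simp
      then show ?thesis by (simp add: L_eq)
    next
      case (real z)
      have "(\<lambda>k. ennreal (\<beta> k)) \<longlonglongrightarrow> ennreal z"
        using LIMSEQ_SUP[of "\<lambda>k. ennreal (\<beta> k)"] inc\<beta> SUP real by (auto simp: incseq_def intro!: ennreal_leI)
      then have "\<beta> \<longlonglongrightarrow> z"
        by (subst (asm) tendsto_ennreal_iff) (use \<beta>0 real in auto)
      then have "\<delta> * z \<le> z - (\<integral>x. W x * real_of_ereal (f x) \<partial>leb_on P)"
        using ineq by (intro LIMSEQ_le[OF tendsto_mult_left tendsto_diff[OF _ A]]) auto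
      moreover have "ereal_integral \<sigma> f = ereal z" using bdry_nonneg[of f] nn real by simp
      ultimately show ?thesis by (simp add: L_eq)
    qed
  qed
qed

text \<open>In the interior the mean value inequality gives the value 0. At the boundary lower
  semicontinuity takes over: a positive value would persist on a relatively open set, and such a set
  meets the interior.\<close>

lemma E1_nonneg_null_imp_zero:
  assumes f: "f \<in> CVX P" and nn: "\<And>x. x \<in> P \<Longrightarrow> 0 \<le> f x" and null: "(\<integral>\<^sup>+x. e2ennreal (f x) \<partial>leb_on P) = 0"
    and x: "x \<in> P"
  shows "f x = 0"
proof -
  have int: "f c = 0" if c: "c \<in> interior P" for c
  proof -
    obtain \<rho> where \<rho>: "\<rho> > 0" "ball c \<rho> \<subseteq> P" using c mem_interior by metis
    have cP: "c \<in> P" using c interior_subset by auto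
    have "emeasure lborel (ball c \<rho>) * e2ennreal (f c) \<le> 0"
      using mean_value_convex[OF f nn \<rho>(2,1)] null by simp
    moreover have "emeasure lborel (ball c \<rho>) \<noteq> 0"
      using content_ball_pos[OF \<rho>(1), of c] by (auto simp: measure_def)
    ultimately have "e2ennreal (f c) = 0" by simp
    then show ?thesis using nn[OF cP] by (cases "f c") (auto simp: zero_ereal_def)
  qed
  show ?thesis
  proof (rule ccontr)
    assume "f x \<noteq> 0"
    then have "x \<in> {x \<in> P. 0 < f x}" using nn[OF x] x by auto
    moreover obtain T where T: "open T" "{x \<in> P. 0 < f x} = P \<inter> T"
      using openin_lsc_greater[OF CVX_D(2)[OF f], of 0] unfolding openin_open by blast
    ultimately have "x \<in> T" by blast
    have "x \<in> closure (interior P)"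
      using convex_closure_interior[OF convex_P] x0_interior x closed_P by auto
    then obtain c where "c \<in> interior P" "c \<in> T"
      using T(1) \<open>x \<in> T\<close> by (metis closure_iff_nhds_not_empty disjoint_iff order_refl)
    then have "c \<in> {x \<in> P. 0 < f x}" using T(2) interior_subset by blast
    then show False using int \<open>c \<in> interior P\<close> by simp
  qed
qed

text \<open>If L f = 0, then (b) forces the boundary integral of the normalization h to vanish. By
  the trace inequality the integral over P vanishes too, so h is zero and f is minus the affine
  function that was added.\<close>

lemma cond_b_E1_imp_cond_K:
  assumes b: "cond_b r lam d V x0 (E1 P)"
  shows "cond_K r lam d V (E1 P)"
proof -
  obtain \<delta> where \<delta>: "\<delta> > 0" "\<And>f. f \<in> normalized P x0 (E1 P) \<Longrightarrow> ereal \<delta> * ereal_integral \<sigma> f \<le> L f"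
    using b by (auto simp: cond_b_def)
  show ?thesis
    unfolding cond_K_def
  proof (intro ballI)
    fix f assume f: "f \<in> E1 P"
    obtain \<xi> where \<xi>: "\<xi> \<in> affine_funs" "\<And>x. x \<in> P \<Longrightarrow> 0 \<le> f x + ereal (\<xi> x)" "f x0 + ereal (\<xi> x0) = 0"
      using normalize_at_x0[OF E1_CVX[OF f] E1_finite_interior[OF f]] by metis
    define h where "h x = f x + ereal (\<xi> x)" for x
    have hE: "h \<in> E1 P" unfolding h_def by (rule E1_add_affine[OF f \<xi>(1)])
    have hn: "\<And>x. x \<in> P \<Longrightarrow> 0 \<le> h x" and h0: "h x0 = 0" using \<xi> by (auto simp: h_def)
    have L: "L h = L f" unfolding h_def by (rule L_add_affine[OF f \<xi>(1)])
    have le: "ereal \<delta> * ereal_integral \<sigma> h \<le> L f"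
      unfolding L[symmetric] using hE hn h0 by (intro \<delta> normalizedI)
    have "0 \<le> ereal \<delta> * ereal_integral \<sigma> h"
      using \<delta> by (simp add: bdry_nonneg[OF hn] ereal_0_le_mult)
    with le have nonneg: "0 \<le> L f" by (rule order_trans[rotated])
    have "affine_on P f" if "L f = 0"
    proof -
      have "ereal \<delta> * ereal_integral \<sigma> h = 0" using le that \<open>0 \<le> ereal \<delta> * ereal_integral \<sigma> h\<close> by simp
      then have "ereal_integral \<sigma> h = 0" using \<delta>(1) by (cases "ereal_integral \<sigma> h") auto
      then have "(\<integral>\<^sup>+x. e2ennreal (h x) \<partial>\<sigma>) = 0" 
        using bdry_nonneg[OF hn] by (cases "\<integral>\<^sup>+x. e2ennreal (h x) \<partial>\<sigma>") auto
      then have null: "(\<integral>\<^sup>+x. e2ennreal (h x) \<partial>leb_on P) = 0"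
        using trace_CVX[OF E1_CVX[OF hE] hn h0] by simp
      have "f x = ereal (- \<xi> x)" if x: "x \<in> P" for x
      proof -
        have "h x = 0" using E1_nonneg_null_imp_zero[OF E1_CVX[OF hE] hn null x] .
        then show ?thesis by (cases "f x") (auto simp: h_def)
      qed
      then show ?thesis using affine_funs_uminus[OF \<xi>(1)] by (auto simp: affine_on_def)
    qed
    with nonneg L_affine show "0 \<le> L f \<and> (L f = 0 \<longleftrightarrow> affine_on P f)" by blast
  qed
qed

lemma cond_K_mono: "\<F> \<subseteq> \<G> \<Longrightarrow> cond_K r lam d V \<G> \<Longrightarrow> cond_K r lam d V \<F>"
  by (auto simp: cond_K_def)

end

section \<open>Continuity at the facets\<close>

context extremal_polytope
begin

text \<open>Both sides are affine of dimension n - 1. Consequently a relatively interior point of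
  the facet has a neighbourhood in the whole hyperplane that lies in the facet.\<close>

lemma affine_hull_facet:
  assumes j: "j \<in> {1..r}" shows "affine hull (F j) = {x. el j x = 0}"
proof -
  have H: "{x. el j x = 0} = {x. nrm j \<bullet> x = - real_of_int (d j)}" by (auto simp: ell_def)
  have "affine {x. el j x = 0}" unfolding H by (rule affine_hyperplane)
  have sub: "affine hull (F j) \<subseteq> {x. el j x = 0}"
    using \<open>affine {x. el j x = 0}\<close> by (intro hull_minimal) (auto simp: facet_def)
  have "aff_dim (F j) = aff_dim P - 1" using facet_of_P[OF j] by (simp add: facet_of_def)
  also have "\<dots> = int CARD('n) - 1" by (simp add: aff_dim_P)
  also have "\<dots> = aff_dim {x. el j x = 0}" unfolding H using nrm_nonzero[OF j] by (simp add: aff_dim_hyperplane)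
  finally have "aff_dim (affine hull (F j)) = aff_dim {x. el j x = 0}" by simp
  moreover have "affine hull (F j) \<noteq> {}"
    using facet_of_P[OF j] by (auto simp: facet_of_def)
  ultimately show ?thesis
    using sub \<open>affine {x. el j x = 0}\<close> by (intro aff_dim_eq_full_gen[THEN iffD1] affine_dim_equal) (auto simp: aff_dim_affine_hull)
qed

lemma rel_interior_facet:
  assumes j: "j \<in> {1..r}" and y: "y \<in> rel_interior (F j)"
  obtains \<rho> where "\<rho> > 0" "\<And>x. dist y x < \<rho> \<Longrightarrow> el j x = 0 \<Longrightarrow> x \<in> rel_interior (F j)"
proof -
  obtain e where e: "e > 0" "ball y e \<inter> affine hull (F j) \<subseteq> F j"
    using y unfolding mem_rel_interior_ball by auto
  show ?thesis
  proof (rule that[of "e / 2"])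
    fix x assume x: "dist y x < e / 2" "el j x = 0"
    have "ball x (e / 2) \<inter> affine hull (F j) \<subseteq> F j"
    proof
      fix z assume z: "z \<in> ball x (e / 2) \<inter> affine hull (F j)"
      then have "dist y z < e" using x dist_triangle[of y z x] by simp
      then show "z \<in> F j" using e z by auto
    qed
    moreover have "x \<in> F j" using e x affine_hull_facet[OF j] by auto
    ultimately show "x \<in> rel_interior (F j)" unfolding mem_rel_interior_ball using e by (auto intro!: exI[of _ "e/2"])
  qed (use e in simp)
qed

text \<open>By Pythagoras the slices of the ball parallel to the hyperplane project into the central
  slice. If the latter were null, Fubini would make the ball itself null.\<close>

lemma emeasure_facet_ball_pos:
  assumes j: "j \<in> {1..r}" and y: "el j y = 0" and \<rho>: "\<rho> > 0"
  shows "emeasure (\<mu> j) (ball y \<rho>) \<noteq> 0"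
proof
  assume null: "emeasure (\<mu> j) (ball y \<rho>) = 0"
  let ?\<nu> = "nrm j /\<^sub>R norm (nrm j)"
  have "emeasure lborel (ball y \<rho>) = (\<integral>\<^sup>+x. indicator (ball y \<rho>) x \<partial>lborel)" by simp
  also have "\<dots> = (\<integral>\<^sup>+\<tau>. (\<integral>\<^sup>+x. indicator (ball y \<rho>) (x + \<tau> *\<^sub>R ?\<nu>) \<partial>\<mu> j) \<partial>lborel)"
    unfolding facet_lborel_def by (rule nn_integral_lborel_hyperplane[OF nrm_nonzero[OF j]])
      (intro borel_measurable_indicator, simp)
  also have "\<dots> \<le> (\<integral>\<^sup>+(\<tau>::real). (\<integral>\<^sup>+x. indicator (ball y \<rho>) x \<partial>\<mu> j) \<partial>lborel)"
  proof (rule nn_integral_mono, rule nn_integral_mono_AE)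
    fix \<tau> :: real
    show "AE x in \<mu> j. (indicator (ball y \<rho>) (x + \<tau> *\<^sub>R ?\<nu>) :: ennreal) \<le> indicator (ball y \<rho>) x"
      using AE_facet_lborel[OF j]
    proof eventually_elim
      case (elim x)
      have "nrm j \<bullet> (x - y) = 0" using elim y by (simp add: ell_def inner_diff_right)
      then have "orthogonal (x - y) (\<tau> *\<^sub>R ?\<nu>)" by (simp add: orthogonal_def inner_commute)
      then have "(norm (x - y + \<tau> *\<^sub>R ?\<nu>))\<^sup>2 = (norm (x - y))\<^sup>2 + (norm (\<tau> *\<^sub>R ?\<nu>))\<^sup>2"
        by (rule norm_add_Pythagorean)
      then have "(norm (x - y))\<^sup>2 \<le> (norm (x - y + \<tau> *\<^sub>R ?\<nu>))\<^sup>2" by simp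
      then have "norm (x - y) \<le> norm (x - y + \<tau> *\<^sub>R ?\<nu>)" by (rule power2_le_imp_le) simp
      then have "dist y x \<le> dist y (x + \<tau> *\<^sub>R ?\<nu>)" by (simp add: dist_norm norm_minus_commute add_diff_eq diff_add_eq)
      then show ?case by (auto simp: indicator_def)
    qed
  qed
  also have "\<dots> = 0" using null by simp
  finally show False using content_ball_pos[OF \<rho>, of y] by (simp add: measure_def)
qed

text \<open>The mean value inequality within the facet: reflection in y preserves the facet measure,
  and a small ball about y in the hyperplane stays in the facet. An infinite value at y would
  contradict integrability over the boundary.\<close>

lemma finite_rel_interior_facet:
  assumes f: "f \<in> CVX P" and nn: "\<And>x. x \<in> P \<Longrightarrow> 0 \<le> f x" and int: "(\<integral>\<^sup>+x. e2ennreal (f x) \<partial>\<sigma>) < \<infinity>"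
    and j: "j \<in> {1..r}" and y: "y \<in> rel_interior (F j)"
  shows "f y \<noteq> \<infinity>"
proof
  assume inf: "f y = \<infinity>"
  obtain \<rho> where \<rho>: "\<rho> > 0" "\<And>x. dist y x < \<rho> \<Longrightarrow> el j x = 0 \<Longrightarrow> x \<in> rel_interior (F j)"
    using rel_interior_facet[OF j y] by metis
  have inF: "x \<in> F j" "x \<in> P" if "dist y x < \<rho>" "el j x = 0" for x
    using \<rho>(2)[OF that] rel_interior_subset facet_subset by blast+
  have yF: "y \<in> F j" "y \<in> P" using y rel_interior_subset facet_subset by blast+
  then have y0: "el j y = 0" by (simp add: facet_def)
  define \<phi> where "\<phi> x = (if x \<in> P then e2ennreal (f x) else 0)" for x
  have [measurable]: "\<phi> \<in> borel_measurable borel"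
    unfolding \<phi>_def by (rule borel_measurable_zero_extension[OF CVX_D(4)[OF f]])
  have "emeasure (\<mu> j) (ball y \<rho>) * \<phi> y \<le> (\<integral>\<^sup>+x. \<phi> x * indicator (ball y \<rho>) x \<partial>\<mu> j)"
  proof (rule emeasure_ball_mult_le_nn_integral)
    show "(\<integral>\<^sup>+x. g x \<partial>\<mu> j) = (\<integral>\<^sup>+x. g (2 *\<^sub>R y - x) \<partial>\<mu> j)" if "g \<in> borel_measurable borel" for g
      unfolding facet_lborel_def
      using y0 base_point[OF j] by (intro nn_integral_hyperplane_lborel_reflect that nrm_nonzero j) (simp add: ell_def)
    show "AE x in \<mu> j. x \<in> ball y \<rho> \<longrightarrow> 2 * \<phi> y \<le> \<phi> x + \<phi> (2 *\<^sub>R y - x)"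
      using AE_facet_lborel[OF j]
    proof (eventually_elim, intro impI)
      fix x assume x0: "el j x = 0" and x: "x \<in> ball y \<rho>"
      have "y - (2 *\<^sub>R y - x) = x - y" by (simp add: algebra_simps scaleR_2)
      then have "dist y (2 *\<^sub>R y - x) = dist y x" unfolding dist_norm by (simp only: norm_minus_commute)
      moreover have "el j (2 *\<^sub>R y - x) = 0" using x0 y0 by (simp add: ell_def inner_diff_right)
      ultimately have "2 *\<^sub>R y - x \<in> P" "x \<in> P" using x x0 inF by auto
      then show "2 * \<phi> y \<le> \<phi> x + \<phi> (2 *\<^sub>R y - x)"
        using ereal_convex_on_midpoint[OF CVX_D(3)[OF f] nn, of x y] yF by (simp add: \<phi>_def)
    qed
  qed auto
  also have "\<dots> \<le> (\<integral>\<^sup>+x. \<phi> x * indicator (F j) x \<partial>\<mu> j)"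
    using AE_facet_lborel[OF j]
    by (intro nn_integral_mono_AE, eventually_elim) (use inF in \<open>auto simp: indicator_def\<close>)
  also have "\<dots> < \<infinity>"
  proof -
    have "ennreal (1 / norm (nrm j)) * (\<integral>\<^sup>+x. \<phi> x * indicator (F j) x \<partial>\<mu> j) \<le> (\<integral>\<^sup>+x. \<phi> x \<partial>\<sigma>)"
      using j by (intro nn_integral_facet_le_bdry) auto
    also have "(\<integral>\<^sup>+x. \<phi> x \<partial>\<sigma>) = (\<integral>\<^sup>+x. e2ennreal (f x) \<partial>\<sigma>)"
      using frontier_subset by (intro nn_integral_cong) (auto simp: \<phi>_def)
    also have "\<dots> < \<infinity>" by (rule int)
    finally show ?thesis using nrm_nonzero[OF j] by (auto simp: ennreal_mult_less_top)
  qed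
  finally have "emeasure (\<mu> j) (ball y \<rho>) * top < \<infinity>" using inf yF by (simp add: \<phi>_def)
  then show False using emeasure_facet_ball_pos[OF j y0 \<rho>(1)] by (simp add: ennreal_mult_top)
qed

lemma CVX_real_convex_on:
  assumes f: "f \<in> CVX P" and S: "S \<subseteq> P" "convex S" and fin: "\<And>x. x \<in> S \<Longrightarrow> f x \<noteq> \<infinity>"
  shows "convex_on S (\<lambda>x. real_of_ereal (f x))"
proof (rule convex_onI)
  have eq: "f x = ereal (real_of_ereal (f x))" if "x \<in> S" for x
    using CVX_D(1)[OF f, of x] fin[OF that] that S by (cases "f x") auto
  fix t :: real and x y assume t: "0 < t" "t < 1" and xy: "x \<in> S" "y \<in> S"
  have z: "(1 - t) *\<^sub>R x + t *\<^sub>R y \<in> S" using S(2) xy t by (simp add: convex_alt)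
  have "f ((1 - t) *\<^sub>R x + t *\<^sub>R y) \<le> ereal ((1 - t) * real_of_ereal (f x) + t * real_of_ereal (f y))"
    using xy S t eq by (intro ereal_convex_on_le[OF CVX_D(3)[OF f]]) auto
  then show "real_of_ereal (f ((1 - t) *\<^sub>R x + t *\<^sub>R y)) \<le> (1 - t) * real_of_ereal (f x) + t * real_of_ereal (f y)"
    using eq[OF z] by (metis ereal_less_eq(3))
qed (rule S)

lemma CVX_usc_interior:
  assumes f: "f \<in> CVX P" and fin: "\<And>x. x \<in> interior P \<Longrightarrow> f x \<noteq> \<infinity>" and x: "x \<in> interior P" and a: "f x < a"
  shows "eventually (\<lambda>z. f z < a) (at x)"
proof -
  define g where "g x = real_of_ereal (f x)" for x
  have eq: "f z = ereal (g z)" if "z \<in> interior P" for z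
    using CVX_D(1)[OF f, of z] fin[OF that] that interior_subset[of P] unfolding g_def by (cases "f z") auto
  have "continuous_on (interior P) g"
    unfolding g_def
    using f fin by (intro convex_on_continuous CVX_real_convex_on) (auto simp: interior_subset convex_P convex_interior)
  then have "(g \<longlongrightarrow> g x) (at x)"
    using x by (simp add: continuous_on_eq_continuous_at isCont_def)
  then have "((\<lambda>z. ereal (g z)) \<longlongrightarrow> ereal (g x)) (at x)" by simp
  moreover have "ereal (g x) < a" using a eq[OF x] by simp
  ultimately have "eventually (\<lambda>z. ereal (g z) < a) (at x)" by (rule order_tendstoD(2))
  moreover have "eventually (\<lambda>z. z \<in> interior P) (at x)"
    using x by (intro eventually_at_in_open') auto
  ultimately show ?thesis by eventually_elim (simp add: eq)
qed

text \<open>Near a relatively interior point of a facet, project from \<open>x0\<close> onto the facet: the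
  convex combination of the value at the projection and the value at \<open>x0\<close> is a continuous
  upper bound.\<close>

lemma CVX_usc_facet:
  assumes f: "f \<in> CVX P" and nn: "\<And>x. x \<in> P \<Longrightarrow> 0 \<le> f x" and int: "(\<integral>\<^sup>+x. e2ennreal (f x) \<partial>\<sigma>) < \<infinity>"
    and fin: "f x0 \<noteq> \<infinity>" and j: "j \<in> {1..r}" and y: "y \<in> rel_interior (F j)" and a: "f y < a"
  shows "eventually (\<lambda>z. f z < a) (at y within P)"
proof -
  obtain \<rho> where \<rho>: "\<rho> > 0" "\<And>x. dist y x < \<rho> \<Longrightarrow> el j x = 0 \<Longrightarrow> x \<in> rel_interior (F j)"
    using rel_interior_facet[OF j y] by metis
  have yF: "y \<in> F j" "y \<in> P" using y rel_interior_subset facet_subset by blast+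
  then have y0: "el j y = 0" by (simp add: facet_def)
  define h where "h x = real_of_ereal (f x)" for x
  have sub: "rel_interior (F j) \<subseteq> P" using rel_interior_subset facet_subset by blast
  have eq: "f z = ereal (h z)" if "z \<in> rel_interior (F j)" for z
    using finite_rel_interior_facet[OF f nn int j that] CVX_D(1)[OF f, of z] that sub
    unfolding h_def by (cases "f z") auto
  have eq0: "f x0 = ereal (h x0)"
    using fin CVX_D(1)[OF f x0_P] unfolding h_def by (cases "f x0") auto
  have cF: "convex (rel_interior (F j))"
    using facet_of_P[OF j] by (intro convex_rel_interior face_of_imp_convex) (auto simp: facet_of_def)
  have hc: "convex_on (rel_interior (F j)) h"
    unfolding h_def using finite_rel_interior_facet[OF f nn int j]
    by (intro CVX_real_convex_on f sub cF)
  define v where "v = nrm j"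
  have v: "v \<bullet> v > 0" using nrm_nonzero[OF j] by (simp add: v_def)
  \<comment> \<open>Orthogonal projection onto the facet hyperplane. Composed with it, h becomes
    convex on a ball that is open in the whole space, so its continuity follows from the theorem on
    convex functions on open sets.\<close>
  define \<pi> where "\<pi> z = z - (el j z / (v \<bullet> v)) *\<^sub>R v" for z
  have el\<pi>: "el j (\<pi> z) = 0" for z
    using v by (simp add: \<pi>_def ell_def v_def[symmetric] inner_diff_right)
  have d\<pi>: "dist y (\<pi> z) \<le> dist y z" for z
  proof -
    have "v \<bullet> (\<pi> z - y) = 0" using el\<pi>[of z] y0 by (simp add: ell_def v_def inner_diff_right)
    then have "orthogonal (\<pi> z - y) ((el j z / (v \<bullet> v)) *\<^sub>R v)" by (simp add: orthogonal_def inner_commute)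
    then have "(norm ((\<pi> z - y) + (el j z / (v \<bullet> v)) *\<^sub>R v))\<^sup>2 = (norm (\<pi> z - y))\<^sup>2 + (norm ((el j z / (v \<bullet> v)) *\<^sub>R v))\<^sup>2"
      by (rule norm_add_Pythagorean)
    moreover have "(\<pi> z - y) + (el j z / (v \<bullet> v)) *\<^sub>R v = z - y" by (simp add: \<pi>_def)
    ultimately have "(norm (\<pi> z - y))\<^sup>2 \<le> (norm (z - y))\<^sup>2" by simp
    then have "norm (\<pi> z - y) \<le> norm (z - y)" by (rule power2_le_imp_le) simp
    then show ?thesis by (simp add: dist_norm norm_minus_commute)
  qed
  have \<pi>F: "\<pi> z \<in> rel_interior (F j)" if "z \<in> ball y \<rho>" for z
    using \<rho>(2)[OF _ el\<pi>] d\<pi>[of z] that by simp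
  have \<pi>aff: "\<pi> ((1 - t) *\<^sub>R z + t *\<^sub>R w) = (1 - t) *\<^sub>R \<pi> z + t *\<^sub>R \<pi> w" for t z w
  proof -
    have e: "el j ((1 - t) *\<^sub>R z + t *\<^sub>R w) = (1 - t) * el j z + t * el j w"
      by (simp add: ell_def inner_simps algebra_simps)
    show ?thesis unfolding \<pi>_def e by (simp add: algebra_simps add_divide_distrib diff_divide_distrib)
  qed
  have "convex_on (ball y \<rho>) (\<lambda>z. h (\<pi> z))"
  proof (rule convex_onI)
    fix t :: real and z w assume t: "0 < t" "t < 1" and zw: "z \<in> ball y \<rho>" "w \<in> ball y \<rho>"
    show "h (\<pi> ((1 - t) *\<^sub>R z + t *\<^sub>R w)) \<le> (1 - t) * h (\<pi> z) + t * h (\<pi> w)"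
      unfolding \<pi>aff using t \<pi>F[OF zw(1)] \<pi>F[OF zw(2)] by (intro convex_onD[OF hc]) auto
  qed simp
  then have "continuous_on (ball y \<rho>) (\<lambda>z. h (\<pi> z))" by (intro convex_on_continuous) auto
  then have ch: "isCont (\<lambda>z. h (\<pi> z)) y"
    using \<rho>(1) by (simp add: continuous_on_eq_continuous_at)
  \<comment> \<open>Here z = (1 - t z) Y z + t z x0, where Y z is the central projection of z onto
    the hyperplane and t z vanishes on the hyperplane.\<close>
  define t where "t z = el j z / el j x0" for z
  define Y where "Y z = x0 + (1 / (1 - t z)) *\<^sub>R (z - x0)" for z
  have L: "el j x0 > 0" by (rule ell_x0[OF j])
  have ty: "t y = 0" by (simp add: t_def y0)
  have Yy: "Y y = y" by (simp add: Y_def ty)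
  have ct: "isCont t y" unfolding t_def ell_def using L by (intro continuous_intros) (simp add: ell_def)
  have cY: "isCont Y y" unfolding Y_def using ct ty by (intro continuous_intros) auto
  \<comment> \<open>The projection \<pi> does not change Y z when t z < 1; it is inserted because
    continuity at y has been shown for h composed with \<pi>.\<close>
  define G where "G z = (1 - t z) * h (\<pi> (Y z)) + t z * h x0" for z
  have "isCont (\<lambda>z. h (\<pi> (Y z))) y"
    using isCont_o2[OF cY, of "\<lambda>z. h (\<pi> z)"] ch by (simp add: Yy)
  then have "isCont G y" unfolding G_def using ct by (intro continuous_intros)
  then have "(G \<longlongrightarrow> G y) (at y)" by (simp add: isCont_def)
  moreover have "G y = h y" using y0 by (simp add: G_def ty Yy \<pi>_def)
  ultimately have "((\<lambda>z. ereal (G z)) \<longlongrightarrow> ereal (h y)) (at y)" by simp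
  moreover have "ereal (h y) < a" using a eq[OF y] by simp
  ultimately have "eventually (\<lambda>z. ereal (G z) < a) (at y)" by (rule order_tendstoD(2))
  then have 1: "eventually (\<lambda>z. ereal (G z) < a) (at y within P)" by (rule filter_leD[OF at_le, rotated]) simp
  have "(t \<longlongrightarrow> 0) (at y)" using ct ty by (simp add: isCont_def)
  then have "eventually (\<lambda>z. t z < 1) (at y)" by (rule order_tendstoD(2)) simp
  then have 2: "eventually (\<lambda>z. t z < 1) (at y within P)" by (rule filter_leD[OF at_le, rotated]) simp
  have "(Y \<longlongrightarrow> y) (at y)" using cY Yy by (simp add: isCont_def)
  then have "eventually (\<lambda>z. dist (Y z) y < \<rho>) (at y)" using \<rho>(1) by (rule tendstoD)
  then have 3: "eventually (\<lambda>z. dist (Y z) y < \<rho>) (at y within P)" by (rule filter_leD[OF at_le, rotated]) simp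
  have 4: "eventually (\<lambda>z. z \<in> P) (at y within P)" by (simp add: eventually_at_filter)
  from 1 2 3 4 show ?thesis
  proof eventually_elim
    case (elim z)
    have t0: "0 \<le> t z" using ell_nonneg[OF j elim(4)] L by (simp add: t_def)
    have "el j (Y z) = 0"
    proof -
      have "el j z = t z * el j x0" using L by (simp add: t_def)
      then have "el j (Y z) = el j x0 * (1 - 1 / (1 - t z)) + t z * el j x0 / (1 - t z)"
        unfolding Y_def ell_diff by (simp add: algebra_simps)
      also have "\<dots> = 0" using elim(2) by (simp add: field_simps)
      finally show ?thesis .
    qed
    then have YF: "Y z \<in> rel_interior (F j)" and \<pi>Y: "\<pi> (Y z) = Y z"
      using elim(3) \<rho>(2)[of "Y z"] by (auto simp: dist_commute \<pi>_def)
    have z: "z = (1 - t z) *\<^sub>R Y z + t z *\<^sub>R x0"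
      using elim(2) by (simp add: Y_def algebra_simps)
    have "f ((1 - t z) *\<^sub>R Y z + t z *\<^sub>R x0) \<le> ereal ((1 - t z) * h (Y z) + t z * h x0)"
      using CVX_D(3)[OF f] YF sub x0_P t0 elim(2) eq[OF YF] eq0 by (intro ereal_convex_on_le) auto
    then have "f z \<le> ereal (G z)" unfolding z[symmetric] by (simp add: G_def \<pi>Y)
    then show ?case using elim(1) by (rule le_less_trans)
  qed
qed

text \<open>Half of continuity is lower semicontinuity, which is given; the other half comes from
  convexity, by separate arguments in the interior and on the open facets. Thus an integrable
  boundary trace is enough to recognize elements of \<open>C_star r lam d\<close>.\<close>

lemma CVX_in_C_star:
  assumes f: "f \<in> CVX P" and nn: "\<And>x. x \<in> P \<Longrightarrow> 0 \<le> f x" and int: "(\<integral>\<^sup>+x. e2ennreal (f x) \<partial>\<sigma>) < \<infinity>"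
    and fin: "\<And>x. x \<in> interior P \<Longrightarrow> f x \<noteq> \<infinity>"
  shows "f \<in> C_star r lam d"
proof -
  have "continuous_on (poly_star r lam d) f"
    unfolding continuous_on_def
  proof
    fix x assume x: "x \<in> poly_star r lam d"
    then have xP: "x \<in> P" using poly_star_subset by blast
    show "(f \<longlongrightarrow> f x) (at x within poly_star r lam d)"
    proof (rule order_tendstoI)
      fix a assume "a < f x"
      then have "a < Liminf (at x within P) f" using CVX_D(2)[OF f] xP by (auto simp: lsc_on_def intro: less_le_trans)
      then have "eventually (\<lambda>z. a < f z) (at x within P)" by (rule less_LiminfD)
      then show "eventually (\<lambda>z. a < f z) (at x within poly_star r lam d)"
        by (rule filter_leD[OF at_le[OF poly_star_subset]])
    next
      fix a assume a: "f x < a"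
      have "eventually (\<lambda>z. f z < a) (at x within P)"
      proof (cases "x \<in> interior P")
        case True
        have "eventually (\<lambda>z. f z < a) (at x)" by (rule CVX_usc_interior[OF f fin True a])
        then show ?thesis by (rule filter_leD[OF at_le, rotated]) simp
      next
        case False
        then obtain j where j: "j \<in> {1..r}" "x \<in> rel_interior (F j)" using x by (auto simp: poly_star_def)
        show ?thesis by (rule CVX_usc_facet[OF f nn int fin[OF x0_interior] j a])
      qed
      then show "eventually (\<lambda>z. f z < a) (at x within poly_star r lam d)"
        by (rule filter_leD[OF at_le[OF poly_star_subset]])
    qed
  qed
  moreover have "f x \<noteq> \<infinity>" if "x \<in> poly_star r lam d" for x
    using that fin finite_rel_interior_facet[OF f nn int] by (auto simp: poly_star_def)
  moreover have "(\<integral>\<^sup>+x. e2ennreal \<bar>f x\<bar> \<partial>\<sigma>) < \<infinity>"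
  proof -
    have "(\<integral>\<^sup>+x. e2ennreal \<bar>f x\<bar> \<partial>\<sigma>) = (\<integral>\<^sup>+x. e2ennreal (f x) \<partial>\<sigma>)"
      using nn frontier_subset by (intro nn_integral_cong) (auto simp: subset_iff)
    then show ?thesis using int by simp
  qed
  ultimately show ?thesis using f by (simp add: C_star_def ereal_integrable_def CVX_D)
qed

end

section \<open>Compactness\<close>

text \<open>The segment from x through y is prolonged to a point z at distance \<rho> / 2 from x,
  and convexity distributes the possible increase M over this length. Points in the quarter ball are
  at most \<rho> / 2 apart, and z stays in the full ball, since \<rho> / 4 + \<rho> / 2 <
  \<rho>.\<close>

lemma real_convex_Lipschitz_ball:
  fixes h :: "'a::real_normed_vector \<Rightarrow> real"
  assumes h: "convex_on P h" and ball: "ball c \<rho> \<subseteq> P" and \<rho>: "\<rho> > 0"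
    and bd: "\<And>z. z \<in> ball c \<rho> \<Longrightarrow> 0 \<le> h z" "\<And>z. z \<in> ball c \<rho> \<Longrightarrow> h z \<le> M"
    and xy: "x \<in> ball c (\<rho> / 4)" "y \<in> ball c (\<rho> / 4)"
  shows "h y - h x \<le> 2 * M / \<rho> * dist x y"
proof (cases "x = y")
  case False
  then have n: "norm (y - x) > 0" by simp
  define u where "u = ((\<rho> / 2) / norm (y - x)) *\<^sub>R (y - x)"
  define z where "z = x + u"
  have "dist x y \<le> dist c x + dist c y" by (metis dist_commute dist_triangle)
  then have le: "norm (y - x) \<le> \<rho> / 2" using xy by (simp add: dist_norm norm_minus_commute)
  define s where "s = norm (y - x) / (\<rho> / 2)"
  have s: "0 \<le> s" "s \<le> 1" using le \<rho> by (auto simp: s_def)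
  have "dist x z = \<rho> / 2" using n \<rho> by (simp add: z_def u_def dist_norm)
  then have "dist c z < \<rho>" using xy dist_triangle[of c z x] \<rho> by simp
  then have z: "z \<in> ball c \<rho>" by simp
  have x: "x \<in> ball c \<rho>" using xy \<rho> by simp
  have "s * ((\<rho> / 2) / norm (y - x)) = 1" using n \<rho> by (simp add: s_def)
  then have su: "s *\<^sub>R u = y - x" unfolding u_def by (simp only: scaleR_scaleR scaleR_one)
  have "y = x + s *\<^sub>R u" unfolding su by simp
  also have "\<dots> = (1 - s) *\<^sub>R x + s *\<^sub>R z" by (simp add: z_def algebra_simps)
  finally have "y = (1 - s) *\<^sub>R x + s *\<^sub>R z" .
  then have "h y \<le> (1 - s) * h x + s * h z"
    using s convex_onD[OF h, of s x z] subsetD[OF ball x] subsetD[OF ball z] by auto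
  also have "\<dots> \<le> h x + s * M"
    using mult_left_mono[OF bd(2)[OF z] s(1)] mult_nonneg_nonneg[OF s(1) bd(1)[OF x]]
    by (simp add: algebra_simps)
  also have "s * M = 2 * M / \<rho> * dist x y" by (simp add: s_def dist_norm norm_minus_commute)
  finally show ?thesis by simp
qed simp

lemma convergent_of_convergent_on_dense:
  fixes h :: "nat \<Rightarrow> 'a::metric_space \<Rightarrow> real"
  assumes e0: "e0 > 0" and lip: "\<And>n y. dist x y < e0 \<Longrightarrow> \<bar>h n x - h n y\<bar> \<le> K * dist x y"
    and dense: "\<And>e. e > 0 \<Longrightarrow> \<exists>y. dist x y < e \<and> convergent (\<lambda>n. h n y)"
  shows "convergent (\<lambda>n. h n x)"
proof -
  have "Cauchy (\<lambda>n. h n x)"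
  proof (rule metric_CauchyI)
    fix e :: real assume e: "e > 0"
    define K' where "K' = \<bar>K\<bar> + 1"
    have K': "K' > 0" "K \<le> K'" by (auto simp: K'_def)
    define \<eta> where "\<eta> = min e0 (e / (4 * K'))"
    have \<eta>: "\<eta> > 0" using e e0 K' by (simp add: \<eta>_def)
    obtain y where y: "dist x y < \<eta>" "convergent (\<lambda>n. h n y)" using dense[OF \<eta>] by blast
    have "K * dist x y \<le> K' * (e / (4 * K'))"
      using y(1) K' by (intro mult_mono) (auto simp: \<eta>_def)
    also have "\<dots> = e / 4" using K' by simp
    finally have K: "K * dist x y \<le> e / 4" .
    have c: "\<bar>h n x - h n y\<bar> \<le> e / 4" for n
      using lip[of y n] K y(1) by (simp add: \<eta>_def)
    have "Cauchy (\<lambda>n. h n y)" using y(2) by (rule convergent_Cauchy)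
    then obtain M where M: "\<And>m n. m \<ge> M \<Longrightarrow> n \<ge> M \<Longrightarrow> dist (h m y) (h n y) < e / 4"
      using e unfolding Cauchy_def by (metis divide_pos_pos zero_less_numeral)
    show "\<exists>M. \<forall>m\<ge>M. \<forall>n\<ge>M. dist (h m x) (h n x) < e"
    proof (intro exI[of _ M] allI impI)
      fix m n assume "m \<ge> M" "n \<ge> M"
      then have "\<bar>h m y - h n y\<bar> < e / 4" using M[of m n] by (simp add: dist_real_def)
      then show "dist (h m x) (h n x) < e"
        unfolding dist_real_def using c[of m] c[of n] e by linarith
    qed
  qed
  then show ?thesis by (simp add: Cauchy_convergent_iff)
qed

text \<open>A positive value at x would give a negative value slightly beyond \<open>x0\<close> on
  the line from x, still inside P.\<close>

lemma affine_nonneg_zero: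
  fixes x0 :: "'a::euclidean_space"
  assumes \<xi>: "\<xi> \<in> affine_funs" and x0: "x0 \<in> interior P" and nn: "\<And>x. x \<in> P \<Longrightarrow> 0 \<le> \<xi> x"
    and z: "\<xi> x0 = 0" and x: "x \<in> P"
  shows "\<xi> x = 0"
proof -
  obtain a b where ab: "\<xi> = (\<lambda>x. a \<bullet> x + b)" using \<xi> by (auto simp: affine_funs_def)
  obtain e where e: "e > 0" "ball x0 e \<subseteq> P" using x0 mem_interior by metis
  define \<epsilon> where "\<epsilon> = e / (2 * (norm (x - x0) + 1))"
  have N: "norm (x - x0) + 1 > 0" by (simp add: add_nonneg_pos)
  have \<epsilon>: "\<epsilon> > 0" using e N by (simp add: \<epsilon>_def)
  have "\<epsilon> * norm (x - x0) < \<epsilon> * (2 * (norm (x - x0) + 1))" using \<epsilon> N by simp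
  also have "\<dots> = e" using N by (simp add: \<epsilon>_def)
  finally have "x0 - \<epsilon> *\<^sub>R (x - x0) \<in> ball x0 e" using \<epsilon> by (simp add: dist_norm)
  then have "0 \<le> \<xi> (x0 - \<epsilon> *\<^sub>R (x - x0))" using e nn by blast
  also have "\<xi> (x0 - \<epsilon> *\<^sub>R (x - x0)) = (1 + \<epsilon>) * \<xi> x0 - \<epsilon> * \<xi> x"
    by (simp add: ab inner_simps algebra_simps)
  finally have "\<epsilon> * \<xi> x \<le> 0" by (simp add: z)
  then have "\<xi> x \<le> 0" using \<epsilon> by (simp add: mult_le_0_iff)
  with nn[OF x] show ?thesis by simp
qed

context extremal_polytope
begin

lemma interior_ray: "y \<in> P \<Longrightarrow> 0 \<le> s \<Longrightarrow> s < 1 \<Longrightarrow> x0 + s *\<^sub>R (y - x0) \<in> interior P"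
  using mem_interior_convex_shrink[OF convex_P x0_interior, of y "1 - s"]
  by (simp add: algebra_simps)

lemma shell_complement_interior:
  assumes "a < 1" "x \<in> P - shell a" shows "x \<in> interior P"
proof (rule ccontr)
  assume "x \<notin> interior P"
  then have "x \<in> frontier P" using assms closed_P by (simp add: frontier_def)
  then obtain j where j: "j \<in> {1..r}" "el j x = 0" by (auto simp: frontier_P facet_def)
  then have "a < 1 - el j x / el j x0" using assms by simp
  then have "x \<in> shell a" using assms j unfolding shell_def by blast
  with assms show False by simp
qed

lemma closed_shell_complement: "closed (P - shell a)"
proof -
  have "P - shell a = P \<inter> (\<Inter>j\<in>{1..r}. {x. 1 - el j x / el j x0 \<le> a})"
    unfolding shell_def not_less[symmetric] by blast
  moreover have "closed {x. 1 - el j x / el j x0 \<le> a}" for j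
    unfolding divide_inverse by (intro closed_Collect_le continuous_intros continuous_on_ell)
  ultimately show ?thesis using closed_P by (auto intro!: closed_Int closed_INT)
qed

text \<open>The quantitative form of non-concentration: because the boundary integral is at most 1,
  the bound does not depend on f. It is applied to the sequence and to its limit alike.\<close>

lemma integral_shell_le:
  assumes f: "f \<in> CVX P" and nn: "\<And>x. x \<in> P \<Longrightarrow> 0 \<le> f x" and f0: "f x0 = 0"
    and I: "(\<integral>\<^sup>+x. e2ennreal (f x) \<partial>\<sigma>) \<le> 1" and a: "0 \<le> a" "a < 1" and fE: "f \<in> E1 P"
  shows "(\<integral>x. indicator (shell a) x * real_of_ereal (f x) \<partial>leb_on P) \<le> (1 - a) * trace_const"
proof -
  define \<psi> where "\<psi> x = (if x \<in> P then e2ennreal (f x) else 0)" for x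
  have [measurable]: "\<psi> \<in> borel_measurable borel"
    unfolding \<psi>_def by (rule borel_measurable_zero_extension[OF CVX_D(4)[OF f]])
  have sP: "shell a \<subseteq> P" by (auto simp: shell_def)
  have [measurable]: "f \<in> borel_measurable (leb_on P)" using f by (rule CVX_D)
  have [measurable]: "shell a \<in> sets (leb_on P)"
    using sP borel_shell by (subst sets_restrict_space_iff) auto
  have int: "integrable (leb_on P) (\<lambda>x. indicator (shell a) x * real_of_ereal (f x))"
    using integrable_mult_indicator[OF _ E1_integrable[OF fE], of "shell a"] by simp
  have nn': "0 \<le> indicator (shell a) x * real_of_ereal (f x)" if "x \<in> P" for x
    using nn[OF that] by (intro mult_nonneg_nonneg real_of_ereal_pos) auto
  have "ennreal (\<integral>x. indicator (shell a) x * real_of_ereal (f x) \<partial>leb_on P) =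
      (\<integral>\<^sup>+x. ennreal (indicator (shell a) x * real_of_ereal (f x)) \<partial>leb_on P)"
    using nn' by (intro nn_integral_eq_integral[symmetric] int AE_I2) auto
  also have "\<dots> = (\<integral>\<^sup>+x. \<psi> x * indicator (shell a) x \<partial>leb_on P)"
    using E1_AE[OF fE] AE_space[of "leb_on P"]
    by (intro nn_integral_cong_AE, eventually_elim) (auto simp: \<psi>_def indicator_def, metis e2ennreal_ereal)
  also have "\<dots> = (\<integral>\<^sup>+x. \<psi> x * indicator (shell a) x * indicator P x \<partial>lborel)"
    by (subst nn_integral_restrict_space) auto
  also have "\<dots> \<le> (\<integral>\<^sup>+x. \<psi> x * indicator (shell a) x \<partial>lborel)"
    by (intro nn_integral_mono) (auto simp: indicator_def)
  also have "\<dots> \<le> ennreal ((1 - a) * trace_const) * (\<integral>\<^sup>+x. \<psi> x \<partial>\<sigma>)"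
  proof (rule nn_integral_shell_le)
    fix y and s :: real assume y: "y \<in> frontier P" and s: "0 < s" "s \<le> 1"
    then have "y \<in> P" using frontier_subset by auto
    then have "f (x0 + s *\<^sub>R (y - x0)) \<le> f y"
      using CVX_D(3)[OF f] x0_P f0 nn s by (intro ereal_convex_on_ray_le) auto
    then show "\<psi> (x0 + s *\<^sub>R (y - x0)) \<le> \<psi> y"
      using \<open>y \<in> P\<close> by (auto simp: \<psi>_def intro: e2ennreal_mono)
  qed (use a in auto)
  also have "(\<integral>\<^sup>+x. \<psi> x \<partial>\<sigma>) = (\<integral>\<^sup>+x. e2ennreal (f x) \<partial>\<sigma>)"
    using frontier_subset by (intro nn_integral_cong) (auto simp: \<psi>_def)
  also have "ennreal ((1 - a) * trace_const) * \<dots> \<le> ennreal ((1 - a) * trace_const) * 1"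
    using I by (intro mult_left_mono) auto
  finally have "ennreal (\<integral>x. indicator (shell a) x * real_of_ereal (f x) \<partial>leb_on P) \<le> ennreal ((1 - a) * trace_const)"
    by simp
  then show ?thesis using a trace_const_nonneg by (subst (asm) ennreal_le_iff) auto
qed

text \<open>The lower semicontinuous extension to \<open>P\<close> of a convex function on the interior whose
  minimum is attained at \<open>x0\<close>.\<close>

definition radial_ext :: "(real ^ 'n \<Rightarrow> real) \<Rightarrow> real ^ 'n \<Rightarrow> ereal" where
  "radial_ext g y = (SUP s\<in>{0..<1}. ereal (g (x0 + s *\<^sub>R (y - x0))))"

context
  fixes g :: "real ^ 'n \<Rightarrow> real"
  assumes g: "convex_on (interior P) g" and g0: "g x0 = 0" and gn: "\<And>x. x \<in> interior P \<Longrightarrow> 0 \<le> g x"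
begin

lemma continuous_on_convex_interior: "continuous_on (interior P) g"
  using g by (rule convex_on_continuous[OF open_interior])

lemma convex_interior_ray_le:
  assumes y: "y \<in> interior P" and s: "0 \<le> s" "s \<le> 1"
  shows "g (x0 + s *\<^sub>R (y - x0)) \<le> g y"
proof -
  have "x0 + s *\<^sub>R (y - x0) = (1 - s) *\<^sub>R x0 + s *\<^sub>R y" by (simp add: algebra_simps)
  then have "g (x0 + s *\<^sub>R (y - x0)) \<le> (1 - s) * g x0 + s * g y"
    using convex_onD[OF g s x0_interior y] by simp
  also have "\<dots> \<le> g y" using s gn[OF y] by (simp add: g0 mult_left_le_one_le)
  finally show ?thesis .
qed

lemma radial_ext_interior:
  assumes y: "y \<in> interior P" shows "radial_ext g y = ereal (g y)"
proof (rule antisym)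
  show "radial_ext g y \<le> ereal (g y)"
    unfolding radial_ext_def using convex_interior_ray_le[OF y] by (intro SUP_least) auto
  \<comment> \<open>The factor 1 is excluded from the supremum because the ray may end outside the
    interior, so the value at y is recovered as a limit from within.\<close>
  define s where "s n = 1 - 1 / real (Suc n)" for n
  have "s \<longlonglongrightarrow> 1 - 0" unfolding s_def using LIMSEQ_inverse_real_of_nat
    by (intro tendsto_diff tendsto_const) (simp add: inverse_eq_divide)
  then have "(\<lambda>n. x0 + s n *\<^sub>R (y - x0)) \<longlonglongrightarrow> x0 + 1 *\<^sub>R (y - x0)"
    by (intro tendsto_intros) simp
  then have lim: "(\<lambda>n. x0 + s n *\<^sub>R (y - x0)) \<longlonglongrightarrow> y" by simp
  have "isCont g y" using continuous_on_convex_interior y by (simp add: continuous_on_eq_continuous_at)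
  then have l1: "(\<lambda>n. ereal (g (x0 + s n *\<^sub>R (y - x0)))) \<longlonglongrightarrow> ereal (g y)"
    using isCont_tendsto_compose[OF _ lim] by simp
  have l2: "ereal (g (x0 + s n *\<^sub>R (y - x0))) \<le> radial_ext g y" for n
    unfolding radial_ext_def by (intro SUP_upper) (auto simp: s_def)
  show "ereal (g y) \<le> radial_ext g y" by (rule LIMSEQ_le_const2[OF l1]) (use l2 in blast)
qed

lemma radial_ext_nonneg: "y \<in> P \<Longrightarrow> 0 \<le> radial_ext g y"
  using SUP_upper[of 0 "{0..<1::real}" "\<lambda>s. ereal (g (x0 + s *\<^sub>R (y - x0)))"]
  by (simp add: radial_ext_def g0 zero_ereal_def)

text \<open>For each s < 1 the contraction by s maps P into the interior, so the function under the
  supremum is continuous and convex on P; lower semicontinuity and convexity survive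
  suprema.\<close>

lemma radial_ext_CVX: "radial_ext g \<in> CVX P"
proof -
  have "lsc_on P (radial_ext g)"
    unfolding lsc_on_def
  proof
    fix y assume y: "y \<in> P"
    show "radial_ext g y \<le> Liminf (at y within P) (radial_ext g)"
      unfolding le_Liminf_iff
    proof (intro allI impI)
      fix c assume "c < radial_ext g y"
      then obtain s where s: "s \<in> {0..<1::real}" "c < ereal (g (x0 + s *\<^sub>R (y - x0)))"
        unfolding radial_ext_def less_SUP_iff by blast
      have "continuous_on P (\<lambda>y. g (x0 + s *\<^sub>R (y - x0)))"
        using s interior_ray
        by (intro continuous_on_compose2[OF continuous_on_convex_interior] continuous_intros) auto
      then have "((\<lambda>z. ereal (g (x0 + s *\<^sub>R (z - x0)))) \<longlongrightarrow> ereal (g (x0 + s *\<^sub>R (y - x0)))) (at y within P)"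
        using y by (simp add: continuous_on_def)
      then have "eventually (\<lambda>z. c < ereal (g (x0 + s *\<^sub>R (z - x0)))) (at y within P)"
        using s(2) by (rule order_tendstoD)
      then show "eventually (\<lambda>z. c < radial_ext g z) (at y within P)"
      proof eventually_elim
        case (elim z)
        also have "ereal (g (x0 + s *\<^sub>R (z - x0))) \<le> radial_ext g z"
          unfolding radial_ext_def using s(1) by (rule SUP_upper)
        finally show ?case .
      qed
    qed
  qed
  moreover have "ereal_convex_on P (radial_ext g)"
    unfolding ereal_convex_on_def
  proof (intro ballI)
    fix x y t assume xy: "x \<in> P" "y \<in> P" and t: "t \<in> {0<..<1::real}"
    show "radial_ext g ((1 - t) *\<^sub>R x + t *\<^sub>R y) \<le> ereal (1 - t) * radial_ext g x + ereal t * radial_ext g y"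
      unfolding radial_ext_def[of g "(1 - t) *\<^sub>R x + t *\<^sub>R y"]
    proof (rule SUP_least)
      fix s :: real assume s: "s \<in> {0..<1}"
      have "x0 + s *\<^sub>R ((1 - t) *\<^sub>R x + t *\<^sub>R y - x0) = (1 - t) *\<^sub>R (x0 + s *\<^sub>R (x - x0)) + t *\<^sub>R (x0 + s *\<^sub>R (y - x0))"
        by (simp add: algebra_simps)
      then have "g (x0 + s *\<^sub>R ((1 - t) *\<^sub>R x + t *\<^sub>R y - x0)) \<le>
          (1 - t) * g (x0 + s *\<^sub>R (x - x0)) + t * g (x0 + s *\<^sub>R (y - x0))"
        using convex_onD[OF g, of t "x0 + s *\<^sub>R (x - x0)" "x0 + s *\<^sub>R (y - x0)"] t s xy interior_ray by auto
      then have "ereal (g (x0 + s *\<^sub>R ((1 - t) *\<^sub>R x + t *\<^sub>R y - x0))) \<le>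
          ereal (1 - t) * ereal (g (x0 + s *\<^sub>R (x - x0))) + ereal t * ereal (g (x0 + s *\<^sub>R (y - x0)))"
        by simp
      also have "\<dots> \<le> ereal (1 - t) * radial_ext g x + ereal t * radial_ext g y"
        unfolding radial_ext_def using t s by (intro add_mono ereal_mult_left_mono SUP_upper) auto
      finally show "ereal (g (x0 + s *\<^sub>R ((1 - t) *\<^sub>R x + t *\<^sub>R y - x0))) \<le>
        ereal (1 - t) * radial_ext g x + ereal t * radial_ext g y" .
    qed
  qed
  moreover have "radial_ext g x0 \<noteq> \<infinity>" using radial_ext_interior[OF x0_interior] by simp
  ultimately show ?thesis
    using radial_ext_nonneg x0_P by (fastforce simp: CVX_def)
qed

end

section \<open>Limits of normalized convex functions with boundary integral one\<close>

context
  fixes h :: "nat \<Rightarrow> real ^ 'n \<Rightarrow> real"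
  assumes hc: "\<And>k. continuous_on P (h k)" and hx: "\<And>k. convex_on P (h k)"
    and hn: "\<And>k x. x \<in> P \<Longrightarrow> 0 \<le> h k x" and h0: "\<And>k. h k x0 = 0"
    and hI: "\<And>k. (\<integral>x. h k x \<partial>\<sigma>) = 1"
begin

lemma h_CVX: "(\<lambda>x. ereal (h k x)) \<in> CVX P"
  using hc hx x0_P by (intro CVX_real) auto

lemma h_E1: "(\<lambda>x. ereal (h k x)) \<in> E1 P"
  using hc hx by (intro E1_continuous) auto

lemma nn_integral_h: "(\<integral>\<^sup>+x. ennreal (h k x) \<partial>\<sigma>) = 1"
  using hI[of k] hn frontier_subset
  by (subst nn_integral_eq_integral) (auto intro!: integrable_bdry_continuous hc AE_I2 simp: subset_iff)

lemma integral_h_le: "(\<integral>x. h k x \<partial>leb_on P) \<le> trace_const"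
proof -
  have "(\<integral>\<^sup>+x. e2ennreal (ereal (h k x)) \<partial>leb_on P) \<le> ennreal trace_const * (\<integral>\<^sup>+x. e2ennreal (ereal (h k x)) \<partial>\<sigma>)"
    using hn h0 by (intro trace_CVX h_CVX) (auto simp: zero_ereal_def)
  then have "ennreal (\<integral>x. h k x \<partial>leb_on P) \<le> ennreal trace_const"
    using nn_integral_E1_nonneg[OF h_E1, of k] hn by (simp add: nn_integral_h)
  then show ?thesis using trace_const_nonneg by (simp add: ennreal_le_iff)
qed

text \<open>The denominator is the volume of a ball of radius \<rho>, and
  \<open>trace_const + 1\<close> exceeds the integral of every \<open>h k\<close> over P; the mean
  value inequality turns this into a pointwise bound.\<close>

definition bound_at :: "real \<Rightarrow> real" where
  "bound_at \<rho> = (trace_const + 1) / (unit_ball_vol (real CARD('n)) * \<rho> ^ CARD('n))"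

lemma h_le_bound_at:
  assumes "\<rho> > 0" "ball c \<rho> \<subseteq> P" shows "h k c \<le> bound_at \<rho>"
proof -
  have "measure lborel (ball c \<rho>) * real_of_ereal (ereal (h k c)) \<le> (\<integral>x. real_of_ereal (ereal (h k x)) \<partial>leb_on P)"
    using hn assms by (intro E1_nonneg_mean_value[OF h_E1]) auto
  also have "\<dots> \<le> trace_const + 1" using integral_h_le[of k] by simp
  finally have le: "measure lborel (ball c \<rho>) * h k c \<le> trace_const + 1" by simp
  have eq: "measure lborel (ball c \<rho>) = unit_ball_vol (real CARD('n)) * \<rho> ^ CARD('n)"
    using assms content_ball[of \<rho> c] by simp
  have "measure lborel (ball c \<rho>) > 0" using content_ball_pos assms by blast
  then show ?thesis using le unfolding bound_at_def eq by (simp add: pos_le_divide_eq mult.commute)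
qed

lemma h_bounded_on_ball:
  assumes "\<rho> > 0" "ball c (2 * \<rho>) \<subseteq> P" "z \<in> ball c \<rho>" shows "h k z \<le> bound_at \<rho>"
proof (rule h_le_bound_at[OF assms(1)])
  show "ball z \<rho> \<subseteq> P"
  proof
    fix w assume "w \<in> ball z \<rho>"
    then have "dist c w < 2 * \<rho>" using assms(3) dist_triangle[of c w z] by simp
    then show "w \<in> P" using assms(2) by auto
  qed
qed

text \<open>Every point of the ball of radius \<rho> about c is the centre of a ball of radius
  \<rho> in P, so the mean value bound holds uniformly there; convexity converts it into a Lipschitz
  constant independent of k.\<close>

lemma h_Lipschitz:
  assumes \<rho>: "\<rho> > 0" and ball: "ball c (2 * \<rho>) \<subseteq> P" and y: "dist c y < \<rho> / 4"
  shows "\<bar>h k c - h k y\<bar> \<le> 2 * bound_at \<rho> / \<rho> * dist c y"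
proof -
  have sub: "ball c \<rho> \<subseteq> P" using ball \<rho> by (intro order_trans[OF subset_ball ball]) simp
  have "h k y - h k c \<le> 2 * bound_at \<rho> / \<rho> * dist c y"
    using y \<rho> sub hn h_bounded_on_ball[OF \<rho> ball] by (intro real_convex_Lipschitz_ball[OF hx]) auto
  moreover have "h k c - h k y \<le> 2 * bound_at \<rho> / \<rho> * dist y c"
    using y \<rho> sub hn h_bounded_on_ball[OF \<rho> ball] by (intro real_convex_Lipschitz_ball[OF hx]) auto
  ultimately show ?thesis by (simp add: dist_commute)
qed

lemma interior_ball2:
  assumes "c \<in> interior P" obtains \<rho> where "\<rho> > 0" "ball c (2 * \<rho>) \<subseteq> P"
proof -
  obtain e where "e > 0" "ball c e \<subseteq> P" using assms mem_interior by metis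
  then show ?thesis using that[of "e / 2"] by simp
qed

text \<open>A diagonal argument gives convergence on a countable dense set, and the Lipschitz
  bounds, uniform in the index, carry it to every interior point. Pointwise convergence in the
  interior is all that is asked for.\<close>

lemma h_convergent_subsequence:
  obtains \<phi> g where "strict_mono (\<phi> :: nat \<Rightarrow> nat)" "\<And>x. x \<in> interior P \<Longrightarrow> (\<lambda>n. h (\<phi> n) x) \<longlonglongrightarrow> g x"
proof -
  obtain D :: "(real ^ 'n) set" where D: "countable D" "\<And>U. open U \<Longrightarrow> U \<noteq> {} \<Longrightarrow> \<exists>d\<in>D. d \<in> U"
    using countable_dense_exists by blast
  define D' where "D' = D \<inter> interior P"
  have "\<forall>x\<in>interior P. \<exists>b>0. \<forall>n. h n x \<le> b"
  proof
    fix x assume x: "x \<in> interior P"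
    obtain \<rho> where "\<rho> > 0" "ball x (2 * \<rho>) \<subseteq> P" using interior_ball2[OF x] .
    then have "h n x \<le> bound_at \<rho>" for n by (intro h_bounded_on_ball[of \<rho> x x]) auto
    then have "h n x \<le> \<bar>bound_at \<rho>\<bar> + 1" for n by (rule order_trans) simp
    then show "\<exists>b>0. \<forall>n. h n x \<le> b"
      by (intro exI[of _ "\<bar>bound_at \<rho>\<bar> + 1"]) (simp add: add_nonneg_pos)
  qed
  then obtain b where b: "\<And>x. x \<in> interior P \<Longrightarrow> b x > 0" "\<And>x n. x \<in> interior P \<Longrightarrow> h n x \<le> b x"
    by metis
  have cD: "countable D'" using D(1) by (simp add: D'_def)
  \<comment> \<open>The bounds grow towards the boundary, whereas the diagonal argument wants one
    constant for all points; dividing by \<open>b x\<close> provides it and is undone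
    afterwards.\<close>
  have bd: "norm (h n x / b x) \<le> 1" if "x \<in> D'" for n x
  proof -
    have "x \<in> interior P" "x \<in> P" using that interior_subset by (auto simp: D'_def)
    then show ?thesis using b[of x] hn[of x n] by simp
  qed
  obtain \<phi> :: "nat \<Rightarrow> nat" where \<phi>: "strict_mono \<phi>" "\<And>x. x \<in> D' \<Longrightarrow> \<exists>l. (\<lambda>n. h (\<phi> n) x / b x) \<longlonglongrightarrow> l"
    using function_convergent_subsequence[OF cD, of "\<lambda>n x. h n x / b x" 1, OF bd] by blast
  have conv: "convergent (\<lambda>n. h (\<phi> n) x)" if x: "x \<in> interior P" for x
  proof -
    obtain \<rho> where \<rho>: "\<rho> > 0" "ball x (2 * \<rho>) \<subseteq> P" using interior_ball2[OF x] .
    show ?thesis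
    proof (rule convergent_of_convergent_on_dense)
      show "\<rho> / 4 > 0" using \<rho> by simp
      show "\<bar>h (\<phi> n) x - h (\<phi> n) y\<bar> \<le> 2 * bound_at \<rho> / \<rho> * dist x y" if "dist x y < \<rho> / 4" for n y
        using \<rho> that by (rule h_Lipschitz)
      fix e :: real assume "e > 0"
      then have "x \<in> ball x e \<inter> interior P" using x by simp
      then have ne: "ball x e \<inter> interior P \<noteq> {}" by blast
      have op: "open (ball x e \<inter> interior P)" by (intro open_Int open_ball open_interior)
      obtain y where y: "y \<in> D" "y \<in> ball x e \<inter> interior P" using D(2)[OF op ne] by blast
      then have yD: "y \<in> D'" "b y > 0" using b by (auto simp: D'_def)
      obtain l where "(\<lambda>n. h (\<phi> n) y / b y) \<longlonglongrightarrow> l" using \<phi>(2)[OF yD(1)] by blast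
      then have "(\<lambda>n. b y * (h (\<phi> n) y / b y)) \<longlonglongrightarrow> b y * l" by (rule tendsto_mult_left)
      then have "(\<lambda>n. h (\<phi> n) y) \<longlonglongrightarrow> b y * l" using yD by simp
      then show "\<exists>y. dist x y < e \<and> convergent (\<lambda>n. h (\<phi> n) y)"
        using y by (auto simp: convergent_def)
    qed
  qed
  show ?thesis
    by (rule that[OF \<phi>(1), of "\<lambda>x. lim (\<lambda>n. h (\<phi> n) x)"]) (use conv in \<open>simp add: convergent_LIMSEQ_iff\<close>)
qed

context
  fixes \<phi> :: "nat \<Rightarrow> nat" and g :: "real ^ 'n \<Rightarrow> real"
  assumes lim: "\<And>x. x \<in> interior P \<Longrightarrow> (\<lambda>n. h (\<phi> n) x) \<longlonglongrightarrow> g x"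
begin

lemma limit_convex: "convex_on (interior P) g"
proof (rule convex_onI)
  fix t :: real and x y assume t: "0 < t" "t < 1" and xy: "x \<in> interior P" "y \<in> interior P"
  have z: "(1 - t) *\<^sub>R x + t *\<^sub>R y \<in> interior P"
    using convex_interior[OF convex_P] t xy by (simp add: convex_alt)
  have xyP: "x \<in> P" "y \<in> P" using xy interior_subset by auto
  show "g ((1 - t) *\<^sub>R x + t *\<^sub>R y) \<le> (1 - t) * g x + t * g y"
  proof (rule LIMSEQ_le[OF lim[OF z] tendsto_add[OF tendsto_mult_left[OF lim[OF xy(1)]] tendsto_mult_left[OF lim[OF xy(2)]]]])
    show "\<exists>N. \<forall>n\<ge>N. h (\<phi> n) ((1 - t) *\<^sub>R x + t *\<^sub>R y) \<le> (1 - t) * h (\<phi> n) x + t * h (\<phi> n) y"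
      using convex_onD[OF hx _ _ xyP] t by (intro exI[of _ 0]) auto
  qed
qed (rule convex_interior[OF convex_P])

lemma limit_x0: "g x0 = 0"
  using LIMSEQ_unique[OF lim[OF x0_interior]] by (simp add: h0)

lemma limit_nonneg: "x \<in> interior P \<Longrightarrow> 0 \<le> g x"
  using hn interior_subset[of P] by (intro LIMSEQ_le_const[OF lim]) auto

lemmas limit_facts = limit_convex limit_x0 limit_nonneg

text \<open>Fatou's lemma. At a boundary point the sequence itself need not converge, but its values
  there dominate those along the ray, and these converge to the values that define the radial
  extension.\<close>

lemma nn_integral_limit_le: "(\<integral>\<^sup>+x. e2ennreal (radial_ext g x) \<partial>\<sigma>) \<le> 1"
proof -
  have [measurable]: "h k \<in> borel_measurable \<sigma>" for k
    using integrable_bdry_continuous[OF hc] by simp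
  have "(\<integral>\<^sup>+x. e2ennreal (radial_ext g x) \<partial>\<sigma>) \<le> (\<integral>\<^sup>+x. liminf (\<lambda>n. ennreal (h (\<phi> n) x)) \<partial>\<sigma>)"
  proof (rule nn_integral_mono)
    fix y assume "y \<in> space \<sigma>"
    then have y: "y \<in> P" using frontier_subset by auto
    have "radial_ext g y \<le> enn2ereal (liminf (\<lambda>n. ennreal (h (\<phi> n) y)))"
      unfolding radial_ext_def
    proof (rule SUP_least)
      fix s :: real assume s: "s \<in> {0..<1}"
      let ?z = "x0 + s *\<^sub>R (y - x0)"
      have z: "?z \<in> interior P" using interior_ray y s by simp
      have "(\<lambda>n. ennreal (h (\<phi> n) ?z)) \<longlonglongrightarrow> ennreal (g ?z)"
        using lim[OF z] by (rule tendsto_ennrealI)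
      then have "ennreal (g ?z) = liminf (\<lambda>n. ennreal (h (\<phi> n) ?z))"
        by (intro lim_imp_Liminf[symmetric]) auto
      also have "\<dots> \<le> liminf (\<lambda>n. ennreal (h (\<phi> n) y))"
      proof (rule Liminf_mono, intro always_eventually allI ennreal_leI)
        fix n
        have "ereal (h (\<phi> n) ?z) \<le> ereal (h (\<phi> n) y)"
          using ereal_convex_on_ray_le[OF CVX_D(3)[OF h_CVX[of "\<phi> n"]] x0_P, of y s] h0 hn y s
          by (simp add: zero_ereal_def)
        then show "h (\<phi> n) ?z \<le> h (\<phi> n) y" by simp
      qed
      finally have "enn2ereal (ennreal (g ?z)) \<le> enn2ereal (liminf (\<lambda>n. ennreal (h (\<phi> n) y)))"
        by (simp add: less_eq_ennreal.rep_eq)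
      then show "ereal (g ?z) \<le> enn2ereal (liminf (\<lambda>n. ennreal (h (\<phi> n) y)))"
        using limit_nonneg[OF z] by simp
    qed
    then have "e2ennreal (radial_ext g y) \<le> e2ennreal (enn2ereal (liminf (\<lambda>n. ennreal (h (\<phi> n) y))))"
      by (rule e2ennreal_mono)
    then show "e2ennreal (radial_ext g y) \<le> liminf (\<lambda>n. ennreal (h (\<phi> n) y))" by simp
  qed
  also have "\<dots> \<le> liminf (\<lambda>n. \<integral>\<^sup>+x. ennreal (h (\<phi> n) x) \<partial>\<sigma>)"
    by (rule nn_integral_liminf) measurable
  also have "\<dots> = 1" by (simp add: nn_integral_h Liminf_const)
  finally show ?thesis .
qed

lemma limit_C_star: "radial_ext g \<in> C_star r lam d"
proof (rule CVX_in_C_star)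
  show "radial_ext g \<in> CVX P" using limit_facts by (rule radial_ext_CVX)
  show "0 \<le> radial_ext g x" if "x \<in> P" for x using limit_facts that by (rule radial_ext_nonneg)
  show "(\<integral>\<^sup>+x. e2ennreal (radial_ext g x) \<partial>\<sigma>) < \<infinity>" using nn_integral_limit_le by (rule le_less_trans) simp
  show "radial_ext g x \<noteq> \<infinity>" if "x \<in> interior P" for x
    using radial_ext_interior[OF limit_facts that] by simp
qed

text \<open>P is split into a thin shell and its complement. In the shell both the sequence and the
  limit have little mass, by the cone estimate; the complement is a compact subset of the interior,
  where a uniform bound permits dominated convergence.\<close>

lemma integral_W_limit:
  "(\<lambda>n. \<integral>x. W x * h (\<phi> n) x \<partial>leb_on P) \<longlonglongrightarrow> (\<integral>x. W x * real_of_ereal (radial_ext g x) \<partial>leb_on P)"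
proof (rule LIMSEQ_I)
  define f where "f = radial_ext g"
  define rf where "rf x = real_of_ereal (f x)" for x
  have fC: "f \<in> CVX P" unfolding f_def using limit_facts by (rule radial_ext_CVX)
  have fn: "0 \<le> f x" if "x \<in> P" for x unfolding f_def using limit_facts that by (rule radial_ext_nonneg)
  have f_int: "f x = ereal (g x)" if "x \<in> interior P" for x
    unfolding f_def using limit_facts that by (rule radial_ext_interior)
  have f0: "f x0 = 0" using f_int[OF x0_interior] limit_x0 by (simp add: zero_ereal_def)
  have fE: "f \<in> E1 P" using limit_C_star C_star_subset by (auto simp: f_def)
  have irf: "integrable (leb_on P) rf" unfolding rf_def by (rule E1_integrable[OF fE])
  have rfn: "0 \<le> rf x" if "x \<in> P" for x using fn[OF that] by (simp add: rf_def real_of_ereal_pos)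
  have [measurable]: "rf \<in> borel_measurable (leb_on P)" using irf by simp
  have ih: "integrable (leb_on P) (h k)" for k by (rule integrable_leb_continuous[OF hc])
  have [measurable]: "h k \<in> borel_measurable (leb_on P)" for k using ih by simp
  obtain C where C: "C > 0" "\<And>x. x \<in> P \<Longrightarrow> \<bar>W x\<bar> \<le> C" using W_bound by metis
  fix \<epsilon> :: real assume \<epsilon>: "\<epsilon> > 0"
  define T where "T = trace_const + 1"
  have T: "T > 0" "trace_const \<le> T" using trace_const_nonneg by (auto simp: T_def)
  \<comment> \<open>The thickness of the shell. The sequence and the limit each have mass at most b
    times \<open>trace_const\<close> in it; weighted by C, together they contribute at most
    \<epsilon> / 2. The minimum with 1 keeps a = 1 - b nonnegative.\<close>
  define b where "b = min 1 (\<epsilon> / (4 * C * T))"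
  have b: "0 < b" "b \<le> 1" "b \<le> \<epsilon> / (4 * C * T)" using \<epsilon> C T by (auto simp: b_def)
  define a where "a = 1 - b"
  have a: "0 \<le> a" "a < 1" "1 - a = b" using b by (auto simp: a_def)
  have bT: "C * (2 * (b * trace_const)) \<le> \<epsilon> / 2"
  proof -
    have "C * (2 * (b * trace_const)) \<le> C * (2 * (\<epsilon> / (4 * C * T) * T))"
      using C T b trace_const_nonneg \<epsilon> by (intro mult_left_mono mult_mono) auto
    also have "\<dots> = \<epsilon> / 2" using C T by (simp add: field_simps)
    finally show ?thesis .
  qed
  define S where "S = shell a"
  have sP: "S \<subseteq> P" by (auto simp: S_def shell_def)
  have S[measurable]: "S \<in> sets (leb_on P)"
    using sP borel_shell unfolding S_def by (subst sets_restrict_space_iff) auto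
  have "compact (P - S)" using closed_shell_complement bounded_P unfolding S_def
    by (simp add: compact_eq_bounded_closed bounded_diff)
  moreover have "P - S \<subseteq> interior P" using shell_complement_interior[OF a(2)] unfolding S_def by blast
  \<comment> \<open>One radius for all points of the compact complement turns the mean value bounds
    into the single constant \<open>bound_at e\<close>, which dominates the whole sequence.\<close>
  ultimately obtain e where e: "e > 0" "(\<Union>x\<in>P - S. ball x e) \<subseteq> interior P"
    using compact_subset_open_imp_ball_epsilon_subset[OF _ open_interior] by metis
  have hb: "h k x \<le> bound_at e" if "x \<in> P - S" for k x
  proof (rule h_le_bound_at[OF e(1)])
    show "ball x e \<subseteq> P" using e(2) that interior_subset[of P] by blast
  qed
  have bound0: "0 \<le> bound_at e"
    using e(1) trace_const_nonneg unfolding bound_at_def by (intro divide_nonneg_nonneg mult_nonneg_nonneg) auto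
  have inner: "(\<lambda>n. \<integral>x. indicator (P - S) x * \<bar>h (\<phi> n) x - rf x\<bar> \<partial>leb_on P) \<longlonglongrightarrow> (\<integral>x. 0 \<partial>leb_on P)"
  proof (rule integral_dominated_convergence[where w="\<lambda>x. bound_at e + rf x"])
    show "integrable (leb_on P) (\<lambda>x. bound_at e + rf x)" using irf by simp
    have PS[measurable]: "P - S \<in> sets (leb_on P)" using sets.compl_sets[OF S] by simp
    show "(\<lambda>x. indicator (P - S) x * \<bar>h (\<phi> n) x - rf x\<bar>) \<in> borel_measurable (leb_on P)" for n by measurable
    show "AE x in leb_on P. (\<lambda>n. indicator (P - S) x * \<bar>h (\<phi> n) x - rf x\<bar>) \<longlonglongrightarrow> 0"
    proof (rule AE_I2)
      fix x
      show "(\<lambda>n. indicator (P - S) x * \<bar>h (\<phi> n) x - rf x\<bar>) \<longlonglongrightarrow> 0"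
      proof (cases "x \<in> P - S")
        case True
        then have xi: "x \<in> interior P" using \<open>P - S \<subseteq> interior P\<close> by blast
        have "rf x = g x" using f_int[OF xi] by (simp add: rf_def)
        then have "(\<lambda>n. \<bar>h (\<phi> n) x - rf x\<bar>) \<longlonglongrightarrow> \<bar>g x - g x\<bar>"
          using lim[OF xi] by (intro tendsto_intros) auto
        then show ?thesis using True by simp
      qed simp
    qed
    show "AE x in leb_on P. norm (indicator (P - S) x * \<bar>h (\<phi> n) x - rf x\<bar>) \<le> bound_at e + rf x" for n
    proof (rule AE_I2)
      fix x assume "x \<in> space (leb_on P)"
      then have x: "x \<in> P" by simp
      show "norm (indicator (P - S) x * \<bar>h (\<phi> n) x - rf x\<bar>) \<le> bound_at e + rf x"
        using hb[of x "\<phi> n"] hn[OF x, of "\<phi> n"] rfn[OF x] bound0 x by (cases "x \<in> S") auto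
    qed
  qed simp
  then have "(\<lambda>n. \<integral>x. indicator (P - S) x * \<bar>h (\<phi> n) x - rf x\<bar> \<partial>leb_on P) \<longlonglongrightarrow> 0" by simp
  from LIMSEQ_D[OF this, of "\<epsilon> / (2 * C)"] obtain N where N: "\<And>n. n \<ge> N \<Longrightarrow> \<bar>\<integral>x. indicator (P - S) x * \<bar>h (\<phi> n) x - rf x\<bar> \<partial>leb_on P\<bar> < \<epsilon> / (2 * C)"
    using \<epsilon> C by auto
  show "\<exists>N. \<forall>n\<ge>N. norm ((\<integral>x. W x * h (\<phi> n) x \<partial>leb_on P) - (\<integral>x. W x * real_of_ereal (radial_ext g x) \<partial>leb_on P)) < \<epsilon>"
  proof (intro exI[of _ N] allI impI)
    fix n assume n: "n \<ge> N"
    let ?h = "h (\<phi> n)"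
    have PS: "P - S \<in> sets (leb_on P)" using sets.compl_sets[OF S] by simp
    have i1: "integrable (leb_on P) (\<lambda>x. indicator (P - S) x * \<bar>?h x - rf x\<bar>)"
      using integrable_mult_indicator[OF PS, of "\<lambda>x. \<bar>?h x - rf x\<bar>"] ih irf by simp
    have i2: "integrable (leb_on P) (\<lambda>x. indicator S x * ?h x)"
      using integrable_mult_indicator[OF S ih] by simp
    have i3: "integrable (leb_on P) (\<lambda>x. indicator S x * rf x)"
      using integrable_mult_indicator[OF S irf] by simp
    have "(\<integral>x. \<bar>?h x - rf x\<bar> \<partial>leb_on P) \<le>
        (\<integral>x. indicator (P - S) x * \<bar>?h x - rf x\<bar> + (indicator S x * ?h x + indicator S x * rf x) \<partial>leb_on P)"
    proof (rule integral_mono)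
      fix x assume "x \<in> space (leb_on P)"
      then have x: "x \<in> P" by simp
      show "\<bar>?h x - rf x\<bar> \<le> indicator (P - S) x * \<bar>?h x - rf x\<bar> + (indicator S x * ?h x + indicator S x * rf x)"
        using x hn[OF x, of "\<phi> n"] rfn[OF x] by (cases "x \<in> S") auto
    qed (use ih irf i1 i2 i3 in auto)
    also have "\<dots> = (\<integral>x. indicator (P - S) x * \<bar>?h x - rf x\<bar> \<partial>leb_on P) +
        ((\<integral>x. indicator S x * ?h x \<partial>leb_on P) + (\<integral>x. indicator S x * rf x \<partial>leb_on P))"
      using i1 i2 i3 by simp
    also have "(\<integral>x. indicator S x * ?h x \<partial>leb_on P) \<le> b * trace_const"
      using integral_shell_le[OF h_CVX _ _ _ a(1,2) h_E1, of "\<phi> n"] hn h0 a(3)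
      by (simp add: S_def zero_ereal_def nn_integral_h)
    also have "(\<integral>x. indicator S x * rf x \<partial>leb_on P) \<le> b * trace_const"
      using integral_shell_le[OF fC fn f0 _ a(1,2) fE] nn_integral_limit_le a(3)
      by (simp add: S_def rf_def f_def)
    finally have le: "(\<integral>x. \<bar>?h x - rf x\<bar> \<partial>leb_on P) \<le>
        (\<integral>x. indicator (P - S) x * \<bar>?h x - rf x\<bar> \<partial>leb_on P) + 2 * (b * trace_const)"
      by simp
    have "(\<integral>x. W x * ?h x \<partial>leb_on P) - (\<integral>x. W x * rf x \<partial>leb_on P) = (\<integral>x. W x * (?h x - rf x) \<partial>leb_on P)"
      using integrable_W_mult[OF ih, of "\<phi> n"] integrable_W_mult[OF irf]
      by (simp add: right_diff_distrib)
    also have "\<bar>\<dots>\<bar> \<le> C * (\<integral>x. \<bar>?h x - rf x\<bar> \<partial>leb_on P)"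
      using ih irf C(2) by (intro integral_W_mult_le) auto
    finally have "\<bar>(\<integral>x. W x * ?h x \<partial>leb_on P) - (\<integral>x. W x * rf x \<partial>leb_on P)\<bar> \<le>
        C * (\<integral>x. \<bar>?h x - rf x\<bar> \<partial>leb_on P)" .
    also have "\<dots> \<le> C * ((\<integral>x. indicator (P - S) x * \<bar>?h x - rf x\<bar> \<partial>leb_on P) + 2 * (b * trace_const))"
      using le C by (intro mult_left_mono) auto
    also have "\<dots> < C * (\<epsilon> / (2 * C)) + \<epsilon> / 2"
    proof -
      have "C * (\<integral>x. indicator (P - S) x * \<bar>?h x - rf x\<bar> \<partial>leb_on P) < C * (\<epsilon> / (2 * C))"
        using N[OF n] C(1) by (intro mult_strict_left_mono) auto
      with bT show ?thesis unfolding distrib_left by linarith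
    qed
    also have "\<dots> = \<epsilon>" using C by simp
    finally show "norm ((\<integral>x. W x * ?h x \<partial>leb_on P) - (\<integral>x. W x * real_of_ereal (radial_ext g x) \<partial>leb_on P)) < \<epsilon>"
      by (simp add: rf_def f_def)
  qed
qed

end

lemma exists_Lam_ge_if_cond_K:
  assumes K: "cond_K r lam d V (C_star r lam d)"
  shows "\<exists>k. Lam (h k) \<ge> 1 / real (Suc k)"
proof (rule ccontr)
  assume "\<not> ?thesis"
  then have small: "Lam (h k) < 1 / real (Suc k)" for k by (simp add: not_le)
  obtain \<phi> g where \<phi>: "strict_mono (\<phi> :: nat \<Rightarrow> nat)" and lim: "\<And>x. x \<in> interior P \<Longrightarrow> (\<lambda>n. h (\<phi> n) x) \<longlonglongrightarrow> g x"
    using h_convergent_subsequence by metis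
  define f where "f = radial_ext g"
  have fS: "f \<in> C_star r lam d" unfolding f_def using lim by (rule limit_C_star)
  note lf = limit_facts[OF lim]
  have fn: "0 \<le> f x" if "x \<in> P" for x unfolding f_def using lf that by (rule radial_ext_nonneg)
  have f0: "f x0 = 0" unfolding f_def using radial_ext_interior[OF lf x0_interior] lf(2) by (simp add: zero_ereal_def)
  define w where "w = (\<integral>x. W x * real_of_ereal (f x) \<partial>leb_on P)"
  have "(\<lambda>n. 1 - (\<integral>x. W x * h (\<phi> n) x \<partial>leb_on P)) \<longlonglongrightarrow> 1 - w"
    unfolding w_def f_def using integral_W_limit[OF lim] by (intro tendsto_diff tendsto_const)
  then have Ll: "(\<lambda>n. Lam (h (\<phi> n))) \<longlonglongrightarrow> 1 - w" by (simp add: Lam_def hI)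
  have "(\<lambda>n. 1 / real (Suc n)) \<longlonglongrightarrow> 0" using LIMSEQ_inverse_real_of_nat by (simp add: inverse_eq_divide)
  from LIMSEQ_subseq_LIMSEQ[OF this \<phi>] have "(\<lambda>n. 1 / real (Suc (\<phi> n))) \<longlonglongrightarrow> 0" by (simp add: o_def)
  then have w1: "1 - w \<le> 0"
    using small by (intro LIMSEQ_le[OF Ll]) (auto intro: less_imp_le)
  \<comment> \<open>Boundary mass may be lost in the limit, but this only lowers L f, so the bound L
    f \<le> 1 - w \<le> 0 survives. With L f \<ge> 0 from (K) it forces equality, and then w = 0
    contradicts 1 - w \<le> 0.\<close>
  have "ereal_integral \<sigma> f \<le> 1"
  proof -
    have "enn2ereal (\<integral>\<^sup>+x. e2ennreal (f x) \<partial>\<sigma>) \<le> enn2ereal 1"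
      unfolding f_def using nn_integral_limit_le[OF lim] by (simp add: less_eq_ennreal.rep_eq)
    then show ?thesis using bdry_nonneg[of f] fn by (simp add: one_ennreal.rep_eq)
  qed
  then have "L f \<le> 1 - ereal w" unfolding L_eq w_def[symmetric] by (intro ereal_minus_mono) auto
  also have "\<dots> \<le> 0" using w1 by (simp add: one_ereal_def zero_ereal_def)
  finally have "L f \<le> 0" .
  then have "L f = 0" "affine_on P f" using K fS by (auto simp: cond_K_def intro: antisym)
  then obtain \<xi> where \<xi>: "\<xi> \<in> affine_funs" "\<And>x. x \<in> P \<Longrightarrow> f x = ereal (\<xi> x)" by (auto simp: affine_on_def)
  have "\<xi> x = 0" if "x \<in> P" for x
    using \<xi>(1) x0_interior _ _ that
  proof (rule affine_nonneg_zero)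
    show "0 \<le> \<xi> x" if "x \<in> P" for x using fn[OF that] \<xi>(2)[OF that] by simp
    show "\<xi> x0 = 0" using f0 \<xi>(2)[OF x0_P] by simp
  qed
  then have "w = (\<integral>x. 0 \<partial>leb_on P)"
    unfolding w_def using \<xi>(2) by (intro Bochner_Integration.integral_cong) auto
  with w1 show False by simp
qed

end

lemma Lam_scale: "Lam (\<lambda>x. c * g x) = c * Lam g"
proof -
  have "(\<integral>x. W x * (c * g x) \<partial>leb_on P) = c * (\<integral>x. W x * g x \<partial>leb_on P)"
    by (subst integral_mult_right_zero[symmetric]) (simp add: ac_simps)
  then show ?thesis by (simp add: Lam_def right_diff_distrib)
qed

lemma cond_K_C_star_imp_cond_b:
  assumes K: "cond_K r lam d V (C_star r lam d)"
  shows "cond_b r lam d V x0 (C_PL P)"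
proof (rule ccontr)
  assume nb: "\<not> ?thesis"
  have "\<exists>h. continuous_on P h \<and> convex_on P h \<and> (\<forall>x\<in>P. 0 \<le> h x) \<and> h x0 = 0 \<and>
      (\<integral>x. h x \<partial>\<sigma>) = 1 \<and> Lam h < 1 / real (Suc k)" for k
  proof -
    have pos: "1 / real (Suc k) > 0" by simp
    obtain f where f: "f \<in> normalized P x0 (C_PL P)" "\<not> ereal (1 / real (Suc k)) * ereal_integral \<sigma> f \<le> L f"
      using nb pos unfolding cond_b_def by blast
    then obtain T where T: "finite T" "T \<noteq> {}" "\<And>x. x \<in> P \<Longrightarrow> f x = ereal (max_affine T x)"
      using normalizedD(1)[OF f(1)] unfolding C_PL_eq by blast
    define q where "q = max_affine T"
    have cq: "continuous_on P q" unfolding q_def by (rule continuous_on_max_affine[OF T(1,2)])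
    have xq: "convex_on P q" unfolding q_def
      by (rule convex_on_subset[OF convex_on_max_affine[OF T(1,2)] subset_UNIV convex_P])
    have qn: "0 \<le> q x" if "x \<in> P" for x using normalizedD(2)[OF f(1) that] T(3)[OF that] by (simp add: q_def)
    have q0: "q x0 = 0" using normalizedD(3)[OF f(1)] T(3)[OF x0_P] by (simp add: q_def)
    define \<beta> where "\<beta> = (\<integral>x. q x \<partial>\<sigma>)"
    have Lq: "L f = ereal (Lam q)" and Bq: "ereal_integral \<sigma> f = ereal \<beta>"
      using L_real[OF cq, of f] T(3) by (auto simp: q_def \<beta>_def)
    have "f \<in> C_star r lam d" using normalizedD(1)[OF f(1)] C_PL_subset by blast
    \<comment> \<open>Nonnegativity from (K) is needed before rescaling: together with the failure
      of (b) it yields \<beta> > 0, so that q can be divided by \<beta>.\<close>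
    then have "0 \<le> L f" using K by (simp add: cond_K_def)
    then have Lq0: "0 \<le> Lam q" by (simp add: Lq)
    have lt: "Lam q < 1 / real (Suc k) * \<beta>" using f(2) by (simp add: Lq Bq)
    then have "0 < 1 / real (Suc k) * \<beta>" using Lq0 by linarith
    then have \<beta>: "\<beta> > 0" using pos by (rule zero_less_mult_pos)
    let ?h = "\<lambda>x. (1 / \<beta>) * q x"
    have "(\<integral>x. ?h x \<partial>\<sigma>) = 1 / \<beta> * \<beta>" unfolding \<beta>_def by simp
    moreover have "Lam ?h < 1 / real (Suc k)"
      unfolding Lam_scale using lt \<beta> by (simp add: field_simps)
    moreover have "continuous_on P ?h" using cq by (intro continuous_intros)
    moreover have "convex_on P ?h" using xq \<beta> by (intro convex_on_cmul) auto
    ultimately show ?thesis using \<beta> qn q0 by (intro exI[of _ ?h]) auto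
  qed
  then obtain h where h: "\<And>k. continuous_on P (h k)" "\<And>k. convex_on P (h k)" "\<And>k x. x \<in> P \<Longrightarrow> 0 \<le> h k x"
    "\<And>k. h k x0 = 0" "\<And>k. (\<integral>x. h k x \<partial>\<sigma>) = 1" and small: "\<And>k. Lam (h k) < 1 / real (Suc k)"
    by metis
  obtain k where "Lam (h k) \<ge> 1 / real (Suc k)"
    using exists_Lam_ge_if_cond_K[of h, OF h K] by blast
  with small[of k] show False by simp
qed

end

section \<open>Smoothing piecewise affine functions\<close>

lemma Ck_on_subset: "Ck_on k U g \<Longrightarrow> V \<subseteq> U \<Longrightarrow> Ck_on k V g"
  by (induction k arbitrary: g) (auto intro: continuous_on_subset)

lemma frechet_derivative_cong_open:
  assumes "open U" "x \<in> U" "\<And>y. y \<in> U \<Longrightarrow> f y = g y" "f differentiable (at x)"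
  shows "g differentiable (at x)" "frechet_derivative g (at x) = frechet_derivative f (at x)"
proof -
  have "(f has_derivative frechet_derivative f (at x)) (at x)"
    using assms(4) frechet_derivative_works by blast
  then have d: "(g has_derivative frechet_derivative f (at x)) (at x)"
    using assms(1,2,3) by (rule has_derivative_transform_within_open)
  then show "g differentiable (at x)" by (rule differentiableI)
  show "frechet_derivative g (at x) = frechet_derivative f (at x)"
    using frechet_derivative_at[OF d] by simp
qed

lemma Ck_on_cong:
  assumes "open U" "\<And>x. x \<in> U \<Longrightarrow> f x = g x" "Ck_on k U f"
  shows "Ck_on k U g"
  using assms(2,3)
proof (induction k arbitrary: f g)
  case 0
  then show ?case using continuous_on_cong[of U U f g] by auto
next
  case (Suc k)
  have d: "g differentiable (at x)" "frechet_derivative g (at x) = frechet_derivative f (at x)" if "x \<in> U" for x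
    using frechet_derivative_cong_open[OF assms(1) that, of f g] Suc.prems that by auto
  have "Ck_on k U (\<lambda>x. frechet_derivative g (at x) v)" for v
    by (rule Suc.IH[of "\<lambda>x. frechet_derivative f (at x) v"]) (use Suc.prems d in auto)
  then show ?case using d by simp
qed

text \<open>Lets a derivative be proposed in closed form; the closure properties below all proceed
  by induction on the order with the usual differentiation rule as the proposal.\<close>

lemma Ck_on_SucI:
  assumes "open U" "\<And>x. x \<in> U \<Longrightarrow> (g has_derivative g' x) (at x)" "\<And>v. Ck_on k U (\<lambda>x. g' x v)"
  shows "Ck_on (Suc k) U g"
proof -
  have "frechet_derivative g (at x) = g' x" if "x \<in> U" for x
    using frechet_derivative_at[OF assms(2)[OF that]] by simp
  then have "Ck_on k U (\<lambda>x. frechet_derivative g (at x) v)" for v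
    by (intro Ck_on_cong[OF assms(1) _ assms(3)[of v]]) simp
  moreover have "g differentiable (at x)" if "x \<in> U" for x
    using assms(2)[OF that] by (rule differentiableI)
  ultimately show ?thesis by simp
qed

lemma Ck_on_SucD:
  assumes "Ck_on (Suc k) U g"
  shows "x \<in> U \<Longrightarrow> (g has_derivative frechet_derivative g (at x)) (at x)"
    "Ck_on k U (\<lambda>x. frechet_derivative g (at x) v)"
  using assms frechet_derivative_works by auto

lemma Ck_on_Suc_imp: "Ck_on (Suc k) U g \<Longrightarrow> Ck_on k U g"
proof (induction k arbitrary: g)
  case 0
  then have "g differentiable (at x)" if "x \<in> U" for x using that by simp
  then have "isCont g x" if "x \<in> U" for x using that differentiable_imp_continuous_within by blast
  then show ?case by (auto intro: continuous_at_imp_continuous_on)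
next
  case (Suc k)
  have "Ck_on k U (\<lambda>x. frechet_derivative g (at x) v)" for v
    using Suc.prems by (intro Suc.IH) simp
  then show ?case using Suc.prems by simp
qed

lemma Ck_on_const: "Ck_on k U (\<lambda>x. c)"
  by (induction k arbitrary: c) auto

lemma Ck_on_inner:
  assumes "open U" shows "Ck_on k U (\<lambda>x. a \<bullet> x + b)"
proof (cases k)
  case 0
  then show ?thesis by (auto intro!: continuous_intros)
next
  case (Suc m)
  have "Ck_on (Suc m) U (\<lambda>x. a \<bullet> x + b)"
  proof (rule Ck_on_SucI[OF assms, where g'="\<lambda>x v. a \<bullet> v"])
    show "((\<lambda>x. a \<bullet> x + b) has_derivative (\<lambda>v. a \<bullet> v)) (at x)" for x
      by (auto intro!: derivative_eq_intros)
  qed (rule Ck_on_const)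
  then show ?thesis by (simp add: Suc)
qed

lemma Ck_on_add:
  assumes U: "open U" shows "Ck_on k U f \<Longrightarrow> Ck_on k U g \<Longrightarrow> Ck_on k U (\<lambda>x. f x + g x)"
proof (induction k arbitrary: f g)
  case 0
  then show ?case by (auto intro: continuous_on_add)
next
  case (Suc k)
  show ?case
  proof (rule Ck_on_SucI[OF U, where g'="\<lambda>x v. frechet_derivative f (at x) v + frechet_derivative g (at x) v"])
    show "((\<lambda>x. f x + g x) has_derivative (\<lambda>v. frechet_derivative f (at x) v + frechet_derivative g (at x) v)) (at x)"
      if "x \<in> U" for x
      using Suc.prems that by (intro has_derivative_add Ck_on_SucD)
  qed (intro Suc.IH Ck_on_SucD(2) Suc.prems)
qed

lemma Ck_on_mult:
  assumes U: "open U" shows "Ck_on k U f \<Longrightarrow> Ck_on k U g \<Longrightarrow> Ck_on k U (\<lambda>x. f x * g x)"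
proof (induction k arbitrary: f g)
  case 0
  then show ?case by (auto intro: continuous_on_mult)
next
  case (Suc k)
  show ?case
  proof (rule Ck_on_SucI[OF U, where g'="\<lambda>x v. f x * frechet_derivative g (at x) v + frechet_derivative f (at x) v * g x"])
    show "((\<lambda>x. f x * g x) has_derivative (\<lambda>v. f x * frechet_derivative g (at x) v + frechet_derivative f (at x) v * g x)) (at x)"
      if "x \<in> U" for x
      using Suc.prems that by (intro has_derivative_mult Ck_on_SucD)
  qed (intro Ck_on_add[OF U] Suc.IH Ck_on_SucD(2) Suc.prems Ck_on_Suc_imp)
qed

lemma Ck_on_sum:
  assumes U: "open U" and "\<And>i. i \<in> I \<Longrightarrow> Ck_on k U (f i)"
  shows "Ck_on k U (\<lambda>x. \<Sum>i\<in>I. f i x)"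
  using assms(2) by (induction I rule: infinite_finite_induct) (auto intro: Ck_on_const Ck_on_add[OF U])

lemma Ck_on_exp:
  assumes U: "open U" shows "Ck_on k U f \<Longrightarrow> Ck_on k U (\<lambda>x. exp (f x))"
proof (induction k arbitrary: f)
  case 0
  then show ?case by (auto intro: continuous_on_exp)
next
  case (Suc k)
  show ?case
  proof (rule Ck_on_SucI[OF U, where g'="\<lambda>x v. exp (f x) * frechet_derivative f (at x) v"])
    show "((\<lambda>x. exp (f x)) has_derivative (\<lambda>v. exp (f x) * frechet_derivative f (at x) v)) (at x)" if "x \<in> U" for x
      using Ck_on_SucD(1)[OF Suc.prems that] by (auto intro!: derivative_eq_intros)
  qed (intro Ck_on_mult[OF U] Suc.IH Ck_on_SucD(2) Suc.prems Ck_on_Suc_imp)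
qed

text \<open>The derivative is a product of derivatives of f and of the inverse itself, one order
  lower, so the induction runs with f fixed.\<close>

lemma Ck_on_inverse:
  assumes U: "open U" and pos: "\<And>x. x \<in> U \<Longrightarrow> f x > 0"
  shows "Ck_on k U f \<Longrightarrow> Ck_on k U (\<lambda>x. inverse (f x))"
proof (induction k)
  case 0
  have "\<And>x. x \<in> U \<Longrightarrow> f x \<noteq> 0" using pos by (metis less_irrefl)
  then show ?case using 0 by (auto intro!: continuous_on_inverse)
next
  case (Suc k)
  show ?case
  proof (rule Ck_on_SucI[OF U, where g'="\<lambda>x v. (- 1) * (inverse (f x) * (frechet_derivative f (at x) v * inverse (f x)))"])
    fix x assume x: "x \<in> U"
    have "f x \<noteq> 0" using pos[OF x] by simp
    from Deriv.has_derivative_inverse[OF this Ck_on_SucD(1)[OF Suc.prems x]]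
    have "((\<lambda>x. inverse (f x)) has_derivative (\<lambda>v. - (inverse (f x) * frechet_derivative f (at x) v * inverse (f x)))) (at x)" .
    then show "((\<lambda>x. inverse (f x)) has_derivative (\<lambda>v. (- 1) * (inverse (f x) * (frechet_derivative f (at x) v * inverse (f x))))) (at x)"
      by (simp add: mult.assoc)
  qed (intro Ck_on_mult[OF U] Ck_on_const Suc.IH Ck_on_SucD(2) Suc.prems Ck_on_Suc_imp)
qed

lemma Ck_on_ln:
  assumes U: "open U" and pos: "\<And>x. x \<in> U \<Longrightarrow> f x > 0" and f: "Ck_on k U f"
  shows "Ck_on k U (\<lambda>x. ln (f x))"
proof (cases k)
  case 0
  have "\<And>x. x \<in> U \<Longrightarrow> f x \<noteq> 0" using pos by (metis less_irrefl)
  then show ?thesis using f 0 by (auto intro!: continuous_on_ln)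
next
  case (Suc m)
  have f: "Ck_on (Suc m) U f" using f Suc by simp
  have "Ck_on (Suc m) U (\<lambda>x. ln (f x))"
  proof (rule Ck_on_SucI[OF U, where g'="\<lambda>x v. inverse (f x) * frechet_derivative f (at x) v"])
    fix x assume x: "x \<in> U"
    show "((\<lambda>x. ln (f x)) has_derivative (\<lambda>v. inverse (f x) * frechet_derivative f (at x) v)) (at x)"
      using Ck_on_SucD(1)[OF f x] pos[OF x] by (auto intro!: derivative_eq_intros simp: divide_inverse)
  qed (intro Ck_on_mult[OF U] Ck_on_inverse[OF U pos] Ck_on_SucD(2) f Ck_on_Suc_imp)
  then show ?thesis by (simp add: Suc)
qed

lemma Ck_on_norm_square:
  assumes U: "open U" shows "Ck_on k U (\<lambda>x. x \<bullet> x)"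
proof (cases k)
  case 0
  then show ?thesis by (auto intro!: continuous_intros)
next
  case (Suc m)
  have "Ck_on (Suc m) U (\<lambda>x. x \<bullet> x)"
  proof (rule Ck_on_SucI[OF U, where g'="\<lambda>x v. (2 *\<^sub>R v) \<bullet> x + 0"])
    show "((\<lambda>x. x \<bullet> x) has_derivative (\<lambda>v. (2 *\<^sub>R v) \<bullet> x + 0)) (at x)" for x :: 'a
      by (auto intro!: derivative_eq_intros simp: inner_commute)
  qed (rule Ck_on_inner[OF U])
  then show ?thesis by (simp add: Suc)
qed

section \<open>Log-sum-exp and the function t ln t\<close>

definition log_sum_exp :: "real \<Rightarrow> ('a::euclidean_space \<times> real) set \<Rightarrow> 'a \<Rightarrow> real" where
  "log_sum_exp k T x = ln (\<Sum>(a, b)\<in>T. exp (k * (a \<bullet> x + b)))"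

lemma sum_exp_pos:
  assumes "finite T" "T \<noteq> {}" shows "(\<Sum>(a, b)\<in>T. exp (k * (a \<bullet> x + b)) :: real) > 0"
  using assms by (intro sum_pos) auto

lemma smooth_on_log_sum_exp:
  assumes T: "finite T" "T \<noteq> {}" shows "Ck_on m UNIV (log_sum_exp k T)"
proof -
  have "Ck_on m UNIV (\<lambda>x. (\<Sum>p\<in>T. exp ((k *\<^sub>R fst p) \<bullet> x + k * snd p)))"
    by (intro Ck_on_sum Ck_on_exp Ck_on_inner open_UNIV)
  moreover have "(\<lambda>x. (\<Sum>p\<in>T. exp ((k *\<^sub>R fst p) \<bullet> x + k * snd p))) = (\<lambda>x. \<Sum>(a, b)\<in>T. exp (k * (a \<bullet> x + b)))"
    by (auto simp: split_beta algebra_simps)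
  ultimately show ?thesis
    unfolding log_sum_exp_def[abs_def] using sum_exp_pos[OF T] by (intro Ck_on_ln open_UNIV) auto
qed

text \<open>The largest exponential is a lower bound for the sum, and \<open>card T\<close> times it
  is an upper bound. The error ln (card T) does not depend on k.\<close>

lemma log_sum_exp_bounds:
  assumes T: "finite T" "T \<noteq> {}" and k: "k \<ge> 0"
  shows "k * max_affine T x \<le> log_sum_exp k T x" "log_sum_exp k T x \<le> k * max_affine T x + ln (real (card T))"
proof -
  let ?S = "\<Sum>(a, b)\<in>T. exp (k * (a \<bullet> x + b))"
  have S: "?S > 0" by (rule sum_exp_pos[OF T])
  obtain a b where ab: "(a, b) \<in> T" "max_affine T x = a \<bullet> x + b" using max_affine_in[OF T] by metis
  have "(\<lambda>(a, b). exp (k * (a \<bullet> x + b))) (a, b) \<le> ?S"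
    using T ab(1) by (intro member_le_sum) auto
  then have "exp (k * max_affine T x) \<le> ?S" by (simp add: ab(2))
  then have "ln (exp (k * max_affine T x)) \<le> ln ?S" using S by (subst ln_le_cancel_iff) auto
  then show "k * max_affine T x \<le> log_sum_exp k T x" by (simp add: log_sum_exp_def)
  have "?S \<le> (\<Sum>p\<in>T. exp (k * max_affine T x))"
    using k max_affine_ge[OF T(1)] by (intro sum_mono) (auto intro!: mult_left_mono)
  also have "\<dots> = real (card T) * exp (k * max_affine T x)" by simp
  finally have "ln ?S \<le> ln (real (card T) * exp (k * max_affine T x))"
    using S by (intro ln_mono) auto
  also have "\<dots> = ln (real (card T)) + k * max_affine T x"
    using T by (subst ln_mult) (auto simp: card_gt_0_iff)
  finally show "log_sum_exp k T x \<le> k * max_affine T x + ln (real (card T))" by (simp add: log_sum_exp_def)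
qed

text \<open>Hoelder's inequality for the two exponential sums, from convexity of the exponential after
  normalizing both sums to one.\<close>

lemma convex_on_log_sum_exp:
  assumes T: "finite T" "T \<noteq> {}" shows "convex_on UNIV (log_sum_exp k T)"
proof (rule convex_onI)
  fix t :: real and x y :: 'a assume t: "0 < t" "t < 1"
  define e where "e p x = k * (fst p \<bullet> x + snd p)" for p and x :: 'a
  define S where "S x = (\<Sum>p\<in>T. exp (e p x))" for x
  have lse: "log_sum_exp k T x = ln (S x)" for x by (simp add: log_sum_exp_def S_def e_def split_beta)
  have S: "S x > 0" for x unfolding S_def using T by (intro sum_pos) auto
  define z where "z = (1 - t) *\<^sub>R x + t *\<^sub>R y"
  define m where "m = (1 - t) * ln (S x) + t * ln (S y)"
  have ez: "e p z = (1 - t) * e p x + t * e p y" for p by (simp add: e_def z_def inner_simps algebra_simps)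
  have "exp (e p z - m) \<le> (1 - t) * (exp (e p x) / S x) + t * (exp (e p y) / S y)" for p
  proof -
    have "e p z - m = (1 - t) * (e p x - ln (S x)) + t * (e p y - ln (S y))"
      by (simp add: ez m_def algebra_simps)
    also have "exp \<dots> \<le> (1 - t) * exp (e p x - ln (S x)) + t * exp (e p y - ln (S y))"
      using convex_onD[OF exp_convex, of t "e p x - ln (S x)" "e p y - ln (S y)"] t by simp
    finally show ?thesis using S by (simp add: exp_diff)
  qed
  then have "(\<Sum>p\<in>T. exp (e p z - m)) \<le> (\<Sum>p\<in>T. (1 - t) * (exp (e p x) / S x) + t * (exp (e p y) / S y))"
    by (intro sum_mono)
  also have "\<dots> = (1 - t) * (S x / S x) + t * (S y / S y)"
    by (simp add: sum.distrib sum_distrib_left[symmetric] sum_divide_distrib[symmetric] S_def)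
  also have "\<dots> = 1" using S[of x] S[of y] by simp
  also have "(\<Sum>p\<in>T. exp (e p z - m)) = S z / exp m"
    by (simp add: exp_diff sum_divide_distrib[symmetric] S_def)
  finally have "S z \<le> exp m" by (simp add: divide_le_eq)
  then have "ln (S z) \<le> m" using S[of z] by (metis exp_gt_zero ln_exp ln_le_cancel_iff)
  then show "log_sum_exp k T ((1 - t) *\<^sub>R x + t *\<^sub>R y) \<le> (1 - t) * log_sum_exp k T x + t * log_sum_exp k T y"
    by (simp add: lse m_def z_def)
qed simp

text \<open>The tangent of t ln t at m lies below the graph, by ln s \<le> s - 1 at s = m / t. The
  end point t = 0 is included thanks to the convention for 0 ln 0.\<close>

lemma xlnx_tangent:
  fixes t m :: real assumes "t \<ge> 0" "m > 0" shows "t * ln m + t - m \<le> t * ln t"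
proof (cases "t = 0")
  case False
  then have t: "t > 0" using assms by simp
  have "ln (m / t) \<le> m / t - 1" using t assms by (intro ln_le_minus_one) simp
  then have "t * ln (m / t) \<le> t * (m / t - 1)" using t by (intro mult_left_mono) auto
  then show ?thesis using t assms by (simp add: ln_div algebra_simps)
qed (use assms in simp)

text \<open>Jensen's argument: average the tangent inequalities at the mean m. Derivatives at the
  end point 0 are thereby avoided.\<close>

lemma xlnx_convex:
  fixes s t u :: real assumes "s \<ge> 0" "t \<ge> 0" "0 < u" "u < 1"
  shows "((1 - u) * s + u * t) * ln ((1 - u) * s + u * t) \<le> (1 - u) * (s * ln s) + u * (t * ln t)"
proof -
  define m where "m = (1 - u) * s + u * t"
  have m0: "m \<ge> 0" using assms by (simp add: m_def)
  show ?thesis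
  proof (cases "m = 0")
    case True
    have "(1 - u) * s \<ge> 0" "u * t \<ge> 0" using assms by auto
    then have "(1 - u) * s = 0" "u * t = 0" using True unfolding m_def by linarith+
    then have "s = 0" "t = 0" using assms by auto
    then show ?thesis by simp
  next
    case False
    then have m: "m > 0" using m0 by simp
    have "(1 - u) * (s * ln m + s - m) + u * (t * ln m + t - m) \<le> (1 - u) * (s * ln s) + u * (t * ln t)"
      using assms m by (intro add_mono mult_left_mono xlnx_tangent) auto
    moreover have "(1 - u) * (s * ln m + s - m) + u * (t * ln m + t - m) = m * ln m"
      by (simp add: m_def algebra_simps)
    ultimately show ?thesis by (simp add: m_def)
  qed
qed

text \<open>Only the point 0 needs care. There ln (1 / sqrt t) \<le> 1 / sqrt t - 1 gives \<bar>t ln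
  t\<bar> \<le> 2 sqrt t for small t.\<close>

lemma continuous_on_xlnx: "continuous_on {0..} (\<lambda>t::real. t * ln t)"
  unfolding continuous_on_def
proof
  fix x :: real assume x: "x \<in> {0..}"
  show "((\<lambda>t. t * ln t) \<longlongrightarrow> x * ln x) (at x within {0..})"
  proof (cases "x = 0")
    case False
    then have "isCont (\<lambda>t. t * ln t) x" using x by (intro continuous_intros) auto
    then have "((\<lambda>t. t * ln t) \<longlongrightarrow> x * ln x) (at x)" by (simp add: isCont_def)
    then show ?thesis by (rule tendsto_within_subset) simp
  next
    case True
    have bd: "\<bar>t * ln t\<bar> \<le> 2 * sqrt t" if t: "0 \<le> t" "t < 1" for t :: real
    proof (cases "t = 0")
      case False
      then have tp: "t > 0" using t by simp
      have "ln (1 / sqrt t) \<le> 1 / sqrt t - 1" using tp by (intro ln_le_minus_one) simp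
      then have "- ln t \<le> 2 / sqrt t" using tp by (simp add: ln_div ln_sqrt)
      then have "t * (- ln t) \<le> t * (2 / sqrt t)" using tp by (intro mult_left_mono) auto
      also have "t * (2 / sqrt t) = 2 * (t / sqrt t)" by simp
      also have "t / sqrt t = sqrt t" using tp by (intro real_div_sqrt) simp
      finally have "- (t * ln t) \<le> 2 * sqrt t" by simp
      moreover have "t * ln t \<le> 0" using tp t by (simp add: mult_nonneg_nonpos)
      ultimately show ?thesis by simp
    qed simp
    have "((\<lambda>t::real. t * ln t) \<longlongrightarrow> 0) (at 0 within {0..})"
    proof (rule Lim_null_comparison)
      show "\<forall>\<^sub>F t in at 0 within {0..}. norm (t * ln t) \<le> 2 * sqrt t"
        unfolding eventually_at by (intro exI[of _ 1]) (auto simp: dist_real_def bd)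
      have "((\<lambda>t. 2 * sqrt t) \<longlongrightarrow> 2 * sqrt 0) (at 0 within {0..})" by (intro tendsto_intros)
      then show "((\<lambda>t. 2 * sqrt t) \<longlongrightarrow> 0) (at 0 within {0..})" by simp
    qed
    then show ?thesis using True by simp
  qed
qed

lemma norm_square_strictly_convex:
  fixes x y :: "'a::real_inner"
  assumes "x \<noteq> y" "0 < t" "t < 1"
  shows "((1 - t) *\<^sub>R x + t *\<^sub>R y) \<bullet> ((1 - t) *\<^sub>R x + t *\<^sub>R y) < (1 - t) * (x \<bullet> x) + t * (y \<bullet> y)"
proof -
  have "(1 - t) * (x \<bullet> x) + t * (y \<bullet> y) - ((1 - t) *\<^sub>R x + t *\<^sub>R y) \<bullet> ((1 - t) *\<^sub>R x + t *\<^sub>R y) =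
      t * (1 - t) * ((x - y) \<bullet> (x - y))"
    by (simp add: inner_simps inner_commute algebra_simps)
  moreover have "t * (1 - t) * ((x - y) \<bullet> (x - y)) > 0" using assms by simp
  ultimately show ?thesis by linarith
qed

section \<open>Symplectic potentials close to multiples of piecewise affine functions\<close>

context extremal_polytope
begin

abbreviation "gui \<equiv> guillemin r lam d"

lemma continuous_on_guillemin: "continuous_on P gui"
  unfolding guillemin_def
  by (intro continuous_on_sum continuous_on_compose2[OF continuous_on_xlnx continuous_on_ell])
     (auto simp: poly_of_def)

lemma ell_interior: assumes "j \<in> {1..r}" "x \<in> interior P" shows "el j x > 0"
proof (rule ccontr)
  assume "\<not> ?thesis"
  have xP: "x \<in> P" using assms interior_subset by blast
  with \<open>\<not> el j x > 0\<close> have "x \<in> F j" using ell_nonneg[OF assms(1) xP] by (simp add: facet_def)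
  then have "x \<in> frontier P" using assms frontier_P by auto
  with assms show False by (simp add: frontier_def)
qed

lemma smooth_on_guillemin: "Ck_on k (interior P) gui"
proof -
  have e: "Ck_on k (interior P) (el j)" for j
    unfolding ell_def[abs_def] by (rule Ck_on_inner) simp
  show ?thesis
    unfolding guillemin_def[abs_def]
    by (intro Ck_on_sum Ck_on_mult Ck_on_ln e ell_interior) auto
qed

lemma convex_guillemin:
  assumes xy: "x \<in> P" "y \<in> P" and t: "0 < t" "t < 1"
  shows "gui ((1 - t) *\<^sub>R x + t *\<^sub>R y) \<le> (1 - t) * gui x + t * gui y"
proof -
  have "gui ((1 - t) *\<^sub>R x + t *\<^sub>R y) \<le> (\<Sum>j\<in>{1..r}. (1 - t) * (el j x * ln (el j x)) + t * (el j y * ln (el j y)))"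
    unfolding guillemin_def
  proof (rule sum_mono)
    fix j assume j: "j \<in> {1..r}"
    have eq: "el j ((1 - t) *\<^sub>R x + t *\<^sub>R y) = (1 - t) * el j x + t * el j y"
      by (simp add: ell_def inner_simps algebra_simps)
    show "el j ((1 - t) *\<^sub>R x + t *\<^sub>R y) * ln (el j ((1 - t) *\<^sub>R x + t *\<^sub>R y))
        \<le> (1 - t) * (el j x * ln (el j x)) + t * (el j y * ln (el j y))"
      unfolding eq using ell_nonneg[OF j] xy t by (intro xlnx_convex) auto
  qed
  then show ?thesis by (simp add: guillemin_def sum.distrib sum_distrib_left)
qed

text \<open>Contraction towards \<open>x0\<close> by a factor below 1 moves P into the interior and
  commutes with convex combinations; continuity lets the factor tend to 1.\<close>

lemma convex_on_P_of_interior: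
  assumes u: "continuous_on P u" "convex_on (interior P) u"
  shows "convex_on P u"
proof (rule convex_onI)
  fix t :: real and x y assume t: "0 < t" "t < 1" and xy: "x \<in> P" "y \<in> P"
  define s where "s n = 1 - 1 / real (Suc n)" for n
  have s: "0 \<le> s n" "s n < 1" for n by (auto simp: s_def)
  have "s \<longlonglongrightarrow> 1 - 0" unfolding s_def using LIMSEQ_inverse_real_of_nat
    by (intro tendsto_diff tendsto_const) (simp add: inverse_eq_divide)
  then have sl: "s \<longlonglongrightarrow> 1" by simp
  have ray: "x0 + s n *\<^sub>R (z - x0) \<in> interior P" if "z \<in> P" for n z
    using interior_ray[OF that] s by simp
  have lim: "(\<lambda>n. u (x0 + s n *\<^sub>R (z - x0))) \<longlonglongrightarrow> u z" if z: "z \<in> P" for z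
  proof -
    have "(\<lambda>n. x0 + s n *\<^sub>R (z - x0)) \<longlonglongrightarrow> x0 + 1 *\<^sub>R (z - x0)" by (intro tendsto_intros sl)
    then have "(\<lambda>n. x0 + s n *\<^sub>R (z - x0)) \<longlonglongrightarrow> z" by simp
    then show ?thesis
      using subsetD[OF interior_subset ray[OF z]] by (intro continuous_on_tendsto_compose[OF u(1) _ z]) auto
  qed
  have zP: "(1 - t) *\<^sub>R x + t *\<^sub>R y \<in> P" using convex_P xy t by (simp add: convex_alt)
  show "u ((1 - t) *\<^sub>R x + t *\<^sub>R y) \<le> (1 - t) * u x + t * u y"
  proof (rule LIMSEQ_le[OF lim[OF zP] tendsto_add[OF tendsto_mult_left[OF lim[OF xy(1)]] tendsto_mult_left[OF lim[OF xy(2)]]]], intro exI allI impI)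
    fix n
    have "x0 + s n *\<^sub>R ((1 - t) *\<^sub>R x + t *\<^sub>R y - x0) = (1 - t) *\<^sub>R (x0 + s n *\<^sub>R (x - x0)) + t *\<^sub>R (x0 + s n *\<^sub>R (y - x0))"
      by (simp add: algebra_simps)
    then show "u (x0 + s n *\<^sub>R ((1 - t) *\<^sub>R x + t *\<^sub>R y - x0)) \<le>
        (1 - t) * u (x0 + s n *\<^sub>R (x - x0)) + t * u (x0 + s n *\<^sub>R (y - x0))"
      using convex_onD[OF u(2) _ _ ray[OF xy(1)] ray[OF xy(2)], of t] t by simp
  qed
qed (rule convex_P)

lemma S_pot_eq: "S_pot r lam d = {f. \<exists>u. (\<forall>x\<in>P. f x = ereal (u x)) \<and>
               smooth_on (interior P) u \<and> strictly_convex_on (interior P) u \<and>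
               smooth_upto_boundary P (\<lambda>x. u x - gui x) \<and>
               (\<forall>F. F face_of P \<longrightarrow> strictly_convex_on (rel_interior F) u)}"
  by (simp add: S_pot_def Let_def)

lemma S_pot_subset: "S_pot r lam d \<subseteq> C_infty P"
proof
  fix f assume "f \<in> S_pot r lam d"
  then obtain u where u: "\<forall>x\<in>P. f x = ereal (u x)" "smooth_on (interior P) u" "strictly_convex_on (interior P) u"
    "smooth_upto_boundary P (\<lambda>x. u x - gui x)" unfolding S_pot_eq by blast
  obtain U h where h: "P \<subseteq> U" "smooth_on U h" "\<forall>x\<in>P. h x = u x - gui x"
    using u(4) by (auto simp: smooth_upto_boundary_def)
  have "Ck_on 0 U h" using h(2) unfolding smooth_on_def by blast
  then have "continuous_on P (\<lambda>x. h x + gui x)"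
    using continuous_on_subset[OF _ h(1)] by (auto intro: continuous_on_add continuous_on_guillemin)
  then have c: "continuous_on P u" using h(3) by (subst (asm) continuous_on_cong[OF refl, of _ _ u]) auto
  have "convex_on (interior P) u"
  proof (rule convex_onI)
    fix t :: real and x y assume t: "0 < t" "t < 1" and xy: "x \<in> interior P" "y \<in> interior P"
    show "u ((1 - t) *\<^sub>R x + t *\<^sub>R y) \<le> (1 - t) * u x + t * u y"
    proof (cases "x = y")
      case True
      then show ?thesis by (simp add: scaleR_left_distrib[symmetric] distrib_right[symmetric])
    next
      case False
      then show ?thesis using u(3) t xy by (auto simp: strictly_convex_on_def intro: less_imp_le)
    qed
  qed (simp add: convex_interior convex_P)
  with c have "convex_on P u" by (rule convex_on_P_of_interior)
  then show "f \<in> C_infty P" using u c by (auto simp: C_infty_def)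
qed

lemma strictly_convex_on_add_affine:
  assumes "strictly_convex_on S u" "\<xi> \<in> affine_funs"
  shows "strictly_convex_on S (\<lambda>x. u x + \<xi> x)"
proof -
  obtain a b where \<xi>: "\<xi> = (\<lambda>x. a \<bullet> x + b)" using assms(2) by (auto simp: affine_funs_def)
  have e: "\<xi> ((1 - t) *\<^sub>R x + t *\<^sub>R y) = (1 - t) * \<xi> x + t * \<xi> y" for t x y
    by (simp add: \<xi> inner_simps algebra_simps)
  show ?thesis
    using assms(1) unfolding strictly_convex_on_def e by (auto simp: distrib_left)
qed

lemma S_pot_add_affine:
  assumes f: "f \<in> S_pot r lam d" and \<xi>: "\<xi> \<in> affine_funs"
  shows "(\<lambda>x. f x + ereal (\<xi> x)) \<in> S_pot r lam d"
proof -
  obtain u where u: "\<forall>x\<in>P. f x = ereal (u x)" "smooth_on (interior P) u" "strictly_convex_on (interior P) u"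
    "smooth_upto_boundary P (\<lambda>x. u x - gui x)" "\<forall>F. F face_of P \<longrightarrow> strictly_convex_on (rel_interior F) u"
    using f unfolding S_pot_eq by blast
  obtain U h where h: "open U" "P \<subseteq> U" "smooth_on U h" "\<forall>x\<in>P. h x = u x - gui x"
    using u(4) by (auto simp: smooth_upto_boundary_def)
  have C\<xi>: "Ck_on k S \<xi>" if "open S" for k S
  proof -
    obtain a b where "\<xi> = (\<lambda>x. a \<bullet> x + b)" using \<xi> by (auto simp: affine_funs_def)
    then show ?thesis using Ck_on_inner[OF that] by simp
  qed
  have "smooth_on U (\<lambda>x. h x + \<xi> x)"
    using h C\<xi> by (auto simp: smooth_on_def intro: Ck_on_add)
  then have "smooth_upto_boundary P (\<lambda>x. (u x + \<xi> x) - gui x)"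
    unfolding smooth_upto_boundary_def using h by (intro exI[of _ U] exI[of _ "\<lambda>x. h x + \<xi> x"]) auto
  moreover have "smooth_on (interior P) (\<lambda>x. u x + \<xi> x)"
    using u(2) C\<xi>[OF open_interior] unfolding smooth_on_def by (auto intro: Ck_on_add[OF open_interior])
  ultimately show ?thesis
    unfolding S_pot_eq using u strictly_convex_on_add_affine[OF _ \<xi>]
    by (intro CollectI exI[of _ "\<lambda>x. u x + \<xi> x"]) auto
qed

text \<open>Each summand has its task: \<open>gui\<close> produces the prescribed behaviour at the
  boundary, the square strict convexity on every face, and log-sum-exp the proximity to
  \<open>k * max_affine T\<close>. There is no division by k, because Guillemin's condition asks for
  \<open>gui\<close> with coefficient one.\<close>

definition smoothing :: "real \<Rightarrow> ((real ^ 'n) \<times> real) set \<Rightarrow> real ^ 'n \<Rightarrow> real" where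
  "smoothing k T x = gui x + x \<bullet> x + log_sum_exp k T x"

lemma smoothing_S_pot:
  assumes T: "finite T" "T \<noteq> {}" shows "(\<lambda>x. ereal (smoothing k T x)) \<in> S_pot r lam d"
proof -
  have sc: "strictly_convex_on S (smoothing k T)" if S: "S \<subseteq> P" "convex S" for S
    unfolding strictly_convex_on_def
  proof (intro conjI ballI impI S(2))
    fix x y t assume xy: "x \<in> S" "y \<in> S" and t: "t \<in> {0<..<1::real}" and ne: "x \<noteq> y"
    have 1: "gui ((1 - t) *\<^sub>R x + t *\<^sub>R y) \<le> (1 - t) * gui x + t * gui y"
      using xy S t by (intro convex_guillemin) auto
    have 2: "((1 - t) *\<^sub>R x + t *\<^sub>R y) \<bullet> ((1 - t) *\<^sub>R x + t *\<^sub>R y) < (1 - t) * (x \<bullet> x) + t * (y \<bullet> y)"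
      using ne t by (intro norm_square_strictly_convex) auto
    have 3: "log_sum_exp k T ((1 - t) *\<^sub>R x + t *\<^sub>R y) \<le> (1 - t) * log_sum_exp k T x + t * log_sum_exp k T y"
      using t by (intro convex_onD[OF convex_on_log_sum_exp[OF T]]) auto
    show "smoothing k T ((1 - t) *\<^sub>R x + t *\<^sub>R y) < (1 - t) * smoothing k T x + t * smoothing k T y"
      unfolding smoothing_def using 1 2 3 by (simp only: distrib_left)
  qed
  have "Ck_on m UNIV (\<lambda>x. x \<bullet> x + log_sum_exp k T x)" for m
    by (intro Ck_on_add Ck_on_norm_square smooth_on_log_sum_exp T open_UNIV)
  then have "smooth_on UNIV (\<lambda>x. x \<bullet> x + log_sum_exp k T x)" by (simp add: smooth_on_def)
  then have "smooth_upto_boundary P (\<lambda>x. smoothing k T x - gui x)"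
    unfolding smooth_upto_boundary_def
    by (intro exI[of _ UNIV] exI[of _ "\<lambda>x. x \<bullet> x + log_sum_exp k T x"]) (auto simp: smoothing_def)
  moreover have "smooth_on (interior P) (smoothing k T)"
    unfolding smooth_on_def smoothing_def[abs_def]
    using Ck_on_subset[OF smooth_on_log_sum_exp[OF T] subset_UNIV]
    by (intro allI Ck_on_add Ck_on_norm_square smooth_on_guillemin) auto
  moreover have "strictly_convex_on (rel_interior F) (smoothing k T)" if "F face_of P" for F
    using that face_of_imp_subset face_of_imp_convex rel_interior_subset
    by (intro sc convex_rel_interior) blast+
  moreover have "strictly_convex_on (interior P) (smoothing k T)"
    by (intro sc interior_subset convex_interior convex_P)
  ultimately show ?thesis unfolding S_pot_eq by blast
qed

lemma continuous_on_smoothing: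
  assumes T: "finite T" "T \<noteq> {}" shows "continuous_on P (smoothing k T)"
proof -
  have "continuous_on UNIV (log_sum_exp k T)" using smooth_on_log_sum_exp[OF T, of 0] by simp
  then show ?thesis
    unfolding smoothing_def[abs_def]
    by (intro continuous_intros continuous_on_guillemin) (rule continuous_on_subset, auto)
qed

lemma Lam_bound:
  obtains K where "K \<ge> 0" "\<And>q c. continuous_on P q \<Longrightarrow> (\<And>x. x \<in> P \<Longrightarrow> \<bar>q x\<bar> \<le> c) \<Longrightarrow> \<bar>Lam q\<bar> \<le> c * K"
proof -
  obtain C where C: "C > 0" "\<And>x. x \<in> P \<Longrightarrow> \<bar>W x\<bar> \<le> C" using W_bound by metis
  define K where "K = measure \<sigma> (frontier P) + C * vol P"
  show ?thesis
  proof (rule that[of K])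
    show "K \<ge> 0" using C vol_pos by (simp add: K_def)
    fix q :: "real ^ 'n \<Rightarrow> real" and c assume q: "continuous_on P q" and c: "\<And>x. x \<in> P \<Longrightarrow> \<bar>q x\<bar> \<le> c"
    have iq: "integrable \<sigma> q" "integrable (leb_on P) q"
      using q by (auto intro: integrable_bdry_continuous integrable_leb_continuous)
    have "\<bar>\<integral>x. q x \<partial>\<sigma>\<bar> \<le> (\<integral>x. \<bar>q x\<bar> \<partial>\<sigma>)" using integral_norm_bound[of \<sigma> q] by simp
    also have "\<dots> \<le> (\<integral>x. c \<partial>\<sigma>)"
      using iq c frontier_subset by (intro integral_mono integrable_abs) auto
    finally have 1: "\<bar>\<integral>x. q x \<partial>\<sigma>\<bar> \<le> c * measure \<sigma> (frontier P)" by (simp add: mult.commute)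
    have "\<bar>\<integral>x. W x * q x \<partial>leb_on P\<bar> \<le> C * (\<integral>x. \<bar>q x\<bar> \<partial>leb_on P)"
      by (rule integral_W_mult_le[OF iq(2) C(2)])
    also have "\<dots> \<le> C * (\<integral>x. c \<partial>leb_on P)"
      using iq c C by (intro mult_left_mono integral_mono integrable_abs) auto
    finally have 2: "\<bar>\<integral>x. W x * q x \<partial>leb_on P\<bar> \<le> C * (c * vol P)" by (simp add: measure_leb mult.commute)
    show "\<bar>Lam q\<bar> \<le> c * K" using 1 2 unfolding Lam_def K_def by (simp add: algebra_simps abs_le_iff)
  qed
qed

lemma Lam_diff:
  assumes "continuous_on P f" "continuous_on P g" shows "Lam (\<lambda>x. f x - g x) = Lam f - Lam g"
proof -
  have i: "integrable \<sigma> f" "integrable \<sigma> g" "integrable (leb_on P) (\<lambda>x. W x * f x)" "integrable (leb_on P) (\<lambda>x. W x * g x)"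
    using assms by (auto intro: integrable_bdry_continuous integrable_leb_continuous integrable_W_mult)
  then show ?thesis by (simp add: Lam_def right_diff_distrib)
qed

text \<open>The elements \<open>smoothing k T\<close> of \<open>S\<close> stay at bounded distance from \<open>k\<close> times the piecewise
  affine function, uniformly in \<open>k\<close>; both sides of the inequality are positively homogeneous, so the error
  disappears after division by \<open>k\<close>.\<close>

lemma cond_b_S_pot_imp_C_PL:
  assumes b: "cond_b r lam d V x0 (S_pot r lam d)"
  shows "cond_b r lam d V x0 (C_PL P)"
proof -
  \<comment> \<open>The smoothed functions are not normalized at \<open>x0\<close>, so (b) does not
    apply to them directly; (J) does.\<close>
  have "cond_J r lam d V (S_pot r lam d)"
    using S_pot_subset C_infty_subset by (intro cond_b_imp_cond_J b S_pot_add_affine) blast+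
  then obtain \<delta> where \<delta>: "\<delta> > 0" "\<And>f. f \<in> S_pot r lam d \<Longrightarrow> ereal \<delta> * J_norm P f \<le> L f"
    by (auto simp: cond_J_def)
  obtain \<kappa> where \<kappa>: "\<kappa> > 0"
    "\<And>f \<xi>. f \<in> normalized P x0 (E1 P) \<Longrightarrow> \<xi> \<in> affine_funs \<Longrightarrow>
      ereal (\<kappa> * (\<integral>x. real_of_ereal (f x) \<partial>leb_on P)) \<le> J_term f \<xi>"
    using J_term_lower by metis
  obtain K where K: "K \<ge> 0" "\<And>q c. continuous_on P q \<Longrightarrow> (\<And>x. x \<in> P \<Longrightarrow> \<bar>q x\<bar> \<le> c) \<Longrightarrow> \<bar>Lam q\<bar> \<le> c * K"
    using Lam_bound by metis
  have "bounded ((\<lambda>x. gui x + x \<bullet> x) ` P)"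
    by (intro compact_imp_bounded compact_continuous_image compact_P continuous_intros continuous_on_guillemin)
  then obtain M where M: "M > 0" "\<And>x. x \<in> P \<Longrightarrow> \<bar>gui x + x \<bullet> x\<bar> \<le> M" unfolding bounded_pos by auto
  show ?thesis
  proof (rule cond_b_if_integral_bound)
    show "C_PL P \<subseteq> E1 P" using C_PL_subset C_star_subset by blast
    show "\<delta> * \<kappa> > 0" using \<delta> \<kappa> by simp
    fix f assume f: "f \<in> normalized P x0 (C_PL P)"
    then obtain T where T: "finite T" "T \<noteq> {}" "\<And>x. x \<in> P \<Longrightarrow> f x = ereal (max_affine T x)"
      using normalizedD(1)[OF f] unfolding C_PL_eq by blast
    define g where "g = max_affine T"
    have cg: "continuous_on P g" unfolding g_def by (rule continuous_on_max_affine[OF T(1,2)])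
    have xg: "convex_on P g" unfolding g_def
      by (rule convex_on_subset[OF convex_on_max_affine[OF T(1,2)] subset_UNIV convex_P])
    have gn: "0 \<le> g x" if "x \<in> P" for x using normalizedD(2)[OF f that] T(3)[OF that] by (simp add: g_def)
    have g0: "g x0 = 0" using normalizedD(3)[OF f] T(3)[OF x0_P] by (simp add: g_def)
    have Lf: "L f = ereal (Lam g)" using L_real(2)[OF cg, of f] T(3) by (simp add: g_def)
    define I where "I = (\<integral>x. g x \<partial>leb_on P)"
    have If: "(\<integral>x. real_of_ereal (f x) \<partial>leb_on P) = I"
      unfolding I_def using T(3) by (intro Bochner_Integration.integral_cong) (auto simp: g_def)
    \<comment> \<open>Bounds the distance on P between the smoothing and k times the piecewise
      affine function: M for the Guillemin and quadratic terms, the logarithm for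
      log-sum-exp.\<close>
    define c where "c = M + ln (real (card T))"
    have lnT: "ln (real (card T)) \<ge> 0" using T by (simp add: card_gt_0_iff Suc_leI)
    have main: "real k * (\<delta> * \<kappa> * I - Lam g) \<le> c * K + 2 * \<delta> * c" if k: "k > 0" for k :: nat
    proof -
      define u where "u = smoothing (real k) T"
      have cu: "continuous_on P u" unfolding u_def by (rule continuous_on_smoothing[OF T(1,2)])
      have near: "\<bar>u x - real k * g x\<bar> \<le> c" if "x \<in> P" for x
        using log_sum_exp_bounds[OF T(1,2), of "real k" x] M(2)[OF that] lnT
        unfolding u_def smoothing_def g_def c_def abs_le_iff by linarith
      define kg where "kg x = ereal (real k * g x)" for x
      have ckg: "continuous_on P (\<lambda>x. real k * g x)" using cg by (intro continuous_intros)
      have kgE: "kg \<in> normalized P x0 (E1 P)"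
      proof (rule normalizedI)
        show "kg \<in> E1 P"
          by (rule E1_continuous[of "\<lambda>x. real k * g x"]) (use ckg xg in \<open>auto simp: kg_def intro!: convex_on_cmul\<close>)
      qed (use gn g0 in \<open>auto simp: kg_def zero_ereal_def\<close>)
      have ikg: "(\<integral>x. real_of_ereal (kg x) \<partial>leb_on P) = real k * I" by (simp add: kg_def I_def)
      \<comment> \<open>The loss is c in the mean and c in the infimum. The lower bound holds for
        every affine \<xi>, so it passes to the J-norm of the smoothing without a choice of
        minimizer.\<close>
      have Jt: "ereal (\<kappa> * (real k * I) - 2 * c) \<le> J_term (\<lambda>x. ereal (u x)) \<xi>" if \<xi>: "\<xi> \<in> affine_funs" for \<xi>
      proof -
        define A where "A = (INF x\<in>P. ereal (u x) + ereal (\<xi> x))"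
        define B where "B = (INF x\<in>P. kg x + ereal (\<xi> x))"
        define au where "au = 1 / vol P * (\<integral>x. u x + \<xi> x \<partial>leb_on P)"
        define ag where "ag = 1 / vol P * (\<integral>x. real k * g x + \<xi> x \<partial>leb_on P)"
        have c\<xi>: "continuous_on P \<xi>" using \<xi> by (rule continuous_on_affine)
        have "A - ereal c \<le> B"
          unfolding B_def
        proof (rule INF_greatest)
          fix x assume x: "x \<in> P"
          have "A \<le> ereal (u x) + ereal (\<xi> x)" unfolding A_def by (rule INF_lower[OF x])
          also have "\<dots> \<le> ereal (real k * g x + \<xi> x + c)" using near[OF x] by simp
          finally show "A - ereal c \<le> kg x + ereal (\<xi> x)" by (cases A) (auto simp: kg_def)
        qed
        have "(\<integral>x. real k * g x + \<xi> x - c \<partial>leb_on P) \<le> (\<integral>x. u x + \<xi> x \<partial>leb_on P)"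
        proof (rule integral_mono)
          show "integrable (leb_on P) (\<lambda>x. real k * g x + \<xi> x - c)" "integrable (leb_on P) (\<lambda>x. u x + \<xi> x)"
            using ckg c\<xi> cu by (auto intro!: integrable_leb_continuous continuous_intros)
          fix x assume "x \<in> space (leb_on P)"
          then show "real k * g x + \<xi> x - c \<le> u x + \<xi> x" using near[of x] by simp
        qed
        moreover have "(\<integral>x. real k * g x + \<xi> x - c \<partial>leb_on P) = (\<integral>x. real k * g x + \<xi> x \<partial>leb_on P) - c * vol P"
        proof -
          have "integrable (leb_on P) (\<lambda>x. real k * g x + \<xi> x)"
            using ckg c\<xi> by (auto intro!: integrable_leb_continuous continuous_intros)
          then show ?thesis by (subst Bochner_Integration.integral_diff) (auto simp: measure_leb)
        qed
        ultimately have "1 / vol P * ((\<integral>x. real k * g x + \<xi> x \<partial>leb_on P) - c * vol P) \<le> au"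
          unfolding au_def using vol_pos by (intro mult_left_mono) auto
        then have a: "ag - c \<le> au" unfolding ag_def using vol_pos by (simp add: right_diff_distrib)
        have "ereal (\<kappa> * (real k * I)) \<le> ereal ag - B"
          using \<kappa>(2)[OF kgE \<xi>] unfolding ikg by (simp add: J_term_def B_def ag_def kg_def)
        with \<open>A - ereal c \<le> B\<close> a have "ereal (\<kappa> * (real k * I) - 2 * c) \<le> ereal au - A"
          by (cases A; cases B) auto
        then show ?thesis by (simp add: J_term_def A_def au_def)
      qed
      have "ereal (\<kappa> * (real k * I) - 2 * c) \<le> J_norm P (\<lambda>x. ereal (u x))"
        unfolding J_norm_eq by (intro INF_greatest Jt)
      then have "ereal \<delta> * ereal (\<kappa> * (real k * I) - 2 * c) \<le> ereal \<delta> * J_norm P (\<lambda>x. ereal (u x))"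
        using \<delta> by (intro ereal_mult_left_mono) auto
      also have "\<dots> \<le> L (\<lambda>x. ereal (u x))" unfolding u_def by (intro \<delta>(2) smoothing_S_pot T(1,2))
      also have "\<dots> = ereal (Lam u)" by (rule L_real(2)[OF cu]) simp
      finally have "\<delta> * (\<kappa> * (real k * I) - 2 * c) \<le> Lam u" by simp
      moreover have "\<bar>Lam (\<lambda>x. u x - real k * g x)\<bar> \<le> c * K"
        using near by (intro K(2) continuous_on_diff cu ckg) auto
      then have "\<bar>Lam u - real k * Lam g\<bar> \<le> c * K"
        by (simp add: Lam_diff[OF cu ckg] Lam_scale)
      ultimately show ?thesis by (simp add: algebra_simps abs_le_iff)
    qed
    have "\<delta> * \<kappa> * I \<le> Lam g"
    proof (rule ccontr)
      assume "\<not> ?thesis"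
      then have p: "\<delta> * \<kappa> * I - Lam g > 0" by simp
      obtain k :: nat where k: "c * K + 2 * \<delta> * c < real k * (\<delta> * \<kappa> * I - Lam g)"
        using reals_Archimedean3[OF p] by blast
      have "real (Suc k) * (\<delta> * \<kappa> * I - Lam g) \<le> c * K + 2 * \<delta> * c" by (rule main) simp
      moreover have "real k * (\<delta> * \<kappa> * I - Lam g) \<le> real (Suc k) * (\<delta> * \<kappa> * I - Lam g)"
        using p by (intro mult_right_mono) auto
      ultimately show False using k by linarith
    qed
    then show "ereal (\<delta> * \<kappa> * (\<integral>x. real_of_ereal (f x) \<partial>leb_on P)) \<le> L f"
      by (simp add: If Lf)
  qed
qed

end

theorem theorem1p0p1:
  fixes r :: nat and lam :: "nat \<Rightarrow> int ^ 'n" and d :: "nat \<Rightarrow> int"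
    and x0 :: "real ^ 'n" and V :: "real ^ 'n \<Rightarrow> real"
    and P :: "(real ^ 'n) set" and \<F> :: "(real ^ 'n \<Rightarrow> ereal) set"
  assumes "P = poly_of r lam d"
    and "integral_delzant r lam d"
    and "x0 \<in> interior P"
    and "extremal_affine r lam d V"
    and "\<F> \<in> {E1 P, C_star r lam d, C_PL P, C_PL_rat P, C_infty P, S_pot r lam d}"
  shows "(cond_b r lam d V x0 \<F> \<longleftrightarrow> cond_J r lam d V \<F>) \<and>
         (cond_J r lam d V \<F> \<longleftrightarrow> cond_K r lam d V (C_star r lam d)) \<and>
         (cond_K r lam d V (C_star r lam d) \<longleftrightarrow> cond_K r lam d V (E1 P))"
proof -
  interpret delzant_polytope r lam d x0
    using assms by unfold_locales auto
  interpret extremal_polytope r lam d x0 V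
    using assms by unfold_locales auto
  let ?P = "poly_of r lam d"
  \<comment> \<open>Each class contains one of the two smallest ones, the rational piecewise affine
    functions or S, and from either of them (b) reaches \<open>C_PL_rat ?P\<close>. The smooth class
    \<open>C_infty P\<close> is covered through S.\<close>
  have F: "\<F> \<subseteq> E1 ?P" and PL: "C_PL_rat ?P \<subseteq> \<F> \<or> S_pot r lam d \<subseteq> \<F>"
    using assms(1,5) C_star_subset C_PL_subset C_PL_rat_subset C_infty_subset S_pot_subset by blast+
  have "cond_b r lam d V x0 (C_PL_rat ?P)" if "cond_b r lam d V x0 \<F>"
    using PL cond_b_mono[OF _ that] cond_b_S_pot_imp_C_PL cond_b_mono[OF C_PL_rat_subset] by blast
  then have b_E1: "cond_b r lam d V x0 (E1 ?P)" if "cond_b r lam d V x0 \<F>"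
    using that cond_b_C_PL_rat_imp_E1 by blast
  have J_b: "cond_b r lam d V x0 \<F>" if "cond_J r lam d V \<F>"
    using F that by (rule cond_J_imp_cond_b)
  \<comment> \<open>Obtained on \<open>E1 ?P\<close>, which is closed under affine functions, and
    then restricted; this treats all six classes at once.\<close>
  have E1_J: "cond_J r lam d V \<F>" if "cond_b r lam d V x0 (E1 ?P)"
    using cond_J_mono[OF F cond_b_imp_cond_J[OF subset_refl E1_add_affine that]] by simp
  have E1_K: "cond_K r lam d V (E1 ?P)" if "cond_b r lam d V x0 (E1 ?P)"
    using that by (rule cond_b_E1_imp_cond_K)
  have K_K: "cond_K r lam d V (C_star r lam d)" if "cond_K r lam d V (E1 ?P)"
    using C_star_subset that by (rule cond_K_mono)
  have K_E1: "cond_b r lam d V x0 (E1 ?P)" if "cond_K r lam d V (C_star r lam d)"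
    using cond_b_C_PL_rat_imp_E1[OF cond_b_mono[OF C_PL_rat_subset cond_K_C_star_imp_cond_b[OF that]]] .
  show ?thesis
    using b_E1 J_b E1_J E1_K K_K K_E1 assms(1) by blast
qed

end
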